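(* Let $\{(S_n,J_n);n\ge0\}$ be a discrete-time Markov additive process as in the context satisfying the assumptions listed there, with mean drift $h$, and let $M_n=\max_{0\le k\le n}S_k$. Let $T$ be a nonnegative random variable independent of $\{(S_n,J_n)\}$. Suppose that $T\in\mathcal{C}$ and that there exists a nonnegative random variable $Y\in\mathcal{S}$ such that (entrywise) $$\int_{|y|>x}d\boldsymbol{\beta}(y)=O(\mathbb{P}(Y>x)),\qquad \int_{|y|>x}d\boldsymbol{H}(y)=O(\mathbb{P}(Y>x)),$$ and $$\lim_{x\to\infty}\mathbb{E}\big[T\cdot\mathbf{1}(T\le x,\ N(T)\le x/\mathbb{E}[\Delta\tau_1])\big]\frac{\mathbb{P}(Y>x)}{\mathbb{P}(T>x)}=0.$$ Then $\mathbb{P}(S_{\lfloor T\rfloor}>hx)\sim\mathbb{P}(M_{\lfloor T\rfloor}>hx)\sim\mathbb{P}(T>x)$ as $x\to\infty$.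
   Context: Let $\mathbb{D}=\{0,\dots,d-1\}$. $\{J_n\}$ is a Markov chain on $\mathbb{D}$ and $X_0,X_1,\dots$ are real r.v.s with $\mathbb{P}(X_0\le x,J_0=i)=\beta_i(x)$ and, conditionally on the past up to time $n$ and on $J_n=i$, $\mathbb{P}(X_{n+1}\le x,J_{n+1}=j\mid\cdot)=H_{i,j}(x)$, with $\sum_i\beta_i(\infty)=1$, $\sum_jH_{i,j}(\infty)=1$. $S_n=\sum_{\nu=0}^nX_\nu$; $\boldsymbol{\beta}(x)=(\beta_i(x))$, $\boldsymbol{H}(x)=(H_{i,j}(x))$. Assumptions: $\boldsymbol{H}(\infty)$ is irreducible stochastic, and $h:=\boldsymbol{\varpi}\int x\,d\boldsymbol{H}(x)\mathbf{e}\in(0,\infty)$ ($\boldsymbol{\varpi}$ stationary vector of $\boldsymbol{H}(\infty)$, $\mathbf{e}$ all-ones vector). Let $0\le\tau_0<\tau_1<\cdots$ be the successive hitting times of state $0$ by $\{J_n\}$, $\Delta\tau_i=\tau_i-\tau_{i-1}$ ($i\ge1$), and $N(t)=\max\{k\ge0:\sum_{i=1}^k\Delta\tau_i\le t\}$. $f=O(g)$ means $\limsup f/g<\infty$; $f\sim g$ means $f/g\to1$. Class $\mathcal{S}$ (subexponential): nonnegative $X$ with $\mathbb{P}(X>x)>0$ for all $x\ge0$ and $\mathbb{P}(X_1+X_2>x)\sim2\mathbb{P}(X>x)$ for independent copies $X_1,X_2$ of $X$. Class $\mathcal{C}$: nonnegative $X$ with $\mathbb{P}(X>x)>0$ for all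 $x$ and $\lim_{v\downarrow1}\liminf_{x\to\infty}\mathbb{P}(X>vx)/\mathbb{P}(X>x)=1$. *)

theory Defs
  imports "HOL-Probability.Probability" "HOL-Library.Landau_Symbols"
begin

definition tail :: "real measure \<Rightarrow> real \<Rightarrow> real" where
  "tail \<mu> x = measure \<mu> {x<..}"

definition subexponential :: "real measure \<Rightarrow> bool" where
  "subexponential \<mu> \<longleftrightarrow> prob_space \<mu> \<and> sets \<mu> = sets borel \<and>
     measure \<mu> {..<0} = 0 \<and> (\<forall>x\<ge>0. tail \<mu> x > 0) \<and>
     ((\<lambda>x. tail (\<mu> \<star> \<mu>) x) \<sim>[at_top] (\<lambda>x. 2 * tail \<mu> x))"

definition class_C :: "real measure \<Rightarrow> bool" where
  "class_C \<mu> \<longleftrightarrow> prob_space \<mu> \<and> sets \<mu> = sets borel \<and>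
     measure \<mu> {..<0} = 0 \<and> (\<forall>x. tail \<mu> x > 0) \<and>
     ((\<lambda>v. Liminf at_top (\<lambda>x. ereal (tail \<mu> (v * x) / tail \<mu> x))) \<longlongrightarrow> 1) (at_right 1)"

fun mpow :: "nat \<Rightarrow> (nat \<Rightarrow> nat \<Rightarrow> real) \<Rightarrow> nat \<Rightarrow> nat \<Rightarrow> nat \<Rightarrow> real" where
  "mpow d P 0 = (\<lambda>i j. if i = j then 1 else 0)"
| "mpow d P (Suc n) = (\<lambda>i j. \<Sum>k<d. mpow d P n i k * P k j)"

definition stochastic_matrix :: "nat \<Rightarrow> (nat \<Rightarrow> nat \<Rightarrow> real) \<Rightarrow> bool" where
  "stochastic_matrix d P \<longleftrightarrow> (\<forall>i<d. \<forall>j<d. P i j \<ge> 0) \<and> (\<forall>i<d. (\<Sum>j<d. P i j) = 1)"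

definition irreducible_matrix :: "nat \<Rightarrow> (nat \<Rightarrow> nat \<Rightarrow> real) \<Rightarrow> bool" where
  "irreducible_matrix d P \<longleftrightarrow> (\<forall>i<d. \<forall>j<d. \<exists>n. mpow d P n i j > 0)"

definition stationary_vector :: "nat \<Rightarrow> (nat \<Rightarrow> nat \<Rightarrow> real) \<Rightarrow> (nat \<Rightarrow> real) \<Rightarrow> bool" where
  "stationary_vector d P \<pi> \<longleftrightarrow> (\<forall>i<d. \<pi> i \<ge> 0) \<and> (\<Sum>i<d. \<pi> i) = 1 \<and>
     (\<forall>j<d. (\<Sum>i<d. \<pi> i * P i j) = \<pi> j)"

definition distr_fun :: "(real \<Rightarrow> real) \<Rightarrow> bool" where
  "distr_fun F \<longleftrightarrow> mono F \<and> (\<forall>x. continuous (at_right x) F) \<and> (F \<longlongrightarrow> 0) at_bot \<and>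
     (\<exists>c. (F \<longlongrightarrow> c) at_top)"

definition Hinf :: "(nat \<Rightarrow> nat \<Rightarrow> real \<Rightarrow> real) \<Rightarrow> nat \<Rightarrow> nat \<Rightarrow> real" where
  "Hinf H i j = Lim at_top (H i j)"

definition past_events :: "'a measure \<Rightarrow> (nat \<Rightarrow> 'a \<Rightarrow> real) \<Rightarrow> (nat \<Rightarrow> 'a \<Rightarrow> nat) \<Rightarrow> nat \<Rightarrow> 'a set set" where
  "past_events M X J n = sigma_sets (space M)
     (\<Union>k\<in>{..n}. {X k -` B \<inter> space M | B. B \<in> sets borel} \<union> {J k -` C \<inter> space M | C. True})"

definition process_events :: "'a measure \<Rightarrow> (nat \<Rightarrow> 'a \<Rightarrow> real) \<Rightarrow> (nat \<Rightarrow> 'a \<Rightarrow> nat) \<Rightarrow> 'a set set" where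
  "process_events M X J = sigma_sets (space M)
     (\<Union>k. {X k -` B \<inter> space M | B. B \<in> sets borel} \<union> {J k -` C \<inter> space M | C. True})"

definition rv_events :: "'a measure \<Rightarrow> ('a \<Rightarrow> real) \<Rightarrow> 'a set set" where
  "rv_events M T = {T -` B \<inter> space M | B. B \<in> sets borel}"

text \<open>The MAP with initial law beta and kernel H: P(X_0 <= x, J_0 = i) = beta_i(x), and
  P(X_{n+1} <= x, J_{n+1} = j | F_n) = H_{J_n, j}(x), expressed via the defining property
  of conditional probability on the events A of F_n.\<close>
definition is_MAP :: "'a measure \<Rightarrow> nat \<Rightarrow> (nat \<Rightarrow> 'a \<Rightarrow> real) \<Rightarrow> (nat \<Rightarrow> 'a \<Rightarrow> nat)
    \<Rightarrow> (nat \<Rightarrow> real \<Rightarrow> real) \<Rightarrow> (nat \<Rightarrow> nat \<Rightarrow> real \<Rightarrow> real) \<Rightarrow> bool" where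
  "is_MAP M d X J \<beta> H \<longleftrightarrow> prob_space M \<and> 0 < d \<and>
     (\<forall>n. X n \<in> borel_measurable M) \<and> (\<forall>n. J n \<in> measurable M (count_space UNIV)) \<and>
     (\<forall>n. \<forall>\<omega>\<in>space M. J n \<omega> < d) \<and>
     (\<forall>i<d. \<forall>x. measure M {\<omega>\<in>space M. X 0 \<omega> \<le> x \<and> J 0 \<omega> = i} = \<beta> i x) \<and>
     (\<forall>i<d. \<forall>j<d. distr_fun (H i j)) \<and>
     (\<forall>n. \<forall>A\<in>past_events M X J n. \<forall>i<d. \<forall>j<d. \<forall>x.
        measure M (A \<inter> {\<omega>\<in>space M. J n \<omega> = i \<and> X (Suc n) \<omega> \<le> x \<and> J (Suc n) \<omega> = j})
        = H i j x * measure M (A \<inter> {\<omega>\<in>space M. J n \<omega> = i}))"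

definition drift :: "nat \<Rightarrow> (nat \<Rightarrow> nat \<Rightarrow> real \<Rightarrow> real) \<Rightarrow> (nat \<Rightarrow> real) \<Rightarrow> real" where
  "drift d H \<pi> = (\<Sum>i<d. \<pi> i * (\<Sum>j<d. integral\<^sup>L (interval_measure (H i j)) (\<lambda>y. y)))"

definition Ssum :: "(nat \<Rightarrow> 'a \<Rightarrow> real) \<Rightarrow> nat \<Rightarrow> 'a \<Rightarrow> real" where
  "Ssum X n \<omega> = (\<Sum>\<nu>\<le>n. X \<nu> \<omega>)"

definition Smax :: "(nat \<Rightarrow> 'a \<Rightarrow> real) \<Rightarrow> nat \<Rightarrow> 'a \<Rightarrow> real" where
  "Smax X n \<omega> = Max {Ssum X k \<omega> | k. k \<le> n}"

text \<open>tau_k = (k+1)-st time n >= 0 with J_n = 0 (tau_0 is the first hitting time).\<close>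
definition hit_time :: "(nat \<Rightarrow> 'a \<Rightarrow> nat) \<Rightarrow> nat \<Rightarrow> 'a \<Rightarrow> nat" where
  "hit_time J k \<omega> = enumerate {n. J n \<omega> = 0} k"

text \<open>N(t) = max{k >= 0 : sum_{i=1}^k Delta tau_i <= t} = max{k : tau_k - tau_0 <= t}.\<close>
definition Ncount :: "(nat \<Rightarrow> 'a \<Rightarrow> nat) \<Rightarrow> real \<Rightarrow> 'a \<Rightarrow> nat" where
  "Ncount J t \<omega> = (GREATEST k. real (hit_time J k \<omega> - hit_time J 0 \<omega>) \<le> t)"

end

theory Submission
  imports Defs "Jordan_Normal_Form.Determinant"
begin

text \<open>A solution \<open>g\<close> of the Poisson equation of the chain turns \<open>S\<^sub>n - X\<^sub>0 - n h\<close> into a martingale,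
  up to a bounded term, so no regeneration is needed.  Put \<open>G(x) = P(T > x) / E(min(T, x))\<close>.
  Because \<open>N(T) \<le> T\<close> and \<open>T\<close> has dominated variation, the hypotheses make the tails of the increments
  \<open>o(G)\<close>.  A Fuk--Nagaev argument (truncation at \<open>\<eta> x / 2\<close> and an exponential supermartingale with parameter
  about \<open>ln (1 / (n G(x))) / x\<close>) then bounds the probability that the martingale exceeds \<open>\<eta> x\<close> before
  time \<open>n \<le> x\<close> by \<open>\<epsilon> n G(x)\<close>.  Summing over \<open>n = \<lfloor>T\<rfloor> \<le> x\<close> costs at most
  \<open>\<epsilon> E(min(T, x)) G(x) = \<epsilon> P(T > x)\<close>, and with \<open>n = x\<close> the same bound is the weak law behind the
  lower estimate.\<close>

section \<open>The Poisson equation of a finite chain\<close>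

text \<open>The increments have only a first moment, so no variance is available, and a deviation
  probability that is merely o(1) would be too weak: it has to be proportional to \<open>n\<close>.
  Dominated variation of G enters twice. It provides \<open>c\<close> with G(2 t) >= c G(t); a
  moment of order \<open>m\<close> with 2^m >= 2 / c, truncated at y and divided by y^m, is then
  still o(G(y)), because each doubling of y shrinks it by 2^(-m) while G loses at most the factor
  \<open>c\<close>. It also makes G decay at most polynomially, so ln (1 / G(y)) = o(y), the
  exponential parameter tends to 0 uniformly in 1 <= n <= x, and the expansion of the exponential
  moment holds up to an error of smaller order than the parameter. The truncation level is half the
  target, so the exponent gained at the target is twice the growth that the centred walk can
  accumulate. That the increments are o(G) has two sources, as E(min(T, x)) <= E(T; T <= a x) + x
  P(T > a x): the limit hypothesis controls the first term, integrability of the increments the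
  second.\<close>

lemma mpow_nonneg:
  assumes "stochastic_matrix d P" "i < d" "j < d"
  shows "mpow d P n i j \<ge> 0"
  using assms(3)
proof (induction n arbitrary: j)
  case (Suc n)
  then show ?case using assms(1)
    by (auto intro!: sum_nonneg mult_nonneg_nonneg simp: stochastic_matrix_def)
qed auto

lemma mpow_row_sum:
  assumes "stochastic_matrix d P" "i < d"
  shows "(\<Sum>j<d. mpow d P n i j) = 1"
proof (induction n)
  case (Suc n)
  have "(\<Sum>j<d. mpow d P (Suc n) i j) = (\<Sum>k<d. mpow d P n i k * (\<Sum>j<d. P k j))"
    unfolding sum_distrib_left mpow.simps by (rule sum.swap)
  also have "\<dots> = (\<Sum>k<d. mpow d P n i k)"
    using assms by (intro sum.cong) (auto simp: stochastic_matrix_def)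
  finally show ?case using Suc by simp
qed (use assms in \<open>auto simp: if_distrib sum.delta\<close>)

lemma harmonic_mpow:
  assumes "\<And>i. i < d \<Longrightarrow> (\<Sum>j<d. P i j * v j) = v i" "i < d"
  shows "(\<Sum>j<d. mpow d P n i j * v j) = v i"
proof (induction n)
  case 0
  have "(\<Sum>j<d. mpow d P 0 i j * v j) = (\<Sum>j<d. if i = j then v j else 0)"
    by (intro sum.cong) auto
  then show ?case using assms by simp
next
  case (Suc n)
  have "(\<Sum>j<d. mpow d P (Suc n) i j * v j) = (\<Sum>k<d. mpow d P n i k * (\<Sum>j<d. P k j * v j))"
    unfolding sum_distrib_left sum_distrib_right mpow.simps mult.assoc by (rule sum.swap)
  also have "\<dots> = (\<Sum>k<d. mpow d P n i k * v k)"
    using assms by (intro sum.cong) auto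
  finally show ?case using Suc by simp
qed

text \<open>Maximum principle: at a maximal point \<open>i0\<close> the average of the nonnegative
  deficits \<open>v i0 - v l\<close> vanishes under every power of \<open>P\<close>, and
  irreducibility puts positive weight on each state for some power.\<close>

lemma harmonic_imp_constant:
  assumes st: "stochastic_matrix d P" and irr: "irreducible_matrix d P"
    and harm: "\<And>i. i < d \<Longrightarrow> (\<Sum>j<d. P i j * v j) = v i"
    and "i < d" "j < d"
  shows "v i = v j"
proof -
  have fin: "finite (v ` {..<d})" "v ` {..<d} \<noteq> {}" using \<open>i < d\<close> by auto
  then obtain i0 where i0: "i0 < d" "v i0 = Max (v ` {..<d})"
    using Max_in[OF fin] by (metis imageE lessThan_iff)
  have le: "v k \<le> v i0" if "k < d" for k
    unfolding i0(2) using that by (intro Max_ge) auto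
  have eq: "v k = v i0" if k: "k < d" for k
  proof -
    obtain n where n: "mpow d P n i0 k > 0"
      using irr i0 k by (auto simp: irreducible_matrix_def)
    have "(\<Sum>l<d. mpow d P n i0 l * (v i0 - v l)) = 0"
      using harmonic_mpow[OF harm i0(1), of n] mpow_row_sum[OF st i0(1), of n]
      by (simp add: algebra_simps sum_subtractf flip: sum_distrib_left)
    then have "mpow d P n i0 k * (v i0 - v k) = 0"
      using k le mpow_nonneg[OF st i0(1)] by (subst (asm) sum_nonneg_eq_0_iff) auto
    with n show ?thesis by simp
  qed
  show ?thesis using eq[OF \<open>i < d\<close>] eq[OF \<open>j < d\<close>] by simp
qed

text \<open>Uniqueness gives existence: a trivial kernel makes the determinant nonzero, and the
  inverse matrix yields the solution.\<close>

lemma square_system_solvable: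
  fixes a :: "nat \<Rightarrow> nat \<Rightarrow> real"
  assumes inj: "\<And>v. (\<And>i. i < d \<Longrightarrow> (\<Sum>j<d. a i j * v j) = 0) \<Longrightarrow> (\<And>i. i < d \<Longrightarrow> v i = 0)"
  obtains g where "\<And>i. i < d \<Longrightarrow> (\<Sum>j<d. a i j * g j) = f i"
proof -
  define A where "A = mat d d (\<lambda>(i, j). a i j)"
  have A: "A \<in> carrier_mat d d" by (simp add: A_def)
  have mv: "vec_index (A *\<^sub>v w) i = (\<Sum>j<d. a i j * vec_index w j)"
    if "w \<in> carrier_vec d" "i < d" for w i
    using that by (simp add: A_def scalar_prod_def lessThan_atLeast0)
  have "det A \<noteq> 0"
  proof
    assume "det A = 0"
    then obtain w where w: "w \<in> carrier_vec d" "w \<noteq> 0\<^sub>v d" "A *\<^sub>v w = 0\<^sub>v d"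
      using det_0_iff_vec_prod_zero_field[OF A] by auto
    have "vec_index w i = 0" if "i < d" for i
      using inj[of "vec_index w"] mv[OF w(1)] w(3) that by (metis index_zero_vec(1))
    then have "w = 0\<^sub>v d" using w(1) by (intro eq_vecI) auto
    with w show False by simp
  qed
  then obtain B where B: "B \<in> carrier_mat d d" "A * B = 1\<^sub>m d"
    using det_non_zero_imp_unit[OF A] by (auto simp: Units_def ring_mat_def)
  define w where "w = B *\<^sub>v vec d f"
  have w: "w \<in> carrier_vec d" using B by (auto simp: w_def)
  have "A *\<^sub>v w = vec d f"
    unfolding w_def using B A by (subst assoc_mult_mat_vec[symmetric, of _ d d _ d]) auto
  then have "(\<Sum>j<d. a i j * vec_index w j) = f i" if "i < d" for i
    using mv[OF w that] that by simp
  then show ?thesis using that by blast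
qed

text \<open>Adding the rank-one term \<open>\<pi> g\<close> makes the singular system \<open>(I - P) g = f\<close> injective,
  and the term vanishes at the solution because \<open>\<pi> f = 0\<close>.\<close>

lemma poisson_equation:
  assumes st: "stochastic_matrix d P" and irr: "irreducible_matrix d P"
    and pi: "stationary_vector d P \<pi>" and f: "(\<Sum>i<d. \<pi> i * f i) = 0"
  obtains g where "\<And>i. i < d \<Longrightarrow> f i + (\<Sum>j<d. P i j * g j) = g i"
proof -
  define a where "a i j = (if i = j then 1 else 0) - P i j + \<pi> j" for i j
  have a: "(\<Sum>j<d. a i j * v j) = v i - (\<Sum>j<d. P i j * v j) + (\<Sum>j<d. \<pi> j * v j)"
    if "i < d" for i v
  proof -
    have "(\<Sum>j<d. a i j * v j) = (\<Sum>j<d. (if i = j then v j else 0)) - (\<Sum>j<d. P i j * v j) + (\<Sum>j<d. \<pi> j * v j)"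
      unfolding a_def sum_subtractf[symmetric] sum.distrib[symmetric]
      by (intro sum.cong) (auto simp: algebra_simps)
    then show ?thesis using that by simp
  qed
  have pi1: "(\<Sum>i<d. \<pi> i) = 1" and piP: "\<And>j. j < d \<Longrightarrow> (\<Sum>i<d. \<pi> i * P i j) = \<pi> j"
    using pi by (auto simp: stationary_vector_def)
  \<comment> \<open>Left multiplication by \<open>\<pi>\<close> kills I - P, and since
    \<open>\<pi>\<close> has mass 1 only the rank-one term survives.\<close>
  have pia: "(\<Sum>i<d. \<pi> i * (\<Sum>j<d. a i j * v j)) = (\<Sum>j<d. \<pi> j * v j)" for v
  proof -
    have "(\<Sum>i<d. \<pi> i * (\<Sum>j<d. P i j * v j)) = (\<Sum>j<d. (\<Sum>i<d. \<pi> i * P i j) * v j)"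
      unfolding sum_distrib_left sum_distrib_right mult.assoc by (rule sum.swap)
    also have "\<dots> = (\<Sum>j<d. \<pi> j * v j)" using piP by (intro sum.cong) auto
    finally have *: "(\<Sum>i<d. \<pi> i * (\<Sum>j<d. P i j * v j)) = (\<Sum>j<d. \<pi> j * v j)" .
    have "(\<Sum>i<d. \<pi> i * (\<Sum>j<d. a i j * v j)) =
       (\<Sum>i<d. \<pi> i * (v i - (\<Sum>j<d. P i j * v j) + (\<Sum>j<d. \<pi> j * v j)))"
      using a by (intro sum.cong) auto
    also have "\<dots> = (\<Sum>i<d. \<pi> i) * (\<Sum>j<d. \<pi> j * v j)"
      unfolding ring_distribs right_diff_distrib sum.distrib sum_subtractf * 
      by (simp add: sum_distrib_right)
    finally show ?thesis using pi1 by simp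
  qed
  \<comment> \<open>By \<open>pia\<close> a kernel vector has \<open>\<pi>\<close>-mean 0, hence is
    harmonic, hence constant, hence 0.\<close>
  have inj: "v i = 0" if 0: "\<And>i. i < d \<Longrightarrow> (\<Sum>j<d. a i j * v j) = 0" and i: "i < d" for v i
  proof -
    have z: "(\<Sum>j<d. \<pi> j * v j) = 0" using pia[of v] 0 by simp
    have "(\<Sum>j<d. P i j * v j) = v i" if "i < d" for i using a[OF that, of v] 0[OF that] z by simp
    then have "v j = v i" if "j < d" for j
      using harmonic_imp_constant[OF st irr _ that i] by blast
    then have "(\<Sum>j<d. \<pi> j * v j) = (\<Sum>j<d. \<pi> j) * v i" by (simp add: sum_distrib_right)
    with z pi1 show ?thesis by simp
  qed
  obtain g where g: "\<And>i. i < d \<Longrightarrow> (\<Sum>j<d. a i j * g j) = f i"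
    using square_system_solvable[of d a f] inj by blast
  have "(\<Sum>j<d. \<pi> j * g j) = 0" using pia[of g] f g by simp
  then show ?thesis using that[of g] a g by force
qed

section \<open>Functions of dominated variation\<close>

text \<open>Doubling the argument halves \<open>r\<close> up to a vanishing error, so the initial
  size decays geometrically along y, 2 y, 4 y, and so on. Boundedness on compact intervals makes the
  start uniform over one dyadic block. Serves both the logarithm of \<open>G\<close> and the
  truncated moments.\<close>

lemma halving_recursion_tendsto_0:
  fixes r e :: "real \<Rightarrow> real"
  assumes rec: "\<forall>\<^sub>F y in at_top. r (2 * y) \<le> r y / 2 + e y"
    and e: "(e \<longlongrightarrow> 0) at_top"
    and bdd: "\<And>a b. 0 < a \<Longrightarrow> \<exists>K. \<forall>y\<in>{a..b}. r y \<le> K"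
    and nonneg: "\<forall>\<^sub>F y in at_top. 0 \<le> r y"
  shows "(r \<longlongrightarrow> 0) at_top"
proof (rule order_tendstoI)
  fix a :: real assume "a < 0"
  then show "\<forall>\<^sub>F y in at_top. a < r y" using nonneg by (auto elim: eventually_mono)
next
  fix a :: real assume a: "0 < a"
  have "\<forall>\<^sub>F y in at_top. e y < a / 4" using order_tendstoD(2)[OF e, of "a / 4"] a by auto
  with rec have "\<forall>\<^sub>F y in at_top. r (2 * y) \<le> r y / 2 + a / 4"
    by eventually_elim auto
  then obtain y0' where y0': "\<And>y. y \<ge> y0' \<Longrightarrow> r (2 * y) \<le> r y / 2 + a / 4"
    by (auto simp: eventually_at_top_linorder)
  define y0 where "y0 = max 1 y0'"
  have y0: "y0 > 0" "\<And>y. y \<ge> y0 \<Longrightarrow> r (2 * y) \<le> r y / 2 + a / 4" using y0' by (auto simp: y0_def)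
  obtain K' where K': "\<And>y. y \<in> {y0..2 * y0} \<Longrightarrow> r y \<le> K'" using bdd[OF y0(1)] by meson
  define K where "K = max 1 K'"
  have K: "K > 0" "\<And>y. y \<in> {y0..2 * y0} \<Longrightarrow> r y \<le> K" using K' unfolding K_def by (fastforce intro: order_trans[OF _ max.cobounded2])+
  \<comment> \<open>\<open>a / 2\<close> is the fixed point of t |-> t / 2 + a / 4, so the errors of
    all doublings together add at most \<open>a / 2\<close>.\<close>
  have iter: "r y \<le> K / 2 ^ n + a / 2" if "y \<in> {2 ^ n * y0..2 ^ Suc n * y0}" for n y
    using that
  proof (induction n arbitrary: y)
    case 0
    then show ?case using K(2)[of y] a by simp
  next
    case (Suc n)
    have "y / 2 \<in> {2 ^ n * y0..2 ^ Suc n * y0}" using Suc.prems by auto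
    from Suc.IH[OF this] have "r (y / 2) \<le> K / 2 ^ n + a / 2" .
    moreover have "y0 \<le> 2 ^ n * y0" using y0 by simp
    then have "y / 2 \<ge> y0" using \<open>y / 2 \<in> _\<close> unfolding atLeastAtMost_iff by linarith
    then have "r (2 * (y / 2)) \<le> r (y / 2) / 2 + a / 4" by (rule y0(2))
    ultimately have "r y \<le> q / 2 + a / 4 + a / 4" if "q = K / 2 ^ n" for q
      unfolding that[symmetric] by simp
    from this[OF refl] show ?case by simp
  qed
  obtain n0 where n0: "K / 2 ^ n0 < a / 2"
  proof -
    have "(\<lambda>n. K * (1 / 2) ^ n) \<longlonglongrightarrow> K * 0"
      by (intro tendsto_intros LIMSEQ_power_zero) auto
    then have "\<forall>\<^sub>F n in sequentially. K * (1 / 2) ^ n < a / 2"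
      using order_tendstoD(2)[of _ "K * 0" sequentially "a / 2"] a by simp
    then show ?thesis using that by (auto simp: eventually_sequentially power_divide)
  qed
  have "r y < a" if y: "y \<ge> 2 ^ n0 * y0" for y
  proof -
    define n where "n = (LEAST n. y \<le> 2 ^ Suc n * y0)"
    have ex: "\<exists>n. y \<le> 2 ^ Suc n * y0"
    proof -
      obtain m where "y / y0 < 2 ^ m" using real_arch_pow[of 2 "y / y0"] by auto
      then have "y < 2 ^ m * y0" using y0 by (simp add: field_simps)
      also have "\<dots> \<le> 2 ^ Suc m * y0" using y0 by (intro mult_right_mono) auto
      finally show ?thesis by (intro exI[of _ m]) simp
    qed
    have up: "y \<le> 2 ^ Suc n * y0" unfolding n_def by (rule LeastI_ex[OF ex])
    have lo: "2 ^ n * y0 \<le> y"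
    proof (cases n)
      case 0
      have "1 * y0 \<le> 2 ^ n0 * y0" using y0 by (intro mult_right_mono) auto
      then show ?thesis using y 0 by simp
    next
      case (Suc k)
      have "\<not> y \<le> 2 ^ Suc k * y0" using not_less_Least[of k "\<lambda>n. y \<le> 2 ^ Suc n * y0"] Suc
        by (simp add: n_def)
      then show ?thesis using Suc by simp
    qed
    have "r y \<le> K / 2 ^ n + a / 2" using iter[of y n] lo up by simp
    \<comment> \<open>The least \<open>n\<close> falls short of \<open>n0\<close> only at the end
      point 2^n0 * y0, where the separate bound at that point takes over.\<close>
    moreover have "K / 2 ^ n \<le> K / 2 ^ n0 \<or> y \<le> 2 ^ n0 * y0"
    proof (cases "n0 \<le> n")
      case True
      then show ?thesis using K by (auto intro!: divide_left_mono simp: power_increasing)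
    next
      case False
      then have "2 ^ Suc n * y0 \<le> 2 ^ n0 * y0" using y0 by (intro mult_right_mono power_increasing) auto
      with up show ?thesis by simp
    qed
    moreover have "r (2 ^ n0 * y0) \<le> K / 2 ^ n0 + a / 2" using iter[of "2 ^ n0 * y0" n0] y0 by simp
    ultimately show ?thesis using n0 y by (smt (verit) field_sum_of_halves)
  qed
  then show "\<forall>\<^sub>F y in at_top. r y < a" by (auto simp: eventually_at_top_linorder)
qed

text \<open>Iteration gives c^n f(t) <= f(v^n t); once v^n exceeds 1 / a, monotonicity yields c^n
  f(a t) <= f(v^n a t) <= f(t), so \<open>C\<close> is c^(-n). Used for \<open>G\<close> and for the
  tail of \<open>T\<close>.\<close>

lemma doubling_imp_scaling:
  fixes f :: "real \<Rightarrow> real"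
  assumes anti: "\<And>s t. 0 < s \<Longrightarrow> s \<le> t \<Longrightarrow> f t \<le> f s" and c: "0 < c" and v: "1 < v"
    and double: "\<forall>\<^sub>F t in at_top. c * f t \<le> f (v * t)" and a: "0 < a"
  obtains C where "C > 0" "\<forall>\<^sub>F t in at_top. f (a * t) \<le> C * f t"
proof -
  obtain n :: nat where n: "1 / a < v ^ n" using real_arch_pow[of v "1 / a"] v by auto
  have it: "\<forall>\<^sub>F t in at_top. c ^ n * f t \<le> f (v ^ n * t)" for n
  proof (induction n)
    case (Suc n)
    have "filterlim (\<lambda>t::real. v ^ n * t) at_top at_top"
      by (intro filterlim_tendsto_pos_mult_at_top[OF tendsto_const]) (use v in \<open>auto simp: filterlim_ident\<close>)
    then have "\<forall>\<^sub>F t in at_top. c * f (v ^ n * t) \<le> f (v * (v ^ n * t))"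
      using double by (auto simp: filterlim_iff)
    with Suc show ?case
    proof eventually_elim
      case (elim t)
      have "c ^ Suc n * f t \<le> c * f (v ^ n * t)" using elim(1) c by (simp add: mult.assoc)
      also have "\<dots> \<le> f (v ^ Suc n * t)" using elim(2) by (simp add: mult.assoc)
      finally show ?case .
    qed
  qed simp
  have "filterlim (\<lambda>t::real. a * t) at_top at_top"
    using a by (intro filterlim_tendsto_pos_mult_at_top[OF tendsto_const]) (auto simp: filterlim_ident)
  then have "\<forall>\<^sub>F t in at_top. c ^ n * f (a * t) \<le> f (v ^ n * (a * t))"
    using it[of n] by (auto simp: filterlim_iff)
  moreover have "\<forall>\<^sub>F t in at_top. t > (0::real)" by (rule eventually_gt_at_top)
  ultimately have "\<forall>\<^sub>F t in at_top. f (a * t) \<le> (1 / c ^ n) * f t"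
  proof eventually_elim
    case (elim t)
    have "1 * t \<le> v ^ n * a * t" using n a elim by (intro mult_right_mono) (auto simp: field_simps)
    then have "f (v ^ n * (a * t)) \<le> f t" using elim by (intro anti) auto
    then show ?case using elim c by (simp add: field_simps)
  qed
  then show ?thesis using that[of "1 / c ^ n"] c by simp
qed

text \<open>Here \<open>G\<close> stands for \<open>P(T > t) / E(min(T, t))\<close>: the hypotheses make the increments \<open>o(G)\<close>.\<close>

locale dominated_fun =
  fixes G :: "real \<Rightarrow> real" and c :: real
  assumes G_pos: "t > 0 \<Longrightarrow> G t > 0"
    and G_antimono: "0 < s \<Longrightarrow> s \<le> t \<Longrightarrow> G t \<le> G s"
    and G_le: "t > 0 \<Longrightarrow> t * G t \<le> 1"
    and c_pos: "c > 0"
    and G_double: "\<forall>\<^sub>F t in at_top. c * G t \<le> G (2 * t)"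
begin

lemma G_scale:
  assumes "a > 0"
  obtains C where "C > 0" "\<forall>\<^sub>F t in at_top. G (a * t) \<le> C * G t"
  using doubling_imp_scaling[of G c 2 a] G_antimono c_pos G_double assms by auto

text \<open>With r(y) = ln (1 / G y) / y, the doubling inequality becomes r(2 y) <= r(y) / 2 + ln (1
  / c) / (2 y). The result keeps the parameter of the exponential bound small.\<close>

lemma ln_G_sublinear: "((\<lambda>y. ln (1 / G y) / y) \<longlongrightarrow> 0) at_top"
proof (rule halving_recursion_tendsto_0[where e = "\<lambda>y. ln (1 / c) / (2 * y)"])
  show "\<forall>\<^sub>F y in at_top. ln (1 / G (2 * y)) / (2 * y) \<le> ln (1 / G y) / y / 2 + ln (1 / c) / (2 * y)"
    using G_double eventually_gt_at_top[of 0]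
  proof eventually_elim
    case (elim y)
    have "ln (c * G y) \<le> ln (G (2 * y))" using elim G_pos[of y] G_pos[of "2 * y"] c_pos by simp
    then show ?case using elim G_pos[of y] G_pos[of "2 * y"] c_pos
      by (simp add: ln_div ln_mult field_simps)
  qed
  show "((\<lambda>y. ln (1 / c) / (2 * y)) \<longlongrightarrow> 0) at_top" by real_asymp
  show "\<exists>K. \<forall>y\<in>{a..b}. ln (1 / G y) / y \<le> K" if "0 < a" for a b
  proof (intro exI ballI)
    fix y assume y: "y \<in> {a..b}"
    have "ln (1 / G y) \<le> ln (1 / G b)" using y that G_pos[of y] G_pos[of b] G_antimono[of y b]
      by (auto simp: field_simps)
    also have "\<dots> \<le> \<bar>ln (1 / G b)\<bar>" by simp
    finally have "ln (1 / G y) / y \<le> \<bar>ln (1 / G b)\<bar> / y" using y that by (intro divide_right_mono) auto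
    also have "\<dots> \<le> \<bar>ln (1 / G b)\<bar> / a" using y that by (intro divide_left_mono) auto
    finally show "ln (1 / G y) / y \<le> \<bar>ln (1 / G b)\<bar> / a" .
  qed
  show "\<forall>\<^sub>F y in at_top. 0 \<le> ln (1 / G y) / y"
    using eventually_ge_at_top[of 1]
  proof eventually_elim
    case (elim y)
    have "1 * G y \<le> y * G y" using elim G_pos[of y] by (intro mult_right_mono) auto
    then have "G y \<le> 1" using elim G_le[of y] by linarith
    then have "1 \<le> 1 / G y" using elim G_pos[of y] by simp
    then show ?case using elim by (intro divide_nonneg_nonneg ln_ge_zero) auto
  qed
qed

end

section \<open>Truncated exponential moments\<close>

lemma exp_excess_mono:
  fixes a b :: real
  assumes "0 \<le> a" "a \<le> b"
  shows "exp a - 1 - a \<le> exp b - 1 - b"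
proof -
  have "1 + (b - a) \<le> exp (b - a)" by (rule exp_ge_add_one_self)
  moreover have "(exp a - 1) * (b - a) \<ge> 0" using assms by simp
  moreover have "exp a * (1 + (b - a)) \<le> exp a * exp (b - a)" by simp
  moreover have "exp a * exp (b - a) = exp b" by (simp flip: exp_add)
  ultimately show ?thesis by (simp add: algebra_simps)
qed

lemma exp_excess_nonneg: "0 \<le> exp a - 1 - (a::real)"
  using exp_ge_add_one_self[of a] by linarith

text \<open>The function exp t / t^m increases for t >= m; here this comes from ln s <= s - 1 at s =
  b / a.\<close>

lemma exp_le_exp_mult_ratio_power:
  fixes a b :: real
  assumes "0 < real m" "real m \<le> a" "a \<le> b"
  shows "exp a \<le> exp b * (a / b) ^ m"
proof -
  have pos: "0 < a" "0 < b" using assms by linarith+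
  have "ln (b / a) \<le> b / a - 1" using pos by (intro ln_le_minus_one) auto
  also have "\<dots> = (b - a) / a" using pos by (simp add: field_simps)
  also have "\<dots> \<le> (b - a) / m" using assms pos by (intro divide_left_mono) auto
  finally have "m * ln (b / a) \<le> b - a" using assms by (simp add: field_simps)
  then have "exp a \<le> exp (b + m * ln (a / b))" using pos by (simp add: ln_div algebra_simps)
  also have "\<dots> = exp b * (a / b) ^ m"
    using pos by (simp add: exp_add exp_of_nat_mult)
  finally show ?thesis .
qed

text \<open>The cut is at u = m / l. Below it the excess is kept, and truncating at \<open>y\<close>
  only lowers it; above it the exponential outgrows the m-th power, so it can be compared with its
  value at \<open>y\<close>.\<close>

lemma exp_excess_truncated_le:
  fixes u y l :: real
  assumes l: "0 < l" and y: "0 < y" and m: "0 < m"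
  shows "exp (l * min u y) - 1 - l * min u y \<le>
    (if l * u \<le> real m then exp (l * u) - 1 - l * u else 0) + exp (l * y) * (min \<bar>u\<bar> y / y) ^ m"
proof (cases "l * u \<le> real m")
  case True
  have "exp (l * min u y) - 1 - l * min u y \<le> exp (l * u) - 1 - l * u"
  proof (cases "u \<le> y")
    case False
    then show ?thesis using l y by (intro exp_excess_mono) auto
  qed auto
  moreover have "0 \<le> exp (l * y) * (min \<bar>u\<bar> y / y) ^ m" using y by auto
  ultimately show ?thesis using True by simp
next
  case False
  then have u: "0 < u" using l m by (smt (verit) mult_nonneg_nonpos of_nat_0_le_iff)
  define w where "w = min u y"
  have w: "0 < w" "w \<le> y" using u y by (auto simp: w_def)
  have "exp (l * w) \<le> exp (l * y) * (w / y) ^ m"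
  proof (cases "u \<le> y")
    case True
    then have "exp (l * w) \<le> exp (l * y) * ((l * w) / (l * y)) ^ m"
      using False l m w by (intro exp_le_exp_mult_ratio_power) (auto simp: w_def)
    then show ?thesis using l by simp
  next
    case False
    then have "w = y" by (simp add: w_def)
    then show ?thesis using y by simp
  qed
  moreover have "exp (l * w) - 1 - l * w \<le> exp (l * w)" using w l by (smt (verit) mult_pos_pos)
  ultimately show ?thesis using False u by (simp add: w_def)
qed

text \<open>Supplies a dominating function that asks for a first moment only: below \<open>m\<close>
  the exponential is bounded and the excess at most linear.\<close>

lemma exp_excess_le_linear:
  fixes u :: real
  assumes "u \<le> m" "0 \<le> m"
  shows "exp u - 1 - u \<le> exp m * \<bar>u\<bar>"
proof (cases "0 \<le> u")
  case True
  have "1 + (-u) \<le> exp (-u)" by (rule exp_ge_add_one_self)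
  then have "exp u * (1 - u) \<le> exp u * exp (-u)" by (intro mult_left_mono) auto
  then have "exp u - 1 \<le> exp u * u" by (simp add: algebra_simps flip: exp_add)
  also have "\<dots> \<le> exp m * u" using assms True by (intro mult_right_mono) auto
  finally show ?thesis using True by simp
next
  case False
  then have "exp u - 1 - u \<le> 1 * \<bar>u\<bar>" by simp
  also have "\<dots> \<le> exp m * \<bar>u\<bar>" using assms by (intro mult_right_mono) auto
  finally show ?thesis .
qed

lemma exp_excess_le_square:
  fixes u :: real
  assumes "\<bar>u\<bar> \<le> 1"
  shows "exp u - 1 - u \<le> u\<^sup>2"
proof (cases "0 \<le> u")
  case True
  then show ?thesis using exp_bound[of u] assms by simp
next
  case False
  have "1 + (-u) \<le> exp (-u)" by (rule exp_ge_add_one_self)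
  then have "exp u * (1 - u) \<le> exp u * exp (-u)" by (intro mult_left_mono) auto
  then have "exp u * (1 - u) \<le> 1" by (simp flip: exp_add)
  moreover have "1 \<le> (1 + u + u\<^sup>2) * (1 - u)"
  proof -
    have "(1 + u + u\<^sup>2) * (1 - u) = 1 - u ^ 3" by (simp add: power2_eq_square power3_eq_cube algebra_simps)
    moreover have "u ^ 3 \<le> 0" using False by (simp add: power3_eq_cube mult_nonneg_nonpos2 mult_nonpos_nonpos mult_nonneg_nonpos)
    ultimately show ?thesis by simp
  qed
  ultimately have "exp u * (1 - u) \<le> (1 + u + u\<^sup>2) * (1 - u)" by linarith
  then have "exp u \<le> 1 + u + u\<^sup>2" by (rule mult_right_le_imp_le) (use False in simp)
  then show ?thesis by simp
qed

text \<open>Divided by \<open>l\<close>, the integrand tends to 0 pointwise by the quadratic bound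
  and is dominated by a multiple of |u| by the linear one, so this part is o(l) without a second
  moment.\<close>

lemma small_mgf_part:
  fixes u :: "'b \<Rightarrow> real"
  assumes u: "integrable N u" and "0 \<le> m" and k: "0 < \<kappa>"
  shows "\<forall>\<^sub>F l in at_right 0.
    (\<integral>x. (if l * u x \<le> m then exp (l * u x) - 1 - l * u x else 0) \<partial>N) \<le> \<kappa> * l"
proof -
  \<comment> \<open>\<open>t\<close> is 1 / l: dominated convergence is applied along
    \<open>at_top\<close> and then transported back to \<open>at_right 0\<close>.\<close>
  define f where "f t x = t * (if inverse t * u x \<le> m then exp (inverse t * u x) - 1 - inverse t * u x else 0)" for t x
  have [measurable]: "u \<in> borel_measurable N" using u by auto
  have "((\<lambda>t. integral\<^sup>L N (f t)) \<longlongrightarrow> integral\<^sup>L N (\<lambda>x. 0)) at_top"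
  proof (rule integral_dominated_convergence_at_top)
    show "(\<lambda>x. 0) \<in> borel_measurable N" "f t \<in> borel_measurable N" for t unfolding f_def by auto
    show "integrable N (\<lambda>x. exp m * \<bar>u x\<bar>)" using u by auto
    show "AE x in N. ((\<lambda>i. f i x) \<longlongrightarrow> 0) at_top"
    proof (intro AE_I2)
      fix x
      show "((\<lambda>i. f i x) \<longlongrightarrow> 0) at_top"
      proof (rule tendsto_sandwich)
        show "\<forall>\<^sub>F t in at_top. 0 \<le> f t x"
          using eventually_gt_at_top[of 0]
          by eventually_elim (auto simp: f_def intro!: mult_nonneg_nonneg exp_excess_nonneg)
        show "\<forall>\<^sub>F t in at_top. f t x \<le> (u x)\<^sup>2 / t"
          using eventually_ge_at_top[of "max 1 \<bar>u x\<bar>"]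
        proof eventually_elim
          case (elim t)
          have t: "0 < t" "\<bar>u x\<bar> \<le> t" using elim by auto
          then have "\<bar>u x\<bar> / t \<le> 1" by simp
          then have "\<bar>inverse t * u x\<bar> \<le> 1" using t by (simp add: abs_mult divide_inverse mult.commute)
          from exp_excess_le_square[OF this]
          have "t * (exp (inverse t * u x) - 1 - inverse t * u x) \<le> t * (inverse t * u x)\<^sup>2"
            using t by (intro mult_left_mono) auto
          then have "f t x \<le> t * (inverse t * u x)\<^sup>2" using t by (auto simp: f_def)
          also have "\<dots> = (u x)\<^sup>2 / t" using t by (simp add: power2_eq_square field_simps)
          finally show ?case .
        qed
        show "((\<lambda>t. (u x)\<^sup>2 / t) \<longlongrightarrow> 0) at_top"
          by (intro tendsto_divide_0[OF tendsto_const] filterlim_at_top_imp_at_infinity filterlim_ident)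
      qed auto
    qed
    show "\<forall>\<^sub>F t in at_top. AE x in N. norm (f t x) \<le> exp m * \<bar>u x\<bar>"
      using eventually_gt_at_top[of 0]
    proof eventually_elim
      case (elim t)
      have "norm (f t x) \<le> exp m * \<bar>u x\<bar>" for x
      proof (cases "inverse t * u x \<le> m")
        case True
        have "norm (f t x) = t * (exp (inverse t * u x) - 1 - inverse t * u x)"
          using elim True exp_excess_nonneg[of "inverse t * u x"] by (simp add: f_def abs_mult)
        also have "\<dots> \<le> t * (exp m * \<bar>inverse t * u x\<bar>)"
          using elim True assms by (intro mult_left_mono exp_excess_le_linear) auto
        also have "\<dots> = exp m * \<bar>u x\<bar>" using elim by (simp add: abs_mult)
        finally show ?thesis .
      qed (simp add: f_def)
      then show ?case by simp
    qed
  qed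
  then have "\<forall>\<^sub>F t in at_top. integral\<^sup>L N (f t) < \<kappa>" using k by (intro order_tendstoD) auto
  then have "\<forall>\<^sub>F l in at_right 0. integral\<^sup>L N (f (inverse l)) < \<kappa>"
    by (simp add: at_top_to_right eventually_filtermap)
  then show ?thesis using eventually_at_right_less[of "0::real"]
  proof eventually_elim
    case (elim l)
    let ?I = "\<integral>x. (if l * u x \<le> m then exp (l * u x) - 1 - l * u x else 0) \<partial>N"
    have "f (inverse l) = (\<lambda>x. inverse l * (if l * u x \<le> m then exp (l * u x) - 1 - l * u x else 0))"
      by (rule ext) (simp add: f_def)
    then have "inverse l * ?I < \<kappa>" using elim(1) by simp
    then have "?I / l < \<kappa>" by (simp only: divide_inverse mult.commute)
    then have "?I < \<kappa> * l" using elim(2) by (simp only: pos_divide_less_eq)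
    then show ?case by simp
  qed
qed

text \<open>The truncated \<open>m\<close>-th moment absorbs the exponential moment of the jumps between \<open>m / l\<close> and \<open>y\<close>.\<close>

lemma (in finite_measure) truncated_mgf_le:
  fixes u :: "'a \<Rightarrow> real"
  assumes u: "integrable M u" and m: "0 < m" and k: "0 < \<kappa>"
  shows "\<forall>\<^sub>F l in at_right 0. \<forall>y>0.
    (\<integral>\<^sup>+x. ennreal (exp (l * min (u x) y)) \<partial>M) \<le>
    ennreal (measure M (space M) + l * (\<integral>x. u x \<partial>M) + \<kappa> * l + exp (l * y) * (\<integral>x. (min \<bar>u x\<bar> y / y) ^ m \<partial>M))"
  using small_mgf_part[OF u of_nat_0_le_iff[of m] k] eventually_at_right_less[of "0::real"]
proof eventually_elim
  case (elim l)
  show ?case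
  proof (intro allI impI)
    fix y :: real assume y: "0 < y"
    have [measurable]: "u \<in> borel_measurable M" using u by auto
    let ?s = "\<lambda>x. if l * u x \<le> m then exp (l * u x) - 1 - l * u x else 0"
    let ?b = "\<lambda>x. (min \<bar>u x\<bar> y / y) ^ m"
    have s: "integrable M ?s"
    proof (rule Bochner_Integration.integrable_bound)
      show "integrable M (\<lambda>x. exp (real m) * (l * \<bar>u x\<bar>))" using u by auto
      show "AE x in M. norm (?s x) \<le> norm (exp (real m) * (l * \<bar>u x\<bar>))"
      proof (intro AE_I2)
        fix x
        show "norm (?s x) \<le> norm (exp (real m) * (l * \<bar>u x\<bar>))"
          using exp_excess_le_linear[of "l * u x" "real m"] exp_excess_nonneg[of "l * u x"] elim
          by (auto simp: abs_mult)
      qed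
    qed auto
    have b: "integrable M ?b"
    proof (rule integrable_const_bound[of _ 1])
      show "AE x in M. norm (?b x) \<le> 1" using y by (intro AE_I2) (auto intro!: power_le_one simp: power_abs)
    qed auto
    \<comment> \<open>Since \<open>l * min (u x) y \<le> l * u x\<close>, the linear term carries
      the untruncated mean, which later cancels exactly.\<close>
    have le: "exp (l * min (u x) y) \<le> 1 + l * u x + ?s x + exp (l * y) * ?b x" for x
    proof -
      have "l * min (u x) y \<le> l * u x" using elim by simp
      with exp_excess_truncated_le[of l y m "u x"] elim(2) y m show ?thesis by linarith
    qed
    have int1: "integrable M (\<lambda>x. 1 + l * u x)" using u by auto
    have int2: "integrable M (\<lambda>x. 1 + l * u x + ?s x)"
      using int1 s by (rule Bochner_Integration.integrable_add)
    have int3: "integrable M (\<lambda>x. exp (l * y) * ?b x)" using b by (rule integrable_mult_right)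
    have int4: "integrable M (\<lambda>x. 1 + l * u x + ?s x + exp (l * y) * ?b x)"
      using int2 int3 by (rule Bochner_Integration.integrable_add)
    have "(\<integral>\<^sup>+x. ennreal (exp (l * min (u x) y)) \<partial>M) \<le>
      (\<integral>\<^sup>+x. ennreal (1 + l * u x + ?s x + exp (l * y) * ?b x) \<partial>M)"
      using le by (intro nn_integral_mono ennreal_leI)
    also have "\<dots> = ennreal (\<integral>x. 1 + l * u x + ?s x + exp (l * y) * ?b x \<partial>M)"
      using int4 by (rule nn_integral_eq_integral) (intro AE_I2 order_trans[OF exp_ge_zero le])
    also have "(\<integral>x. 1 + l * u x + ?s x + exp (l * y) * ?b x \<partial>M) =
       measure M (space M) + l * (\<integral>x. u x \<partial>M) + (\<integral>x. ?s x \<partial>M) + exp (l * y) * (\<integral>x. ?b x \<partial>M)"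
      unfolding Bochner_Integration.integral_add[OF int2 int3] Bochner_Integration.integral_add[OF int1 s]
      using u by simp
    also have "ennreal \<dots> \<le> ennreal (measure M (space M) + l * (\<integral>x. u x \<partial>M) + \<kappa> * l + exp (l * y) * (\<integral>x. ?b x \<partial>M))"
      using elim by (intro ennreal_leI) auto
    finally show "(\<integral>\<^sup>+x. ennreal (exp (l * min (u x) y)) \<partial>M) \<le>
    ennreal (measure M (space M) + l * (\<integral>x. u x \<partial>M) + \<kappa> * l + exp (l * y) * (\<integral>x. (min \<bar>u x\<bar> y / y) ^ m \<partial>M))" .
  qed
qed

section \<open>Moments and tails on the scale of G\<close>

context dominated_fun
begin

text \<open>Passing from \<open>y\<close> to \<open>2 * y\<close> multiplies the scaled moment by
  2^(-m) off the event |u| > y and adds at most the mass of that event, while \<open>G\<close> loses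
  at most the factor \<open>c\<close>; the choice of \<open>m\<close> makes 2^(-m) / c at most 1 /
  2.\<close>

lemma truncated_moment_tendsto_0:
  fixes u :: "'b \<Rightarrow> real"
  assumes N: "finite_measure N" and u [measurable]: "u \<in> borel_measurable N"
    and tl: "((\<lambda>t. measure N {x\<in>space N. t < \<bar>u x\<bar>} / G t) \<longlongrightarrow> 0) at_top"
    and m: "2 / c \<le> 2 ^ m"
  shows "((\<lambda>y. (\<integral>x. (min \<bar>u x\<bar> y / y) ^ m \<partial>N) / G y) \<longlongrightarrow> 0) at_top"
proof -
  interpret finite_measure N by fact
  define b where "b y = (\<integral>x. (min \<bar>u x\<bar> y / y) ^ m \<partial>N)" for y
  define q where "q t = measure N {x\<in>space N. t < \<bar>u x\<bar>}" for t
  have le1: "(min \<bar>u x\<bar> y / y) ^ m \<le> 1" if "0 < y" for x y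
    using that by (intro power_le_one) auto
  have int: "integrable N (\<lambda>x. (min \<bar>u x\<bar> y / y) ^ m)" if "0 < y" for y
    using le1[OF that] that by (intro integrable_const_bound[of _ 1]) (auto simp: power_abs)
  have b0: "0 \<le> b y" if "0 < y" for y
    unfolding b_def using that by (intro integral_nonneg_AE AE_I2) auto
  have b_le: "b y \<le> measure N (space N)" if "0 < y" for y
  proof -
    have "b y \<le> (\<integral>x. 1 \<partial>N)" unfolding b_def
      using int[OF that] le1[OF that] by (intro integral_mono) auto
    then show ?thesis by simp
  qed
  have rec: "b (2 * y) \<le> (1 / 2) ^ m * b y + q y" if y: "0 < y" for y
  proof -
    have int_ind: "integrable N (indicator {x\<in>space N. y < \<bar>u x\<bar>} :: 'b \<Rightarrow> real)"
      by (intro integrable_real_indicator) (auto simp: less_top[symmetric])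
    have "b (2 * y) \<le> (\<integral>x. (1 / 2) ^ m * (min \<bar>u x\<bar> y / y) ^ m + indicator {x\<in>space N. y < \<bar>u x\<bar>} x \<partial>N)"
      unfolding b_def
    proof (intro integral_mono)
      show "integrable N (\<lambda>x. (min \<bar>u x\<bar> (2 * y) / (2 * y)) ^ m)" using y by (intro int) auto
      show "integrable N (\<lambda>x. (1 / 2) ^ m * (min \<bar>u x\<bar> y / y) ^ m + indicator {x\<in>space N. y < \<bar>u x\<bar>} x)"
        using int[OF y] int_ind by (intro Bochner_Integration.integrable_add integrable_mult_right)
      fix x assume x: "x \<in> space N"
      show "(min \<bar>u x\<bar> (2 * y) / (2 * y)) ^ m \<le>
        (1 / 2) ^ m * (min \<bar>u x\<bar> y / y) ^ m + indicator {x\<in>space N. y < \<bar>u x\<bar>} x"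
      proof (cases "y < \<bar>u x\<bar>")
        case True
        then show ?thesis using le1[of "2 * y" x] x y by (auto intro!: add_increasing)
      next
        case False
        then show ?thesis using y by (simp add: power_divide power_mult_distrib)
      qed
    qed
    also have "\<dots> = (1 / 2) ^ m * b y + q y"
      unfolding b_def q_def using int[OF y] int_ind
      by (subst Bochner_Integration.integral_add) auto
    finally show ?thesis .
  qed
  have "((\<lambda>y. b y / G y) \<longlongrightarrow> 0) at_top"
  proof (rule halving_recursion_tendsto_0[where e = "\<lambda>y. 1 / c * (q y / G y)"])
    show "\<forall>\<^sub>F y in at_top. b (2 * y) / G (2 * y) \<le> b y / G y / 2 + 1 / c * (q y / G y)"
      using G_double eventually_gt_at_top[of 0]
    proof eventually_elim
      case (elim y)
      have pos: "0 < G y" "0 < G (2 * y)" using elim G_pos by auto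
      have q0: "0 \<le> q y" by (simp add: q_def)
      have "(1 / 2) ^ m * (1 / c) \<le> 1 / 2" using m c_pos by (simp add: field_simps)
      then have *: "(1 / 2) ^ m * (1 / c) * (b y / G y) \<le> 1 / 2 * (b y / G y)"
        using b0[of y] elim pos by (intro mult_right_mono) auto
      have "b (2 * y) / G (2 * y) \<le> ((1 / 2) ^ m * b y + q y) / G (2 * y)"
        using rec[of y] elim pos by (intro divide_right_mono) auto
      also have "\<dots> \<le> ((1 / 2) ^ m * b y + q y) / (c * G y)"
        using elim pos c_pos b0[of y] q0 by (intro divide_left_mono) auto
      also have "\<dots> = (1 / 2) ^ m * (1 / c) * (b y / G y) + 1 / c * (q y / G y)"
        using pos c_pos by (simp add: field_simps)
      finally show ?case using * by simp
    qed
    show "((\<lambda>y. 1 / c * (q y / G y)) \<longlongrightarrow> 0) at_top"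
      using tendsto_mult[OF tendsto_const tl, of "1 / c"] by (simp add: q_def)
    show "\<exists>K. \<forall>y\<in>{a..b'}. b y / G y \<le> K" if a: "0 < a" for a b'
    proof (intro exI ballI)
      fix y assume y: "y \<in> {a..b'}"
      then show "b y / G y \<le> measure N (space N) / G b'"
        using a b_le[of y] G_pos G_antimono[of y b'] by (intro frac_le) auto
    qed
    show "\<forall>\<^sub>F y in at_top. 0 \<le> b y / G y"
      using eventually_gt_at_top[of 0] by eventually_elim (use b0 G_pos in \<open>auto intro!: divide_nonneg_pos\<close>)
  qed
  then show ?thesis by (simp add: b_def)
qed

text \<open>For t >= 2 |k| a shift by \<open>k\<close> costs at most half the level, and
  \<open>G\<close> at t / 2 is comparable with \<open>G\<close> at t. This carries the tail of the
  kernel over to the centred increments.\<close>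

lemma shifted_tail_tendsto_0:
  fixes N :: "real measure"
  assumes N: "finite_measure N" "sets N = sets borel"
    and tl: "((\<lambda>t. measure N {x. t < \<bar>x\<bar>} / G t) \<longlongrightarrow> 0) at_top"
    and s: "\<bar>s\<bar> = 1"
  shows "((\<lambda>t. measure N {x\<in>space N. t < \<bar>s * (x + k)\<bar>} / G t) \<longlongrightarrow> 0) at_top"
proof -
  interpret finite_measure N by fact
  obtain C where C: "C > 0" "\<forall>\<^sub>F t in at_top. G (1 / 2 * t) \<le> C * G t" using G_scale[of "1 / 2"] by auto
  have lim: "filterlim (\<lambda>t::real. 1 / 2 * t) at_top at_top"
    by (intro filterlim_tendsto_pos_mult_at_top[OF tendsto_const]) (auto simp: filterlim_ident)
  show ?thesis
  proof (rule tendsto_sandwich)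
    show "\<forall>\<^sub>F t in at_top. 0 \<le> measure N {x\<in>space N. t < \<bar>s * (x + k)\<bar>} / G t"
      using eventually_gt_at_top[of 0] by eventually_elim (use G_pos in \<open>auto intro!: divide_nonneg_pos\<close>)
    show "\<forall>\<^sub>F t in at_top. measure N {x\<in>space N. t < \<bar>s * (x + k)\<bar>} / G t \<le>
        C * (measure N {x. 1 / 2 * t < \<bar>x\<bar>} / G (1 / 2 * t))"
      using C(2) eventually_gt_at_top[of 0] eventually_ge_at_top[of "2 * \<bar>k\<bar>"]
    proof eventually_elim
      case (elim t)
      have pos: "0 < G t" "0 < G (1 / 2 * t)" using elim G_pos by auto
      have "measure N {x\<in>space N. t < \<bar>s * (x + k)\<bar>} \<le> measure N {x. 1 / 2 * t < \<bar>x\<bar>}"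
      proof (rule finite_measure_mono)
        show "{x\<in>space N. t < \<bar>s * (x + k)\<bar>} \<subseteq> {x. 1 / 2 * t < \<bar>x\<bar>}"
          using s elim(3) by (auto simp: abs_mult)
        show "{x. 1 / 2 * t < \<bar>x\<bar>} \<in> sets N" unfolding N by measurable
      qed
      then have "measure N {x\<in>space N. t < \<bar>s * (x + k)\<bar>} / G t \<le> measure N {x. 1 / 2 * t < \<bar>x\<bar>} / G t"
        using pos by (intro divide_right_mono) auto
      also have "\<dots> = C * (measure N {x. 1 / 2 * t < \<bar>x\<bar>} / (C * G t))" using C by simp
      also have "\<dots> \<le> C * (measure N {x. 1 / 2 * t < \<bar>x\<bar>} / G (1 / 2 * t))"
        using C elim pos by (intro mult_left_mono divide_left_mono) auto
      finally show ?case .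
    qed
    show "((\<lambda>t. C * (measure N {x. 1 / 2 * t < \<bar>x\<bar>} / G (1 / 2 * t))) \<longlongrightarrow> 0) at_top"
      using tendsto_mult[OF tendsto_const filterlim_compose[OF tl lim], of C] by simp
  qed auto
qed

end

section \<open>Markov additive processes\<close>

lemma finite_measure_eqI_Iic:
  fixes A B :: "real measure"
  assumes "sets A = sets borel" "sets B = sets borel" "finite_measure A"
    and eq: "\<And>x. emeasure A {..x} = emeasure B {..x}"
  shows "A = B"
proof (rule measure_eqI_generator_eq)
  show "Int_stable (range (\<lambda>a::real. {..a}))" by (auto simp: Int_stable_def)
  show "range (\<lambda>a::real. {..a}) \<subseteq> Pow UNIV" by simp
  show "emeasure A X = emeasure B X" if "X \<in> range (\<lambda>a::real. {..a})" for X using that eq by auto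
  show "sets A = sigma_sets UNIV (range (\<lambda>a::real. {..a}))" "sets B = sigma_sets UNIV (range (\<lambda>a::real. {..a}))"
    using assms by (simp_all add: borel_eq_atMost)
  show "range (\<lambda>n::nat. {..real n}) \<subseteq> range (\<lambda>a::real. {..a})" by auto
  show "(\<Union>n::nat. {..real n}) = UNIV" by (auto simp: real_arch_simple)
  show "emeasure A {..real n} \<noteq> \<infinity>" for n
    using finite_measure.emeasure_finite[OF assms(3)] by auto
qed

lemma distr_fun_interval_measure:
  assumes "distr_fun F"
  shows "finite_measure (interval_measure F)"
    and "emeasure (interval_measure F) {..x} = ennreal (F x)"
    and "measure (interval_measure F) UNIV = Lim at_top F"
    and "0 \<le> F x"
proof -
  have F: "mono F" "\<And>x. continuous (at_right x) F" "(F \<longlongrightarrow> 0) at_bot"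
    using assms by (auto simp: distr_fun_def)
  obtain m where m: "(F \<longlongrightarrow> m) at_top" using assms by (auto simp: distr_fun_def)
  show F0: "0 \<le> F x" for x
    using F(3) by (rule tendsto_upperbound)
      (auto simp: eventually_at_bot_linorder intro!: exI[of _ x] monoD[OF F(1)])
  have "0 \<le> m" by (rule tendsto_lowerbound[OF m]) (auto simp: F0)
  note iv = F(2,3) m this
  interpret finite_borel_measure "interval_measure F"
    by (rule finite_borel_measure_interval_measure[OF monoD[OF F(1)] iv])
  show "finite_measure (interval_measure F)" by (rule finite_measure_axioms)
  show "emeasure (interval_measure F) {..x} = ennreal (F x)"
    by (rule emeasure_interval_measure_Iic[OF monoD[OF F(1)] F(2,3)])
  have "emeasure (interval_measure F) UNIV = m"
    by (rule interval_measure_UNIV[OF monoD[OF F(1)] iv])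
  then show "measure (interval_measure F) UNIV = Lim at_top F"
    using tendsto_Lim[OF _ m] \<open>0 \<le> m\<close> by (simp add: measure_def)
qed

locale map_process = prob_space M for M :: "'a measure" +
  fixes d :: nat and X :: "nat \<Rightarrow> 'a \<Rightarrow> real" and J :: "nat \<Rightarrow> 'a \<Rightarrow> nat"
    and \<beta> :: "nat \<Rightarrow> real \<Rightarrow> real" and H :: "nat \<Rightarrow> nat \<Rightarrow> real \<Rightarrow> real"
  assumes MAP: "is_MAP M d X J \<beta> H" and stoch: "stochastic_matrix d (Hinf H)"
begin

lemma
  shows X_meas [measurable]: "X n \<in> borel_measurable M"
    and J_meas [measurable]: "J n \<in> measurable M (count_space UNIV)"
    and J_less: "\<omega> \<in> space M \<Longrightarrow> J n \<omega> < d"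
    and H_distr_fun: "i < d \<Longrightarrow> j < d \<Longrightarrow> distr_fun (H i j)"
    and d_pos: "0 < d"
  using MAP by (auto simp: is_MAP_def)

lemmas H_interval_measure = distr_fun_interval_measure[OF H_distr_fun]

section \<open>Filtration and the one-step Markov property\<close>

definition past :: "nat \<Rightarrow> 'a measure" where
  "past n = sigma (space M)
     (\<Union>k\<in>{..n}. {X k -` B \<inter> space M | B. B \<in> sets borel} \<union> {J k -` C \<inter> space M | C. True})"

lemma space_past [simp]: "space (past n) = space M"
  unfolding past_def by (subst space_measure_of) auto

lemma sets_past: "sets (past n) = past_events M X J n"
  unfolding past_def past_events_def by (subst sets_measure_of) auto

lemma sets_past_mono: "k \<le> n \<Longrightarrow> sets (past k) \<subseteq> sets (past n)"
  unfolding sets_past past_events_def by (intro sigma_sets_mono' UN_mono) auto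

lemma sets_past_le: "sets (past n) \<subseteq> sets M"
proof -
  have "sigma_sets (space M) (\<Union>k\<in>{..n}. {X k -` B \<inter> space M | B. B \<in> sets borel} \<union> {J k -` C \<inter> space M | C. True}) \<subseteq> sets M"
    by (intro sets.sigma_sets_subset) (auto intro: measurable_sets[OF X_meas] measurable_sets[OF J_meas])
  then show ?thesis by (simp add: sets_past past_events_def)
qed

lemma measurable_past_imp: "f \<in> measurable (past n) N \<Longrightarrow> f \<in> measurable M N"
  using sets_past_le[of n] by (auto simp: measurable_def)

lemma X_past: "k \<le> n \<Longrightarrow> X k \<in> borel_measurable (past n)"
  unfolding measurable_def sets_past past_events_def by (auto intro!: sigma_sets.Basic bexI[of _ k])

lemma J_past: "k \<le> n \<Longrightarrow> J k \<in> measurable (past n) (count_space UNIV)"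
  unfolding measurable_def sets_past past_events_def by (auto intro!: sigma_sets.Basic bexI[of _ k])

text \<open>With an indicator for \<open>\<phi>\<close>, both sides are finite measures of the Borel
  set; the defining property of the process equates them on half-lines, so they coincide and
  integrate every \<open>\<phi>\<close> alike.\<close>

lemma kernel_event:
  assumes A: "A \<in> sets (past n)" and i: "i < d" and j: "j < d"
    and \<phi> [measurable]: "\<phi> \<in> borel_measurable borel"
  shows "(\<integral>\<^sup>+\<omega>. indicator (A \<inter> {\<omega>\<in>space M. J n \<omega> = i \<and> J (Suc n) \<omega> = j}) \<omega> * \<phi> (X (Suc n) \<omega>) \<partial>M)
    = emeasure M (A \<inter> {\<omega>\<in>space M. J n \<omega> = i}) * (\<integral>\<^sup>+x. \<phi> x \<partial>interval_measure (H i j))"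
proof -
  have [measurable]: "A \<in> sets M" using A sets_past_le by auto
  let ?A = "A \<inter> {\<omega>\<in>space M. J n \<omega> = i \<and> J (Suc n) \<omega> = j}"
  let ?p = "emeasure M (A \<inter> {\<omega>\<in>space M. J n \<omega> = i})"
  let ?\<nu> = "distr (density M (indicator ?A)) borel (X (Suc n))"
  have "?\<nu> = scale_measure ?p (interval_measure (H i j))"
  proof (rule finite_measure_eqI_Iic)
    have em: "emeasure ?\<nu> B = emeasure M (?A \<inter> (X (Suc n) -` B \<inter> space M))" if B [measurable]: "B \<in> sets borel" for B
    proof -
      have "emeasure ?\<nu> B = (\<integral>\<^sup>+\<omega>. indicator ?A \<omega> * indicator (X (Suc n) -` B \<inter> space M) \<omega> \<partial>M)"
        by (subst emeasure_distr) (auto simp: emeasure_density)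
      also have "\<dots> = (\<integral>\<^sup>+\<omega>. indicator (?A \<inter> (X (Suc n) -` B \<inter> space M)) \<omega> \<partial>M)"
        by (intro nn_integral_cong) (auto split: split_indicator)
      also have "\<dots> = emeasure M (?A \<inter> (X (Suc n) -` B \<inter> space M))"
        by (rule nn_integral_indicator[OF sets.Int[OF _ measurable_sets[OF X_meas B]]]) measurable
      finally show ?thesis .
    qed
    show "finite_measure ?\<nu>"
    proof (rule finite_measureI)
      have "emeasure ?\<nu> UNIV \<noteq> \<infinity>" by (subst em) (auto simp: emeasure_eq_measure)
      then show "emeasure ?\<nu> (space ?\<nu>) \<noteq> \<infinity>" by (simp only: space_distr space_borel simp_thms)
    qed
    fix x
    have "emeasure ?\<nu> {..x} = emeasure M (A \<inter> {\<omega>\<in>space M. J n \<omega> = i \<and> X (Suc n) \<omega> \<le> x \<and> J (Suc n) \<omega> = j})"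
      unfolding em[OF atMost_borel] by (rule arg_cong[where f = "emeasure M"]) auto
    also have "\<dots> = ennreal (measure M (A \<inter> {\<omega>\<in>space M. J n \<omega> = i \<and> X (Suc n) \<omega> \<le> x \<and> J (Suc n) \<omega> = j}))"
      by (rule emeasure_eq_measure)
    also have "measure M (A \<inter> {\<omega>\<in>space M. J n \<omega> = i \<and> X (Suc n) \<omega> \<le> x \<and> J (Suc n) \<omega> = j}) =
        H i j x * measure M (A \<inter> {\<omega>\<in>space M. J n \<omega> = i})"
      using MAP A i j unfolding is_MAP_def sets_past by blast
    also have "\<dots> = emeasure (scale_measure ?p (interval_measure (H i j))) {..x}"
      unfolding emeasure_scale_measure H_interval_measure(2)[OF i j] emeasure_eq_measure
      by (subst ennreal_mult'[symmetric]) (auto simp: H_interval_measure(4)[OF i j] mult.commute)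
    finally show "emeasure ?\<nu> {..x} = emeasure (scale_measure ?p (interval_measure (H i j))) {..x}" .
  qed (simp_all only: sets_distr sets_scale_measure sets_interval_measure)
  then have "(\<integral>\<^sup>+x. \<phi> x \<partial>?\<nu>) = ?p * (\<integral>\<^sup>+x. \<phi> x \<partial>interval_measure (H i j))"
    by (simp add: nn_integral_scale_measure)
  then show ?thesis by (simp add: nn_integral_distr nn_integral_density)
qed

text \<open>The same extension in the other argument: for fixed \<open>\<phi>\<close> both sides are
  measures of the past event, and equal measures on \<open>past n\<close> give the same integral of
  \<open>W\<close>.\<close>

lemma kernel_integral:
  assumes W: "W \<in> borel_measurable (past n)" and i: "i < d" and j: "j < d"
    and \<phi> [measurable]: "\<phi> \<in> borel_measurable borel"
  shows "(\<integral>\<^sup>+\<omega>. W \<omega> * indicator {\<omega>\<in>space M. J n \<omega> = i \<and> J (Suc n) \<omega> = j} \<omega> * \<phi> (X (Suc n) \<omega>) \<partial>M)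
    = (\<integral>\<^sup>+\<omega>. W \<omega> * indicator {\<omega>\<in>space M. J n \<omega> = i} \<omega> \<partial>M) * (\<integral>\<^sup>+x. \<phi> x \<partial>interval_measure (H i j))"
proof -
  let ?I = "\<integral>\<^sup>+x. \<phi> x \<partial>interval_measure (H i j)"
  let ?f = "\<lambda>\<omega>. indicator {\<omega>\<in>space M. J n \<omega> = i \<and> J (Suc n) \<omega> = j} \<omega> * \<phi> (X (Suc n) \<omega>)"
  let ?g = "indicator {\<omega>\<in>space M. J n \<omega> = i}"
  \<comment> \<open>Pushing forward along the identity into \<open>past n\<close> restricts a
    measure on \<open>M\<close> to the smaller sigma-algebra.\<close>
  have id [measurable]: "(\<lambda>\<omega>. \<omega>) \<in> measurable M (past n)"
    using sets_past_le by (auto simp: measurable_def)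
  have [measurable]: "W \<in> borel_measurable M" using W by (rule measurable_past_imp)
  have "distr (density M ?f) (past n) (\<lambda>\<omega>. \<omega>) = scale_measure ?I (distr (density M ?g) (past n) (\<lambda>\<omega>. \<omega>))"
  proof (rule measure_eqI)
    fix A assume "A \<in> sets (distr (density M ?f) (past n) (\<lambda>\<omega>. \<omega>))"
    then have A: "A \<in> sets (past n)" by simp
    have [measurable]: "A \<in> sets M" using A sets_past_le by auto
    have AM: "A \<inter> space M = A" using sets.sets_into_space[OF \<open>A \<in> sets M\<close>] by auto
    have "emeasure (distr (density M ?f) (past n) (\<lambda>\<omega>. \<omega>)) A = (\<integral>\<^sup>+\<omega>. ?f \<omega> * indicator A \<omega> \<partial>M)"
      using A by (subst emeasure_distr) (auto simp: emeasure_density AM)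
    also have "\<dots> = (\<integral>\<^sup>+\<omega>. indicator (A \<inter> {\<omega>\<in>space M. J n \<omega> = i \<and> J (Suc n) \<omega> = j}) \<omega> * \<phi> (X (Suc n) \<omega>) \<partial>M)"
      by (intro nn_integral_cong) (auto split: split_indicator)
    also have "\<dots> = emeasure M (A \<inter> {\<omega>\<in>space M. J n \<omega> = i}) * ?I"
      using A i j by (rule kernel_event) simp
    also have "emeasure M (A \<inter> {\<omega>\<in>space M. J n \<omega> = i}) = (\<integral>\<^sup>+\<omega>. indicator (A \<inter> {\<omega>\<in>space M. J n \<omega> = i}) \<omega> \<partial>M)"
      by (rule nn_integral_indicator[symmetric]) measurable
    also have "\<dots> = (\<integral>\<^sup>+\<omega>. ?g \<omega> * indicator A \<omega> \<partial>M)"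
      by (intro nn_integral_cong) (auto split: split_indicator)
    also have "\<dots> = emeasure (distr (density M ?g) (past n) (\<lambda>\<omega>. \<omega>)) A"
      using A by (subst emeasure_distr) (auto simp: emeasure_density AM)
    finally show "emeasure (distr (density M ?f) (past n) (\<lambda>\<omega>. \<omega>)) A =
       emeasure (scale_measure ?I (distr (density M ?g) (past n) (\<lambda>\<omega>. \<omega>))) A"
      by (simp add: mult.commute)
  qed simp
  then have "(\<integral>\<^sup>+\<omega>. W \<omega> \<partial>distr (density M ?f) (past n) (\<lambda>\<omega>. \<omega>)) =
     ?I * (\<integral>\<^sup>+\<omega>. W \<omega> \<partial>distr (density M ?g) (past n) (\<lambda>\<omega>. \<omega>))"
    using W by (simp add: nn_integral_scale_measure)
  then have "(\<integral>\<^sup>+\<omega>. ?f \<omega> * W \<omega> \<partial>M) = ?I * (\<integral>\<^sup>+\<omega>. ?g \<omega> * W \<omega> \<partial>M)"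
    using W id by (simp add: nn_integral_distr nn_integral_density)
  then show ?thesis by (simp add: ac_simps)
qed

text \<open>Conditionally on the past and on state \<open>i\<close>, the last factor contributes the
  row sum of its kernel integrals, which is at most \<open>K\<close>; summing over the transitions
  gives the supermartingale step.\<close>

lemma one_step_bound:
  assumes W: "W \<in> borel_measurable (past n)"
    and \<phi> [measurable]: "\<And>i j. \<phi> i j \<in> borel_measurable borel"
    and K: "\<And>i. i < d \<Longrightarrow> (\<Sum>j<d. \<integral>\<^sup>+x. \<phi> i j x \<partial>interval_measure (H i j)) \<le> K"
  shows "(\<integral>\<^sup>+\<omega>. W \<omega> * \<phi> (J n \<omega>) (J (Suc n) \<omega>) (X (Suc n) \<omega>) \<partial>M) \<le> K * (\<integral>\<^sup>+\<omega>. W \<omega> \<partial>M)"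
proof -
  have [measurable]: "W \<in> borel_measurable M" using W by (rule measurable_past_imp)
  let ?g = "\<lambda>i. indicator {\<omega>\<in>space M. J n \<omega> = i} :: 'a \<Rightarrow> ennreal"
  have "(\<integral>\<^sup>+\<omega>. W \<omega> * \<phi> (J n \<omega>) (J (Suc n) \<omega>) (X (Suc n) \<omega>) \<partial>M) =
    (\<integral>\<^sup>+\<omega>. (\<Sum>i<d. \<Sum>j<d. W \<omega> * indicator {\<omega>\<in>space M. J n \<omega> = i \<and> J (Suc n) \<omega> = j} \<omega> * \<phi> i j (X (Suc n) \<omega>)) \<partial>M)"
  proof (rule nn_integral_cong)
    fix \<omega> assume \<omega>: "\<omega> \<in> space M"
    have "(\<Sum>i<d. \<Sum>j<d. W \<omega> * indicator {\<omega>\<in>space M. J n \<omega> = i \<and> J (Suc n) \<omega> = j} \<omega> * \<phi> i j (X (Suc n) \<omega>)) =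
       (\<Sum>i<d. \<Sum>j<d. if i = J n \<omega> then (if j = J (Suc n) \<omega> then W \<omega> * \<phi> i j (X (Suc n) \<omega>) else 0) else 0)"
      using \<omega> by (intro sum.cong refl) (auto split: split_indicator)
    also have "\<dots> = (\<Sum>i<d. if i = J n \<omega> then (\<Sum>j<d. if j = J (Suc n) \<omega> then W \<omega> * \<phi> i j (X (Suc n) \<omega>) else 0) else 0)"
      by (intro sum.cong refl) auto
    also have "\<dots> = W \<omega> * \<phi> (J n \<omega>) (J (Suc n) \<omega>) (X (Suc n) \<omega>)"
      using J_less[OF \<omega>] by simp
    finally show "W \<omega> * \<phi> (J n \<omega>) (J (Suc n) \<omega>) (X (Suc n) \<omega>) =
      (\<Sum>i<d. \<Sum>j<d. W \<omega> * indicator {\<omega>\<in>space M. J n \<omega> = i \<and> J (Suc n) \<omega> = j} \<omega> * \<phi> i j (X (Suc n) \<omega>))" ..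
  qed
  also have "\<dots> = (\<Sum>i<d. \<Sum>j<d. \<integral>\<^sup>+\<omega>. W \<omega> * indicator {\<omega>\<in>space M. J n \<omega> = i \<and> J (Suc n) \<omega> = j} \<omega> * \<phi> i j (X (Suc n) \<omega>) \<partial>M)"
    by (simp add: nn_integral_sum)
  also have "\<dots> = (\<Sum>i<d. \<Sum>j<d. (\<integral>\<^sup>+\<omega>. W \<omega> * ?g i \<omega> \<partial>M) * (\<integral>\<^sup>+x. \<phi> i j x \<partial>interval_measure (H i j)))"
    by (intro sum.cong refl kernel_integral[OF W]) auto
  also have "\<dots> = (\<Sum>i<d. (\<integral>\<^sup>+\<omega>. W \<omega> * ?g i \<omega> \<partial>M) * (\<Sum>j<d. \<integral>\<^sup>+x. \<phi> i j x \<partial>interval_measure (H i j)))"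
    by (simp add: sum_distrib_left)
  also have "\<dots> \<le> (\<Sum>i<d. (\<integral>\<^sup>+\<omega>. W \<omega> * ?g i \<omega> \<partial>M) * K)"
    using K by (intro sum_mono mult_left_mono) auto
  also have "\<dots> = K * (\<Sum>i<d. \<integral>\<^sup>+\<omega>. W \<omega> * ?g i \<omega> \<partial>M)"
    unfolding sum_distrib_right[symmetric] by (rule mult.commute)
  also have "(\<Sum>i<d. \<integral>\<^sup>+\<omega>. W \<omega> * ?g i \<omega> \<partial>M) = (\<integral>\<^sup>+\<omega>. (\<Sum>i<d. W \<omega> * ?g i \<omega>) \<partial>M)"
    by (rule nn_integral_sum[symmetric]) measurable
  also have "(\<integral>\<^sup>+\<omega>. (\<Sum>i<d. W \<omega> * ?g i \<omega>) \<partial>M) = (\<integral>\<^sup>+\<omega>. W \<omega> \<partial>M)"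
  proof (rule nn_integral_cong)
    fix \<omega> assume \<omega>: "\<omega> \<in> space M"
    have "(\<Sum>i<d. W \<omega> * ?g i \<omega>) = (\<Sum>i<d. if J n \<omega> = i then W \<omega> else 0)"
      using \<omega> by (intro sum.cong) auto
    then show "(\<Sum>i<d. W \<omega> * ?g i \<omega>) = W \<omega>" using J_less[OF \<omega>] by simp
  qed
  finally show ?thesis .
qed

section \<open>Maximal inequalities for functionals of the transitions\<close>

definition incr :: "(nat \<Rightarrow> nat \<Rightarrow> real \<Rightarrow> real) \<Rightarrow> nat \<Rightarrow> 'a \<Rightarrow> real" where
  "incr u l \<omega> = u (J l \<omega>) (J (Suc l) \<omega>) (X (Suc l) \<omega>)"

lemma incr_past:
  assumes u: "\<And>i j. u i j \<in> borel_measurable borel" and "l < n"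
  shows "incr u l \<in> borel_measurable (past n)"
proof -
  have [measurable]: "J l \<in> measurable (past n) (count_space UNIV)"
    "J (Suc l) \<in> measurable (past n) (count_space UNIV)" "X (Suc l) \<in> borel_measurable (past n)"
    using assms by (auto intro!: J_past X_past)
  have "(\<lambda>\<omega>. u i j (X (Suc l) \<omega>)) \<in> borel_measurable (past n)" for i j
    using u by measurable
  then have "(\<lambda>\<omega>. u i (J (Suc l) \<omega>) (X (Suc l) \<omega>)) \<in> borel_measurable (past n)" for i
    by (rule measurable_compose_countable[where f = "\<lambda>j \<omega>. u i j (X (Suc l) \<omega>)" and g = "J (Suc l)"]) auto
  then have "(\<lambda>\<omega>. u (J l \<omega>) (J (Suc l) \<omega>) (X (Suc l) \<omega>)) \<in> borel_measurable (past n)"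
    by (rule measurable_compose_countable[where f = "\<lambda>i \<omega>. u i (J (Suc l) \<omega>) (X (Suc l) \<omega>)" and g = "J l"]) auto
  then show ?thesis by (simp add: incr_def[abs_def])
qed

lemma incr_measurable:
  "(\<And>i j. u i j \<in> borel_measurable borel) \<Longrightarrow> incr u l \<in> borel_measurable M"
  by (rule measurable_past_imp[OF incr_past[of u l "Suc l"]]) auto

text \<open>Doob's argument with the first passage above \<open>z\<close> built into the process:
  \<open>R k\<close> is the exponential functional before the passage and stays at exp (\<theta> z)
  afterwards. Its expectation grows by at most the factor \<rho> per step, and Markov's inequality
  at time \<open>n\<close> covers the whole maximum.\<close>

lemma maximal_exp_bound:
  assumes u [measurable]: "\<And>i j. u i j \<in> borel_measurable borel"
    and \<theta>: "0 \<le> \<theta>" and \<rho>: "1 \<le> \<rho>"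
    and mgf: "\<And>i. i < d \<Longrightarrow> (\<Sum>j<d. \<integral>\<^sup>+x. ennreal (exp (\<theta> * u i j x)) \<partial>interval_measure (H i j)) \<le> ennreal \<rho>"
  shows "prob {\<omega>\<in>space M. \<exists>k\<le>n. z \<le> (\<Sum>l<k. incr u l \<omega>)} \<le> exp (- \<theta> * z) * \<rho> ^ n"
proof -
  define D where "D k \<omega> = (\<Sum>l<k. incr u l \<omega>)" for k \<omega>
  define B where "B k = {\<omega>\<in>space M. \<forall>l\<le>k. D l \<omega> < z}" for k
  define R where "R k \<omega> = (if \<omega> \<in> B k then ennreal (exp (\<theta> * D k \<omega>)) else ennreal (exp (\<theta> * z)))" for k \<omega>
  have D_past: "D k \<in> borel_measurable (past n)" if "k \<le> n" for k n
    unfolding D_def[abs_def] using that by (intro borel_measurable_sum incr_past u) auto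
  have [measurable]: "D k \<in> borel_measurable M" for k
    by (rule measurable_past_imp[OF D_past[OF order_refl]])
  have B_past: "B k \<in> sets (past k)" for k
  proof -
    have "B k = (\<Inter>l\<in>{..k}. {\<omega>\<in>space (past k). D l \<omega> < z})" by (auto simp: B_def)
    also have "\<dots> \<in> sets (past k)"
      by (intro sets.finite_INT borel_measurable_less D_past) auto
    finally show ?thesis .
  qed
  have [measurable]: "B k \<in> sets M" for k using B_past[of k] sets_past_le by auto
  have R_meas [measurable]: "R k \<in> borel_measurable M" for k unfolding R_def by measurable
  have R_bound: "(\<integral>\<^sup>+\<omega>. R k \<omega> \<partial>M) \<le> ennreal \<rho> ^ k" for k
  proof (induction k)
    case 0
    have "(\<integral>\<^sup>+\<omega>. R 0 \<omega> \<partial>M) \<le> (\<integral>\<^sup>+\<omega>. 1 \<partial>M)"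
    proof (intro nn_integral_mono)
      fix \<omega> assume "\<omega> \<in> space M"
      then show "R 0 \<omega> \<le> 1" using \<theta> by (auto simp: R_def B_def D_def mult_nonneg_nonpos)
    qed
    then show ?case by (simp add: emeasure_space_1)
  next
    case (Suc k)
    let ?W = "\<lambda>\<omega>. indicator (B k) \<omega> * ennreal (exp (\<theta> * D k \<omega>))"
    let ?V = "\<lambda>\<omega>. indicator (space M - B k) \<omega> * ennreal (exp (\<theta> * z))"
    have W: "?W \<in> borel_measurable (past k)"
      using B_past[of k] D_past[of k k] by measurable
    have R_eq: "(\<integral>\<^sup>+\<omega>. R k \<omega> \<partial>M) = (\<integral>\<^sup>+\<omega>. ?V \<omega> \<partial>M) + (\<integral>\<^sup>+\<omega>. ?W \<omega> \<partial>M)"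
      by (subst nn_integral_add[symmetric]) (auto simp: R_def intro!: nn_integral_cong split: split_indicator)
    have "(\<integral>\<^sup>+\<omega>. R (Suc k) \<omega> \<partial>M) \<le>
      (\<integral>\<^sup>+\<omega>. ?V \<omega> + ?W \<omega> * ennreal (exp (\<theta> * u (J k \<omega>) (J (Suc k) \<omega>) (X (Suc k) \<omega>))) \<partial>M)"
    proof (intro nn_integral_mono)
      fix \<omega> assume \<omega>: "\<omega> \<in> space M"
      have D_Suc: "exp (\<theta> * D (Suc k) \<omega>) = exp (\<theta> * D k \<omega>) * exp (\<theta> * u (J k \<omega>) (J (Suc k) \<omega>) (X (Suc k) \<omega>))"
        by (simp add: D_def incr_def ring_distribs exp_add)
      show "R (Suc k) \<omega> \<le> ?V \<omega> + ?W \<omega> * ennreal (exp (\<theta> * u (J k \<omega>) (J (Suc k) \<omega>) (X (Suc k) \<omega>)))"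
      proof (cases "\<omega> \<in> B k")
        case True
        have "R (Suc k) \<omega> \<le> ennreal (exp (\<theta> * D (Suc k) \<omega>))"
        proof (cases "\<omega> \<in> B (Suc k)")
          case False
          \<comment> \<open>At the passage the walk may overshoot \<open>z\<close>; freezing at exp
            (\<theta> z) then only lowers the value.\<close>
          then have "z \<le> D (Suc k) \<omega>" using True by (auto simp: B_def le_Suc_eq)
          then show ?thesis using False \<theta> by (auto simp: R_def intro!: ennreal_leI mult_left_mono)
        qed (simp add: R_def)
        then show ?thesis using True unfolding D_Suc by (simp add: ennreal_mult)
      next
        case False
        moreover have "B (Suc k) \<subseteq> B k" by (auto simp: B_def)
        ultimately have "\<omega> \<notin> B (Suc k)" by blast
        with False show ?thesis using \<omega> by (simp add: R_def)
      qed
    qed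
    also have "\<dots> = (\<integral>\<^sup>+\<omega>. ?V \<omega> \<partial>M) +
        (\<integral>\<^sup>+\<omega>. ?W \<omega> * ennreal (exp (\<theta> * u (J k \<omega>) (J (Suc k) \<omega>) (X (Suc k) \<omega>))) \<partial>M)"
      using incr_measurable[OF u, where l = k] by (intro nn_integral_add) (auto simp flip: incr_def)
    also have "\<dots> \<le> (\<integral>\<^sup>+\<omega>. ?V \<omega> \<partial>M) + ennreal \<rho> * (\<integral>\<^sup>+\<omega>. ?W \<omega> \<partial>M)"
      by (intro add_left_mono one_step_bound[OF W, where \<phi> = "\<lambda>i j x. ennreal (exp (\<theta> * u i j x))"] mgf) auto
    also have "\<dots> \<le> ennreal \<rho> * (\<integral>\<^sup>+\<omega>. ?V \<omega> \<partial>M) + ennreal \<rho> * (\<integral>\<^sup>+\<omega>. ?W \<omega> \<partial>M)"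
    proof (intro add_right_mono)
      have "1 \<le> ennreal \<rho>" using ennreal_leI[OF \<rho>] by simp
      then show "(\<integral>\<^sup>+\<omega>. ?V \<omega> \<partial>M) \<le> ennreal \<rho> * (\<integral>\<^sup>+\<omega>. ?V \<omega> \<partial>M)"
        using mult_right_mono[of 1 "ennreal \<rho>" "\<integral>\<^sup>+\<omega>. ?V \<omega> \<partial>M"] by simp
    qed
    also have "\<dots> \<le> ennreal \<rho> * ennreal \<rho> ^ k"
      using Suc unfolding R_eq distrib_left[symmetric] by (intro mult_left_mono) auto
    finally show ?case by simp
  qed
  let ?E = "{\<omega>\<in>space M. \<exists>k\<le>n. z \<le> (\<Sum>l<k. incr u l \<omega>)}"
  have E: "?E = space M - B n" by (auto simp: B_def D_def not_less)
  have "ennreal (exp (\<theta> * z)) * emeasure M ?E = (\<integral>\<^sup>+\<omega>. ennreal (exp (\<theta> * z)) * indicator ?E \<omega> \<partial>M)"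
    unfolding E by (subst nn_integral_cmult_indicator) auto
  also have "\<dots> \<le> (\<integral>\<^sup>+\<omega>. R n \<omega> \<partial>M)"
    unfolding E by (intro nn_integral_mono) (auto simp: R_def split: split_indicator)
  also have "\<dots> \<le> ennreal (\<rho> ^ n)" using R_bound[of n] \<rho> by (simp add: ennreal_power)
  finally have "exp (\<theta> * z) * prob ?E \<le> \<rho> ^ n"
    using \<rho> by (simp add: emeasure_eq_measure ennreal_mult[symmetric])
  then show ?thesis by (simp add: exp_minus field_simps)
qed

lemma some_increment_bound:
  assumes u [measurable]: "\<And>i j. u i j \<in> borel_measurable borel"
    and p: "0 \<le> p" "\<And>i. i < d \<Longrightarrow> (\<Sum>j<d. measure (interval_measure (H i j)) {x. y < u i j x}) \<le> p"
  shows "prob {\<omega>\<in>space M. \<exists>l<n. y < incr u l \<omega>} \<le> real n * p"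
proof -
  note [measurable] = incr_measurable[OF u]
  have one: "prob {\<omega>\<in>space M. y < incr u l \<omega>} \<le> p" for l
  proof -
    let ?\<phi> = "\<lambda>i j x. indicator {x. y < u i j x} x :: ennreal"
    have "emeasure M {\<omega>\<in>space M. y < incr u l \<omega>} = (\<integral>\<^sup>+\<omega>. indicator {\<omega>\<in>space M. y < incr u l \<omega>} \<omega> \<partial>M)"
      by (rule nn_integral_indicator[symmetric]) measurable
    also have "\<dots> = (\<integral>\<^sup>+\<omega>. 1 * ?\<phi> (J l \<omega>) (J (Suc l) \<omega>) (X (Suc l) \<omega>) \<partial>M)"
      by (intro nn_integral_cong) (auto simp: incr_def split: split_indicator)
    also have "\<dots> \<le> ennreal p * (\<integral>\<^sup>+\<omega>. 1 \<partial>M)"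
    proof (rule one_step_bound)
      fix i assume i: "i < d"
      have "(\<Sum>j<d. \<integral>\<^sup>+x. ?\<phi> i j x \<partial>interval_measure (H i j)) =
        (\<Sum>j<d. ennreal (measure (interval_measure (H i j)) {x. y < u i j x}))"
      proof (intro sum.cong refl)
        fix j assume "j \<in> {..<d}"
        then interpret finite_measure "interval_measure (H i j)" using i by (intro H_interval_measure) auto
        show "(\<integral>\<^sup>+x. ?\<phi> i j x \<partial>interval_measure (H i j)) = ennreal (measure (interval_measure (H i j)) {x. y < u i j x})"
          by (simp add: emeasure_eq_measure)
      qed
      also have "\<dots> \<le> ennreal p" using p(2)[OF i] by (simp add: ennreal_leI)
      finally show "(\<Sum>j<d. \<integral>\<^sup>+x. ?\<phi> i j x \<partial>interval_measure (H i j)) \<le> ennreal p" .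
    qed auto
    finally show ?thesis using p by (simp add: emeasure_eq_measure emeasure_space_1 prob_space)
  qed
  have "{\<omega>\<in>space M. \<exists>l<n. y < incr u l \<omega>} = (\<Union>l\<in>{..<n}. {\<omega>\<in>space M. y < incr u l \<omega>})" by auto
  also have "prob \<dots> \<le> (\<Sum>l<n. prob {\<omega>\<in>space M. y < incr u l \<omega>})"
    by (intro finite_measure_subadditive_finite) auto
  also have "\<dots> \<le> (\<Sum>l<n. p)" by (intro sum_mono one)
  finally show ?thesis by simp
qed

text \<open>If no increment exceeds \<open>y\<close>, truncation at \<open>y\<close> changes no
  partial sum; the exceptional event is paid for by the union bound
  \<open>real n * p\<close>.\<close>

lemma maximal_truncated_bound:
  assumes u [measurable]: "\<And>i j. u i j \<in> borel_measurable borel"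
    and \<theta>: "0 \<le> \<theta>" and \<rho>: "1 \<le> \<rho>"
    and mgf: "\<And>i. i < d \<Longrightarrow> (\<Sum>j<d. \<integral>\<^sup>+x. ennreal (exp (\<theta> * min (u i j x) y)) \<partial>interval_measure (H i j)) \<le> ennreal \<rho>"
    and p: "0 \<le> p" "\<And>i. i < d \<Longrightarrow> (\<Sum>j<d. measure (interval_measure (H i j)) {x. y < u i j x}) \<le> p"
  shows "prob {\<omega>\<in>space M. \<exists>k\<le>n. z \<le> (\<Sum>l<k. incr u l \<omega>)} \<le> real n * p + exp (- \<theta> * z) * \<rho> ^ n"
proof -
  let ?v = "\<lambda>i j x. min (u i j x) y"
  have v: "?v i j \<in> borel_measurable borel" for i j by measurable
  note [measurable] = incr_measurable[OF u] incr_measurable[OF v]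
  have "prob {\<omega>\<in>space M. \<exists>k\<le>n. z \<le> (\<Sum>l<k. incr u l \<omega>)} \<le>
    prob ({\<omega>\<in>space M. \<exists>l<n. y < incr u l \<omega>} \<union> {\<omega>\<in>space M. \<exists>k\<le>n. z \<le> (\<Sum>l<k. incr ?v l \<omega>)})"
  proof (rule finite_measure_mono)
    show "{\<omega>\<in>space M. \<exists>k\<le>n. z \<le> (\<Sum>l<k. incr u l \<omega>)} \<subseteq>
      {\<omega>\<in>space M. \<exists>l<n. y < incr u l \<omega>} \<union> {\<omega>\<in>space M. \<exists>k\<le>n. z \<le> (\<Sum>l<k. incr ?v l \<omega>)}"
    proof (intro subsetI)
      fix \<omega>
      have incr_min: "incr ?v l \<omega> = min (incr u l \<omega>) y" for l by (simp add: incr_def)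
      assume "\<omega> \<in> {\<omega>\<in>space M. \<exists>k\<le>n. z \<le> (\<Sum>l<k. incr u l \<omega>)}"
      then obtain k where k: "\<omega> \<in> space M" "k \<le> n" "z \<le> (\<Sum>l<k. incr u l \<omega>)" by auto
      show "\<omega> \<in> {\<omega>\<in>space M. \<exists>l<n. y < incr u l \<omega>} \<union> {\<omega>\<in>space M. \<exists>k\<le>n. z \<le> (\<Sum>l<k. incr ?v l \<omega>)}"
      proof (cases "\<exists>l<n. y < incr u l \<omega>")
        case False
        then have "incr u l \<omega> \<le> y" if "l < n" for l using that by (meson not_less)
        then have "(\<Sum>l<k. incr u l \<omega>) = (\<Sum>l<k. incr ?v l \<omega>)"
          using k(2) by (intro sum.cong) (auto simp: incr_min min_absorb1)
        then show ?thesis using k by auto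
      qed (use k in auto)
    qed
  qed measurable
  also have "\<dots> \<le> prob {\<omega>\<in>space M. \<exists>l<n. y < incr u l \<omega>} + prob {\<omega>\<in>space M. \<exists>k\<le>n. z \<le> (\<Sum>l<k. incr ?v l \<omega>)}"
    by (intro measure_Un_le) measurable
  also have "\<dots> \<le> real n * p + exp (- \<theta> * z) * \<rho> ^ n"
    by (intro add_mono some_increment_bound maximal_exp_bound u v \<theta> \<rho> mgf p)
  finally show ?thesis .
qed

section \<open>Deviations of the centred walk, with a bound linear in n\<close>

lemma Hinf_eq_measure: "i < d \<Longrightarrow> j < d \<Longrightarrow> measure (interval_measure (H i j)) UNIV = Hinf H i j"
  using H_interval_measure(3) by (simp add: Hinf_def)

text \<open>With y = \<eta> x / 2, q = n e0 G(y) and l = ln (1 / q) / y one has exp (l y) = 1 / q,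
  so the truncated moment adds at most 1 / n to the one-step factor. Over n <= x steps that factor
  grows to at most exp (l y + 1), against exp (- 2 l y) from the Chernoff bound; what remains is exp
  1 * q, of the same order as the union bound for large increments. The sign \<open>s\<close> covers
  both tails.\<close>

lemma deviation:
  fixes g :: "nat \<Rightarrow> real" and h s \<eta> \<epsilon> :: real
  assumes G: "dominated_fun G c"
    and tl: "\<And>i j. i < d \<Longrightarrow> j < d \<Longrightarrow>
        ((\<lambda>t. measure (interval_measure (H i j)) {x. t < \<bar>x\<bar>} / G t) \<longlongrightarrow> 0) at_top"
    and int: "\<And>i j. i < d \<Longrightarrow> j < d \<Longrightarrow> integrable (interval_measure (H i j)) (\<lambda>x. x)"
    and poisson: "\<And>i. i < d \<Longrightarrow>
        (\<Sum>j<d. \<integral>x. x \<partial>interval_measure (H i j)) - h + (\<Sum>j<d. Hinf H i j * g j) = g i"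
    and s: "\<bar>s\<bar> = 1" and \<eta>: "0 < \<eta>" and \<epsilon>: "0 < \<epsilon>"
  shows "\<forall>\<^sub>F x in at_top. \<forall>n. 1 \<le> n \<and> real n \<le> x \<longrightarrow>
    prob {\<omega>\<in>space M. \<exists>k\<le>n. \<eta> * x \<le> (\<Sum>l<k. incr (\<lambda>i j y. s * (y + (g j - g i - h))) l \<omega>)}
      \<le> \<epsilon> * (real n * G x)"
proof -
  interpret G: dominated_fun G c by fact
  define u where "u i j x = s * (x + (g j - g i - h))" for i j and x :: real
  have u [measurable]: "u i j \<in> borel_measurable borel" for i j unfolding u_def by measurable
  \<comment> \<open>One more than the Archimedean exponent makes \<open>m\<close> positive and keeps
    2^m >= 2 / c.\<close>
  obtain m :: nat where m: "2 / c \<le> 2 ^ m" "0 < m"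
  proof -
    obtain m :: nat where "2 / c < 2 ^ m" using real_arch_pow[of 2 "2 / c"] by auto
    also have "(2::real) ^ m \<le> 2 ^ Suc m" by simp
    finally show ?thesis using that[of "Suc m"] by simp
  qed
  obtain C where C: "C > 0" "\<forall>\<^sub>F x in at_top. G (\<eta> / 2 * x) \<le> C * G x"
    using G.G_scale[of "\<eta> / 2"] \<eta> by auto
  \<comment> \<open>The first bound makes the final constant e0 * C * (1 + exp 1) at most
    \<open>\<epsilon>\<close>; the second keeps \<open>q\<close> at most 1 / 2, hence
    \<open>l\<close> positive.\<close>
  define e0 where "e0 = min (\<epsilon> / (C * (1 + exp 1))) (\<eta> / 4)"
  have K: "0 < C * (1 + exp (1::real))" using C by (simp add: add_pos_pos)
  have "e0 \<le> \<epsilon> / (C * (1 + exp 1))" "e0 \<le> \<eta> / 4"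
    unfolding e0_def by (rule min.cobounded1, rule min.cobounded2)
  moreover have "0 < e0" unfolding e0_def using \<epsilon> \<eta> K by (simp del: mult_pos_pos)
  ultimately have e0: "0 < e0" "e0 * (C * (1 + exp 1)) \<le> \<epsilon>" "e0 \<le> \<eta> / 4"
    using K by (simp_all only: pos_le_divide_eq)
  have d: "0 < real d" using d_pos by simp

  have fin: "finite_measure (interval_measure (H i j))" if "i < d" "j < d" for i j
    using H_interval_measure(1) that .
  have int_u: "integrable (interval_measure (H i j)) (u i j)" if "i < d" "j < d" for i j
  proof -
    interpret finite_measure "interval_measure (H i j)" using that by (rule fin)
    show ?thesis using int[OF that] unfolding u_def by auto
  qed
  have mean_u: "(\<integral>x. u i j x \<partial>interval_measure (H i j)) =
      s * ((\<integral>x. x \<partial>interval_measure (H i j)) + (g j - g i - h) * Hinf H i j)" if "i < d" "j < d" for i j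
  proof -
    interpret finite_measure "interval_measure (H i j)" using that by (rule fin)
    show ?thesis using int[OF that] Hinf_eq_measure[OF that] unfolding u_def by simp
  qed
  have row: "(\<Sum>j<d. Hinf H i j) = 1" if "i < d" for i
    using stoch that by (simp add: stochastic_matrix_def)
  \<comment> \<open>The Poisson equation and the unit row sums cancel the drift in every single
    state, not only on average under \<open>\<pi>\<close>.\<close>
  have drift_u: "(\<Sum>j<d. \<integral>x. u i j x \<partial>interval_measure (H i j)) = 0" if i: "i < d" for i
  proof -
    have "(\<Sum>j<d. \<integral>x. u i j x \<partial>interval_measure (H i j)) =
      (\<Sum>j<d. s * ((\<integral>x. x \<partial>interval_measure (H i j)) + Hinf H i j * g j - (g i + h) * Hinf H i j))"
      using mean_u[OF i] by (intro sum.cong) (auto simp: algebra_simps)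
    also have "\<dots> = s * ((\<Sum>j<d. \<integral>x. x \<partial>interval_measure (H i j)) + (\<Sum>j<d. Hinf H i j * g j)
       - (g i + h) * (\<Sum>j<d. Hinf H i j))"
      by (simp add: sum_distrib_left sum.distrib sum_subtractf algebra_simps)
    also have "\<dots> = 0" using poisson[OF i] row[OF i] by simp
    finally show ?thesis .
  qed

  let ?b = "\<lambda>i j y. \<integral>x. (min \<bar>u i j x\<bar> y / y) ^ m \<partial>interval_measure (H i j)"
  have tail_u: "((\<lambda>t. measure (interval_measure (H i j)) {x. t < \<bar>u i j x\<bar>} / G t) \<longlongrightarrow> 0) at_top"
    if "i < d" "j < d" for i j
    using G.shifted_tail_tendsto_0[OF fin[OF that] _ tl[OF that] s, of "g j - g i - h"]
    by (simp add: u_def)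
  have "((\<lambda>y. ?b i j y / G y) \<longlongrightarrow> 0) at_top" if "i < d" "j < d" for i j
    using G.truncated_moment_tendsto_0[OF fin[OF that] _ _ m(1), of "u i j"] tail_u[OF that] by simp
  then have "\<forall>\<^sub>F y in at_top. ?b i j y / G y < e0 / d" if "i < d" "j < d" for i j
    using that e0 d by (intro order_tendstoD) auto
  then have ev_b: "\<forall>\<^sub>F y in at_top. \<forall>i\<in>{..<d}. \<forall>j\<in>{..<d}. ?b i j y / G y < e0 / d"
    by (intro eventually_ball_finite ballI) auto
  have "\<forall>\<^sub>F y in at_top. measure (interval_measure (H i j)) {x. y < \<bar>u i j x\<bar>} / G y < e0 / d"
    if "i < d" "j < d" for i j
    using tail_u[OF that] e0 d by (intro order_tendstoD) auto
  then have ev_t: "\<forall>\<^sub>F y in at_top. \<forall>i\<in>{..<d}. \<forall>j\<in>{..<d}.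
      measure (interval_measure (H i j)) {x. y < \<bar>u i j x\<bar>} / G y < e0 / d"
    by (intro eventually_ball_finite ballI) auto
  have "\<forall>\<^sub>F l in at_right 0. \<forall>i\<in>{..<d}. \<forall>j\<in>{..<d}. \<forall>y>0.
    (\<integral>\<^sup>+x. ennreal (exp (l * min (u i j x) y)) \<partial>interval_measure (H i j)) \<le>
    ennreal (measure (interval_measure (H i j)) (space (interval_measure (H i j)))
      + l * (\<integral>x. u i j x \<partial>interval_measure (H i j)) + \<eta> / (2 * d) * l + exp (l * y) * ?b i j y)"
    using d \<eta>
    by (intro eventually_ball_finite ballI finite_measure.truncated_mgf_le[OF fin int_u m(2)]) auto
  \<comment> \<open>Below \<open>l0\<close> the expansion holds for all truncation levels at once.
    Its error \<open>\<eta> / (2 * d)\<close> per entry adds up to \<open>\<eta> / 2\<close> over a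
    row.\<close>
  then obtain l0 where l0: "0 < l0" and mgf: "\<And>l i j y. 0 < l \<Longrightarrow> l < l0 \<Longrightarrow> i < d \<Longrightarrow> j < d \<Longrightarrow> 0 < y \<Longrightarrow>
    (\<integral>\<^sup>+x. ennreal (exp (l * min (u i j x) y)) \<partial>interval_measure (H i j)) \<le>
    ennreal (measure (interval_measure (H i j)) UNIV
      + l * (\<integral>x. u i j x \<partial>interval_measure (H i j)) + \<eta> / (2 * d) * l + exp (l * y) * ?b i j y)"
    unfolding eventually_at_right_field by auto
  \<comment> \<open>For n >= 1 the parameter \<open>l\<close> is at most this quantity, so it falls
    below \<open>l0\<close> uniformly in \<open>n\<close>.\<close>
  have "((\<lambda>y. ln (1 / e0) / y + ln (1 / G y) / y) \<longlongrightarrow> 0 + 0) at_top"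
    by (intro tendsto_add G.ln_G_sublinear tendsto_divide_0[OF tendsto_const]
        filterlim_at_top_imp_at_infinity filterlim_ident)
  then have ev_l: "\<forall>\<^sub>F y in at_top. ln (1 / e0) / y + ln (1 / G y) / y < l0"
    using l0 by (intro order_tendstoD) auto
  have ev_y: "\<forall>\<^sub>F y in at_top. y > 0 \<and> ln (1 / e0) / y + ln (1 / G y) / y < l0 \<and>
    (\<forall>i\<in>{..<d}. \<forall>j\<in>{..<d}. ?b i j y / G y < e0 / d) \<and>
    (\<forall>i\<in>{..<d}. \<forall>j\<in>{..<d}. measure (interval_measure (H i j)) {x. y < \<bar>u i j x\<bar>} / G y < e0 / d)"
    using eventually_gt_at_top[of 0] ev_l ev_b ev_t by eventually_elim auto
  have "filterlim (\<lambda>x::real. \<eta> / 2 * x) at_top at_top"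
    using \<eta> by (intro filterlim_tendsto_pos_mult_at_top[OF tendsto_const]) (auto simp: filterlim_ident)
  from eventually_compose_filterlim[OF ev_y this] C(2) eventually_gt_at_top[of 0]
  show ?thesis
  proof eventually_elim
    case (elim x)
    define y where "y = \<eta> / 2 * x"
    have x: "0 < x" and GC: "G y \<le> C * G x" using elim by (auto simp: y_def)
    have y: "0 < y" and ly: "ln (1 / e0) / y + ln (1 / G y) / y < l0"
      and bb: "\<And>i j. i < d \<Longrightarrow> j < d \<Longrightarrow> ?b i j y / G y < e0 / d"
      and ty: "\<And>i j. i < d \<Longrightarrow> j < d \<Longrightarrow> measure (interval_measure (H i j)) {x. y < \<bar>u i j x\<bar>} / G y < e0 / d"
      using elim by (auto simp: y_def)
    have Gy: "0 < G y" using y by (rule G.G_pos)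
    have sum_b: "(\<Sum>j<d. ?b i j y) \<le> e0 * G y" if "i < d" for i
    proof -
      have "(\<Sum>j<d. ?b i j y) \<le> (\<Sum>j<d. e0 / d * G y)"
        using bb[OF that] by (intro sum_mono less_imp_le) (simp only: pos_divide_less_eq[OF Gy] lessThan_iff)
      then show ?thesis using d by simp
    qed
    have sum_t: "(\<Sum>j<d. measure (interval_measure (H i j)) {x. y < u i j x}) \<le> e0 * G y" if i: "i < d" for i
    proof -
      have "(\<Sum>j<d. measure (interval_measure (H i j)) {x. y < u i j x}) \<le> (\<Sum>j<d. e0 / d * G y)"
      proof (rule sum_mono)
        fix j assume j: "j \<in> {..<d}"
        interpret finite_measure "interval_measure (H i j)" using i j by (intro fin) auto
        have "measure (interval_measure (H i j)) {x. y < u i j x} \<le> measure (interval_measure (H i j)) {x. y < \<bar>u i j x\<bar>}"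
          by (intro finite_measure_mono) auto
        also have "\<dots> \<le> e0 / d * G y" using ty[of i j] i j by (intro less_imp_le) (simp only: pos_divide_less_eq[OF Gy] lessThan_iff)
        finally show "measure (interval_measure (H i j)) {x. y < u i j x} \<le> e0 / d * G y" .
      qed
      then show ?thesis using d by simp
    qed
    show ?case
    proof (intro allI impI)
      fix n :: nat assume n: "1 \<le> n \<and> real n \<le> x"
      define q where "q = real n * (e0 * G y)"
      have q: "0 < q" using n e0 Gy by (simp add: q_def)
      have "q \<le> x * (e0 * G y)" using n e0 Gy by (auto simp: q_def intro!: mult_right_mono)
      also have "\<dots> = (2 * e0 / \<eta>) * (y * G y)" using \<eta> by (simp add: y_def)
      also have "\<dots> \<le> (2 * e0 / \<eta>) * 1"
        using G.G_le[OF y] e0 \<eta> by (intro mult_left_mono) auto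
      also have "\<dots> \<le> 1 / 2" using e0 \<eta> by (simp add: field_simps)
      finally have q1: "q < 1" by simp
      define l where "l = ln (1 / q) / y"
      have l: "0 < l" using q q1 y by (simp add: l_def)
      have "e0 * G y \<le> q" using n e0 Gy by (simp add: q_def)
      then have "ln (1 / q) \<le> ln (1 / (e0 * G y))" using q e0 Gy by (simp add: frac_le)
      also have "\<dots> = ln (1 / e0) + ln (1 / G y)" using e0 Gy by (simp add: ln_div ln_mult)
      finally have "l \<le> ln (1 / e0) / y + ln (1 / G y) / y"
        using y by (simp add: l_def divide_right_mono flip: add_divide_distrib)
      with ly have ll0: "l < l0" by simp
      have ely: "exp (l * y) = 1 / q" using y q by (simp add: l_def)
      \<comment> \<open>The two additions are the expansion error and the truncated moment, the
        latter at most exp (l y) * e0 * G y = 1 / n.\<close>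
      define \<rho> where "\<rho> = 1 + \<eta> / 2 * l + 1 / n"
      have \<rho>: "1 \<le> \<rho>" using \<eta> l by (simp add: \<rho>_def)
      have "prob {\<omega>\<in>space M. \<exists>k\<le>n. \<eta> * x \<le> (\<Sum>l<k. incr u l \<omega>)} \<le>
        real n * (e0 * G y) + exp (- l * (\<eta> * x)) * \<rho> ^ n"
      proof (rule maximal_truncated_bound[where y = y])
        fix i assume i: "i < d"
        let ?a = "\<lambda>j. measure (interval_measure (H i j)) UNIV
          + l * (\<integral>x. u i j x \<partial>interval_measure (H i j)) + \<eta> / (2 * d) * l + exp (l * y) * ?b i j y"
        have "(\<Sum>j<d. \<integral>\<^sup>+x. ennreal (exp (l * min (u i j x) y)) \<partial>interval_measure (H i j)) \<le> (\<Sum>j<d. ennreal (?a j))"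
          using mgf[OF l ll0 i _ y] by (intro sum_mono) auto
        also have "\<dots> = ennreal (\<Sum>j<d. ?a j)"
        proof (rule sum_ennreal)
          fix j assume "j \<in> {..<d}"
          then have j: "j < d" by simp
          interpret finite_measure "interval_measure (H i j)" using i j by (rule fin)
          \<comment> \<open>\<open>ennreal\<close> reads a negative bound as 0. The exponential
            integral would then vanish, the kernel entry would be the null measure, and every term
            of \<open>?a j\<close> would be nonnegative after all.\<close>
          show "0 \<le> ?a j"
          proof (rule ccontr)
            assume "\<not> 0 \<le> ?a j"
            then have "(\<integral>\<^sup>+x. ennreal (exp (l * min (u i j x) y)) \<partial>interval_measure (H i j)) = 0"
              using mgf[OF l ll0 i j y] by (simp add: ennreal_neg)
            then have "AE x in interval_measure (H i j). ennreal (exp (l * min (u i j x) y)) = 0"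
              by (subst (asm) nn_integral_0_iff_AE) auto
            then have "AE x in interval_measure (H i j). False" by (simp add: ennreal_eq_0_iff)
            then have 0: "emeasure (interval_measure (H i j)) UNIV = 0"
              by (subst (asm) AE_False[symmetric]) (auto simp: AE_iff_measurable[OF _ refl])
            then have m0: "measure (interval_measure (H i j)) UNIV = 0" by (simp add: measure_def)
            have "AE x in interval_measure (H i j). u i j x = 0"
              using \<open>AE x in interval_measure (H i j). False\<close> by eventually_elim simp
            then have "(\<integral>x. u i j x \<partial>interval_measure (H i j)) = 0" by (rule integral_eq_zero_AE)
            moreover have "0 \<le> ?b i j y" using y by (intro integral_nonneg_AE AE_I2) auto
            ultimately have "0 \<le> ?a j" using m0 \<eta> l d by simp
            with \<open>\<not> 0 \<le> ?a j\<close> show False by simp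
          qed
        qed
        also have "(\<Sum>j<d. ?a j) = 1 + \<eta> / 2 * l + exp (l * y) * (\<Sum>j<d. ?b i j y)"
        proof -
          have "(\<Sum>j<d. ?a j) = (\<Sum>j<d. Hinf H i j) + l * (\<Sum>j<d. \<integral>x. u i j x \<partial>interval_measure (H i j))
            + real d * (\<eta> / (2 * d) * l) + exp (l * y) * (\<Sum>j<d. ?b i j y)"
            using Hinf_eq_measure[OF i] by (simp add: sum.distrib sum_distrib_left)
          then show ?thesis using row[OF i] drift_u[OF i] d by simp
        qed
        also have "ennreal \<dots> \<le> ennreal \<rho>"
        proof (rule ennreal_leI)
          have "exp (l * y) * (\<Sum>j<d. ?b i j y) \<le> 1 / q * (e0 * G y)"
            unfolding ely using sum_b[OF i] q by (intro mult_left_mono) auto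
          also have "\<dots> = 1 / n" using e0 Gy n by (simp add: q_def)
          finally show "1 + \<eta> / 2 * l + exp (l * y) * (\<Sum>j<d. ?b i j y) \<le> \<rho>" by (simp add: \<rho>_def)
        qed
        finally show "(\<Sum>j<d. \<integral>\<^sup>+x. ennreal (exp (l * min (u i j x) y)) \<partial>interval_measure (H i j)) \<le> ennreal \<rho>" .
      qed (use u l \<rho> e0 Gy sum_t in auto)
      also have "exp (- l * (\<eta> * x)) * \<rho> ^ n \<le> exp 1 * q"
      proof -
        have "\<rho> \<le> exp (\<eta> / 2 * l + 1 / n)" unfolding \<rho>_def
          using exp_ge_add_one_self[of "\<eta> / 2 * l + 1 / n"] by (simp only: add.assoc)
        then have "\<rho> ^ n \<le> exp (\<eta> / 2 * l + 1 / n) ^ n" using \<rho> by (intro power_mono) auto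
        also have "\<dots> = exp (real n * (\<eta> / 2 * l + 1 / n))" by (simp add: exp_of_nat_mult)
        also have "\<dots> \<le> exp (l * y + 1)"
        proof -
          \<comment> \<open>As y = \<eta> x / 2, the restriction n <= x bounds the accumulated
            expansion error by l y.\<close>
          have "real n * (\<eta> / 2 * l) \<le> x * (\<eta> / 2 * l)" using n \<eta> l by (intro mult_right_mono) auto
          then show ?thesis using n by (simp add: y_def ring_distribs mult_ac)
        qed
        finally have "exp (- l * (\<eta> * x)) * \<rho> ^ n \<le> exp (- l * (\<eta> * x)) * exp (l * y + 1)"
          by (intro mult_left_mono) auto
        also have "\<dots> = exp 1 * exp (- (l * y))"
          by (simp add: y_def flip: exp_add)
        also have "exp (- (l * y)) = q" using ely q by (simp add: exp_minus)
        finally show ?thesis .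
      qed
      finally have "prob {\<omega>\<in>space M. \<exists>k\<le>n. \<eta> * x \<le> (\<Sum>l<k. incr u l \<omega>)} \<le> (1 + exp 1) * (e0 * real n) * G y"
        by (simp add: q_def algebra_simps)
      also have "\<dots> \<le> (1 + exp 1) * (e0 * real n) * (C * G x)"
        using GC e0 by (intro mult_left_mono) (auto intro!: mult_nonneg_nonneg add_nonneg_nonneg)
      also have "\<dots> = (e0 * (C * (1 + exp 1))) * (real n * G x)" by (simp add: algebra_simps)
      also have "\<dots> \<le> \<epsilon> * (real n * G x)"
        using e0 G.G_pos[OF x] by (intro mult_right_mono) auto
      finally show "prob {\<omega>\<in>space M. \<exists>k\<le>n. \<eta> * x \<le> (\<Sum>l<k. incr (\<lambda>i j y. s * (y + (g j - g i - h))) l \<omega>)}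
      \<le> \<epsilon> * (real n * G x)" by (simp add: u_def[abs_def])
    qed
  qed
qed

end

section \<open>Hitting times\<close>

lemma mpow_Suc_left: "i < d \<Longrightarrow> k < d \<Longrightarrow> mpow d P (Suc n) i k = (\<Sum>j<d. P i j * mpow d P n j k)"
proof (induction n arbitrary: k)
  case 0
  have "mpow d P (Suc 0) i k = (\<Sum>l<d. if l = i then P l k else 0)"
    unfolding mpow.simps by (intro sum.cong) auto
  moreover have "(\<Sum>j<d. P i j * mpow d P 0 j k) = (\<Sum>j<d. if j = k then P i j else 0)"
    unfolding mpow.simps by (intro sum.cong) auto
  ultimately show ?case using 0 by simp
next
  case (Suc n)
  have "mpow d P (Suc (Suc n)) i k = (\<Sum>l<d. (\<Sum>j<d. P i j * mpow d P n j l) * P l k)"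
    using Suc by (subst mpow.simps(2)) (intro sum.cong, auto)
  also have "\<dots> = (\<Sum>j<d. P i j * (\<Sum>l<d. mpow d P n j l * P l k))"
    unfolding sum_distrib_left sum_distrib_right mult.assoc by (rule sum.swap)
  finally show ?case by simp
qed

text \<open>\<open>irreducible_matrix\<close> admits the power 0, which says nothing about returns
  to the same state; one step followed by a path from its end point has positive length.\<close>

lemma irreducible_return:
  assumes st: "stochastic_matrix d P" and irr: "irreducible_matrix d P" and i: "i < d" and k: "k < d"
  obtains n where "1 \<le> n" "mpow d P n i k > 0"
proof -
  have "(\<Sum>j<d. P i j) = 1" using st i by (simp add: stochastic_matrix_def)
  then obtain j where j: "j < d" "P i j \<noteq> 0"
    by (metis lessThan_iff sum.neutral zero_neq_one)
  then have Pij: "P i j > 0" using st i by (auto simp: stochastic_matrix_def less_le)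
  obtain n where n: "mpow d P n j k > 0" using irr j k by (auto simp: irreducible_matrix_def)
  have "0 < P i j * mpow d P n j k" using Pij n by simp
  also have "\<dots> \<le> (\<Sum>l<d. P i l * mpow d P n l k)"
  proof (rule member_le_sum)
    fix l assume "l \<in> {..<d} - {j}"
    then show "0 \<le> P i l * mpow d P n l k"
      using st i mpow_nonneg[OF st _ k] by (auto simp: stochastic_matrix_def)
  qed (use j in auto)
  also have "\<dots> = mpow d P (Suc n) i k" using mpow_Suc_left[OF i k] by simp
  finally show ?thesis using that[of "Suc n"] by simp
qed

text \<open>The induction varies the random set, since \<open>enumerate\<close> removes the least
  element before it counts on.\<close>

lemma measurable_enumerate:
  assumes "\<And>n. Measurable.pred M (\<lambda>\<omega>. n \<in> S \<omega>)"
  shows "(\<lambda>\<omega>. enumerate (S \<omega>) k) \<in> measurable M (count_space (UNIV :: nat set))"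
  using assms
proof (induction k arbitrary: S)
  case 0
  note [measurable] = 0
  show ?case unfolding enumerate_0 by measurable
next
  case (Suc k)
  note [measurable] = Suc.prems
  show ?case unfolding enumerate_Suc by (intro Suc.IH) measurable
qed

text \<open>Successive hits are at least one time unit apart, so the first k gaps sum to at least k.
  The same fact bounds the set behind \<open>GREATEST\<close>, which is therefore a genuine
  maximum.\<close>

lemma Ncount_le:
  assumes inf: "infinite {n. J n \<omega> = 0}" and t: "0 \<le> t"
  shows "real (Ncount J t \<omega>) \<le> t"
proof -
  have mono: "hit_time J k \<omega> \<ge> hit_time J 0 \<omega> + k" for k
  proof (induction k)
    case (Suc k)
    moreover have "hit_time J k \<omega> < hit_time J (Suc k) \<omega>"
      unfolding hit_time_def using inf by (intro enumerate_step)
    ultimately show ?case by simp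
  qed simp
  let ?P = "\<lambda>k. real (hit_time J k \<omega> - hit_time J 0 \<omega>) \<le> t"
  have le: "real k \<le> t" if "?P k" for k using mono[of k] that by linarith
  have "?P (Greatest ?P)"
  proof (rule GreatestI_nat)
    show "?P 0" using t by simp
    show "k \<le> nat \<lceil>t\<rceil>" if "?P k" for k using le[OF that] by linarith
  qed
  then show ?thesis unfolding Ncount_def by (rule le)
qed

locale irreducible_map_process = map_process +
  assumes irred: "irreducible_matrix d (Hinf H)"
begin

lemma measurable_hit_time [measurable]: "hit_time J k \<in> measurable M (count_space UNIV)"
  unfolding hit_time_def[abs_def] by (rule measurable_enumerate) measurable

lemma measurable_Ncount:
  assumes [measurable]: "T \<in> borel_measurable M"
  shows "(\<lambda>\<omega>. Ncount J (T \<omega>) \<omega>) \<in> measurable M (count_space UNIV)"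
  unfolding Ncount_def Greatest_def
  by (rule measurable_THE[where I = UNIV]) (auto intro: antisym)

section \<open>Recurrence of state 0\<close>

lemma transition:
  assumes A: "A \<in> sets (past n)" and j: "j < d" and i: "i < d"
  shows "prob (A \<inter> {\<omega>\<in>space M. J n \<omega> = i \<and> J (Suc n) \<omega> = j}) =
    Hinf H i j * prob (A \<inter> {\<omega>\<in>space M. J n \<omega> = i})"
proof -
  interpret N: finite_measure "interval_measure (H i j)" using i j by (rule H_interval_measure)
  have [measurable]: "A \<in> sets M" using A sets_past_le by auto
  have "emeasure M (A \<inter> {\<omega>\<in>space M. J n \<omega> = i \<and> J (Suc n) \<omega> = j}) =
      emeasure M (A \<inter> {\<omega>\<in>space M. J n \<omega> = i}) * emeasure (interval_measure (H i j)) UNIV"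
    using kernel_event[OF A i j, of "\<lambda>_. 1"] by simp
  also have "\<dots> = ennreal (Hinf H i j * prob (A \<inter> {\<omega>\<in>space M. J n \<omega> = i}))"
    unfolding emeasure_eq_measure N.emeasure_eq_measure
    using H_interval_measure(3)[OF i j] by (simp add: Hinf_def ennreal_mult'' mult.commute)
  finally show ?thesis
    using stoch i j by (simp add: emeasure_eq_measure stochastic_matrix_def)
qed

lemma split_state:
  assumes [measurable]: "A \<in> sets M"
  shows "prob A = (\<Sum>i<d. prob (A \<inter> {\<omega>\<in>space M. J n \<omega> = i}))"
proof -
  have "A = (\<Union>i\<in>{..<d}. A \<inter> {\<omega>\<in>space M. J n \<omega> = i})"
    using J_less sets.sets_into_space[OF assms] by auto
  also have "prob \<dots> = (\<Sum>i<d. prob (A \<inter> {\<omega>\<in>space M. J n \<omega> = i}))"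
    by (intro finite_measure_finite_Union) (auto simp: disjoint_family_on_def)
  finally show ?thesis .
qed

lemma J_event_past: "k \<le> n \<Longrightarrow> {\<omega>\<in>space M. Q (J k \<omega>)} \<in> sets (past n)"
proof -
  assume "k \<le> n"
  then have "J k -` {x. Q x} \<inter> space (past n) \<in> sets (past n)"
    by (intro measurable_sets[OF J_past]) auto
  also have "J k -` {x. Q x} \<inter> space (past n) = {\<omega>\<in>space M. Q (J k \<omega>)}" by auto
  finally show ?thesis .
qed

text \<open>Chapman-Kolmogorov relative to an arbitrary past event, the form needed to chain time
  windows.\<close>

lemma transition_mpow:
  assumes A: "A \<in> sets (past n)" and i: "i < d"
  shows "j < d \<Longrightarrow> prob (A \<inter> {\<omega>\<in>space M. J n \<omega> = i} \<inter> {\<omega>\<in>space M. J (n + k) \<omega> = j}) =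
    mpow d (Hinf H) k i j * prob (A \<inter> {\<omega>\<in>space M. J n \<omega> = i})"
proof (induction k arbitrary: j)
  case 0
  have "A \<inter> {\<omega>\<in>space M. J n \<omega> = i} \<inter> {\<omega>\<in>space M. J n \<omega> = j} = (if i = j then A \<inter> {\<omega>\<in>space M. J n \<omega> = i} else {})"
    by auto
  then show ?case by simp
next
  case (Suc k)
  let ?A = "A \<inter> {\<omega>\<in>space M. J n \<omega> = i}"
  have A': "?A \<in> sets (past (n + k))"
    using A sets_past_mono[of n "n + k"] J_event_past[of n "n + k" "\<lambda>x. x = i"] by auto
  have [measurable]: "A \<in> sets M" using A sets_past_le by auto
  have "prob (?A \<inter> {\<omega>\<in>space M. J (n + Suc k) \<omega> = j}) =
    (\<Sum>l<d. prob (?A \<inter> {\<omega>\<in>space M. J (n + k) \<omega> = l \<and> J (Suc (n + k)) \<omega> = j}))"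
    by (subst split_state[where n = "n + k"]) (auto intro!: sum.cong arg_cong[where f = prob])
  also have "\<dots> = (\<Sum>l<d. Hinf H l j * (mpow d (Hinf H) k i l * prob ?A))"
    using transition[OF A' \<open>j < d\<close>] Suc.IH by (intro sum.cong) auto
  also have "\<dots> = mpow d (Hinf H) (Suc k) i j * prob ?A"
    by (simp add: sum_distrib_left sum_distrib_right mult_ac)
  finally show ?case .
qed

text \<open>Finitely many states allow uniform constants: \<open>L\<close> is the longest of the
  chosen path lengths to 0, \<open>p\<close> the smallest of their probabilities. Positive lengths
  keep the window strictly after \<open>n\<close>.\<close>

lemma no_hit_bound:
  obtains p L where "0 < p" "p \<le> 1" "1 \<le> L"
    "\<And>n A. A \<in> sets (past n) \<Longrightarrow>
      prob (A \<inter> {\<omega>\<in>space M. \<forall>l\<in>{n<..n + L}. J l \<omega> \<noteq> 0}) \<le> (1 - p) * prob A"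
proof -
  have "\<exists>k. 1 \<le> k \<and> mpow d (Hinf H) k i 0 > 0" if "i < d" for i
    using irreducible_return[OF stoch irred that d_pos] by metis
  then obtain k where k: "\<And>i. i < d \<Longrightarrow> 1 \<le> k i \<and> mpow d (Hinf H) (k i) i 0 > 0" by metis
  define L where "L = Max (k ` {..<d})"
  define p where "p = Min ((\<lambda>i. mpow d (Hinf H) (k i) i 0) ` {..<d})"
  have ne: "{..<d} \<noteq> {}" using d_pos by auto
  have L: "k i \<le> L" if "i < d" for i unfolding L_def using that by (intro Max_ge) auto
  have p: "p \<le> mpow d (Hinf H) (k i) i 0" if "i < d" for i unfolding p_def using that by (intro Min_le) auto
  have p0: "0 < p" unfolding p_def using k ne by (subst Min_gr_iff) auto
  have L1: "1 \<le> L" using L[OF d_pos] k[OF d_pos] by simp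
  have bound: "prob (A \<inter> {\<omega>\<in>space M. \<forall>l\<in>{n<..n + L}. J l \<omega> \<noteq> 0}) \<le> (1 - p) * prob A"
    if A: "A \<in> sets (past n)" for A n
  proof -
    have [measurable]: "A \<in> sets M" using A sets_past_le by auto
    let ?N = "{\<omega>\<in>space M. \<forall>l\<in>{n<..n + L}. J l \<omega> \<noteq> 0}"
    have N [measurable]: "?N \<in> sets M" by measurable
    have "prob (A \<inter> ?N) = (\<Sum>i<d. prob (A \<inter> ?N \<inter> {\<omega>\<in>space M. J n \<omega> = i}))"
      by (intro split_state) measurable
    also have "\<dots> \<le> (\<Sum>i<d. (1 - p) * prob (A \<inter> {\<omega>\<in>space M. J n \<omega> = i}))"
    proof (rule sum_mono)
      fix i assume "i \<in> {..<d}"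
      then have i: "i < d" by simp
      let ?A = "A \<inter> {\<omega>\<in>space M. J n \<omega> = i}"
      let ?Z = "{\<omega>\<in>space M. J (n + k i) \<omega> = 0}"
      have "n + k i \<in> {n<..n + L}" using k[OF i] L[OF i] by auto
      then have "prob (A \<inter> ?N \<inter> {\<omega>\<in>space M. J n \<omega> = i}) \<le> prob (?A - ?A \<inter> ?Z)"
        by (intro finite_measure_mono subsetI) (blast, measurable)
      also have "\<dots> = prob ?A - prob (?A \<inter> ?Z)" by (intro finite_measure_Diff) auto
      also have "prob (?A \<inter> ?Z) = mpow d (Hinf H) (k i) i 0 * prob ?A"
        by (rule transition_mpow[OF A i d_pos])
      also have "prob ?A - \<dots> \<le> (1 - p) * prob ?A"
        using mult_right_mono[OF p[OF i], of "prob ?A"] by (simp add: algebra_simps)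
      finally show "prob (A \<inter> ?N \<inter> {\<omega>\<in>space M. J n \<omega> = i}) \<le> (1 - p) * prob ?A" .
    qed
    also have "\<dots> = (1 - p) * prob A"
      by (subst split_state[of A n]) (simp_all add: sum_distrib_left)
    finally show ?thesis .
  qed
  \<comment> \<open>Applied to the whole space, the bound has a probability on its left, which
    forces p <= 1.\<close>
  have "0 \<le> (1 - p) * prob (space M)"
    by (rule order_trans[OF measure_nonneg bound[of _ 0]]) (use sets.top[of "past 0"] in simp)
  then have "p \<le> 1" by (simp add: prob_space)
  then show ?thesis by (rule that[OF p0 _ L1 bound])
qed

text \<open>Consecutive windows of length \<open>L\<close> are chained: having missed 0 so far is an
  event of the past.\<close>

lemma no_hit_geometric:
  obtains p L where "0 < p" "p \<le> 1" "1 \<le> L"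
    "\<And>n k. prob {\<omega>\<in>space M. \<forall>l\<in>{n<..n + k * L}. J l \<omega> \<noteq> 0} \<le> (1 - p) ^ k"
proof -
  obtain p L where pL: "0 < p" "p \<le> 1" "1 \<le> L"
    and bound: "\<And>n A. A \<in> sets (past n) \<Longrightarrow>
      prob (A \<inter> {\<omega>\<in>space M. \<forall>l\<in>{n<..n + L}. J l \<omega> \<noteq> 0}) \<le> (1 - p) * prob A"
    using no_hit_bound by blast
  have nn: "0 \<le> 1 - p" using pL by simp
  have "prob {\<omega>\<in>space M. \<forall>l\<in>{n<..n + k * L}. J l \<omega> \<noteq> 0} \<le> (1 - p) ^ k" for n k
  proof (induction k)
    case 0
    show ?case unfolding power_0 by (rule prob_le_1)
  next
    case (Suc k)
    let ?Z = "{\<omega>\<in>space M. \<forall>l\<in>{n<..n + k * L}. J l \<omega> \<noteq> 0}"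
    have "?Z = space (past (n + k * L)) - (\<Union>l\<in>{n<..n + k * L}. {\<omega>\<in>space M. J l \<omega> = 0})" by auto
    also have "\<dots> \<in> sets (past (n + k * L))"
      by (intro sets.compl_sets sets.finite_UN J_event_past[of _ _ "\<lambda>x. x = 0"]) auto
    finally have Z: "?Z \<in> sets (past (n + k * L))" .
    have "{n<..n + Suc k * L} = {n<..n + k * L} \<union> {n + k * L<..n + k * L + L}" by auto
    then have split: "{\<omega>\<in>space M. \<forall>l\<in>{n<..n + Suc k * L}. J l \<omega> \<noteq> 0} =
       ?Z \<inter> {\<omega>\<in>space M. \<forall>l\<in>{n + k * L<..n + k * L + L}. J l \<omega> \<noteq> 0}" by auto
    have "prob {\<omega>\<in>space M. \<forall>l\<in>{n<..n + Suc k * L}. J l \<omega> \<noteq> 0} \<le> (1 - p) * prob ?Z"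
      unfolding split by (rule bound[OF Z])
    also have "\<dots> \<le> (1 - p) * (1 - p) ^ k" by (rule mult_left_mono[OF Suc.IH nn])
    finally show ?case unfolding power_Suc .
  qed
  then show ?thesis by (rule that[OF pL])
qed

text \<open>Gives \<open>hit_time\<close> and \<open>Ncount\<close> their intended meaning almost
  surely, since \<open>enumerate\<close> lists a strictly increasing sequence only for an infinite
  set.\<close>

lemma AE_infinitely_many_hits: "AE \<omega> in M. infinite {n. J n \<omega> = 0}"
proof -
  obtain p L where pL: "0 < p" "p \<le> 1" "1 \<le> L"
    and geo: "\<And>n k. prob {\<omega>\<in>space M. \<forall>l\<in>{n<..n + k * L}. J l \<omega> \<noteq> 0} \<le> (1 - p) ^ k"
    using no_hit_geometric by blast
  have "AE \<omega> in M. \<exists>l>n. J l \<omega> = 0" for n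
  proof -
    let ?E = "{\<omega>\<in>space M. \<forall>l>n. J l \<omega> \<noteq> 0}"
    have "prob ?E \<le> (1 - p) ^ k" for k
      by (rule order_trans[OF finite_measure_mono geo[of n k]]) auto
    moreover have "(\<lambda>k. (1 - p) ^ k) \<longlonglongrightarrow> 0" using pL by (intro LIMSEQ_power_zero) auto
    ultimately have "prob ?E \<le> 0" by (intro LIMSEQ_le_const) auto
    then have "prob ?E = 0" using measure_nonneg[of M ?E] by linarith
    then have "emeasure M ?E = 0" by (simp only: emeasure_eq_measure ennreal_0)
    then show ?thesis by (subst AE_iff_measurable[where N = ?E]) auto
  qed
  then have "AE \<omega> in M. \<forall>n. \<exists>l>n. J l \<omega> = 0" by (simp add: AE_all_countable)
  then show ?thesis by eventually_elim (auto simp: infinite_nat_iff_unbounded)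
qed

lemma hit_time_1_le:
  assumes "J a \<omega> = 0" "J b \<omega> = 0" "a < b"
  shows "hit_time J 1 \<omega> \<le> b"
proof -
  have "(LEAST n. J n \<omega> = 0) \<le> a" using assms by (intro Least_le)
  then show ?thesis using assms
    by (auto simp: hit_time_def enumerate_Suc enumerate_0 intro!: Least_le)
qed

text \<open>A nonintegrable function has Bochner integral 0, so the mean gap can be bounded below
  only after this. A hit in each of two adjacent windows of length k L puts the second hit at time 2
  k L or earlier, which makes the tail geometric.\<close>

lemma integrable_hit_time: "integrable M (\<lambda>\<omega>. real (hit_time J 1 \<omega> - hit_time J 0 \<omega>))"
proof -
  obtain p L where pL: "0 < p" "p \<le> 1" "1 \<le> L"
    and geo: "\<And>n k. prob {\<omega>\<in>space M. \<forall>l\<in>{n<..n + k * L}. J l \<omega> \<noteq> 0} \<le> (1 - p) ^ k"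
    using no_hit_geometric by blast
  let ?\<tau> = "hit_time J 1"
  have tl: "prob {\<omega>\<in>space M. 2 * k * L < ?\<tau> \<omega>} \<le> 2 * (1 - p) ^ k" for k
  proof -
    let ?Z = "\<lambda>n. {\<omega>\<in>space M. \<forall>l\<in>{n<..n + k * L}. J l \<omega> \<noteq> 0}"
    have "prob {\<omega>\<in>space M. 2 * k * L < ?\<tau> \<omega>} \<le> prob (?Z 0 \<union> ?Z (k * L))"
    proof (rule finite_measure_mono)
      show "{\<omega>\<in>space M. 2 * k * L < ?\<tau> \<omega>} \<subseteq> ?Z 0 \<union> ?Z (k * L)"
      proof (rule subsetI, rule ccontr)
        fix \<omega> assume \<omega>: "\<omega> \<in> {\<omega>\<in>space M. 2 * k * L < ?\<tau> \<omega>}" "\<omega> \<notin> ?Z 0 \<union> ?Z (k * L)"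
        then obtain a b where ab: "J a \<omega> = 0" "a \<le> k * L" "J b \<omega> = 0" "k * L < b" "b \<le> k * L + k * L" by auto
        then have "?\<tau> \<omega> \<le> b" by (intro hit_time_1_le[of a]) auto
        then show False using \<omega> ab by (auto simp: mult_2 distrib_right)
      qed
    qed measurable
    also have "\<dots> \<le> prob (?Z 0) + prob (?Z (k * L))" by (intro measure_Un_le) measurable
    also have "\<dots> \<le> 2 * (1 - p) ^ k" using geo[of 0 k] geo[of "k * L" k] by simp
    finally show ?thesis .
  qed
  have "(\<integral>\<^sup>+\<omega>. ennreal (real (?\<tau> \<omega>)) \<partial>M) \<le>
    (\<integral>\<^sup>+\<omega>. (\<Sum>k. ennreal (2 * L) * indicator {\<omega>\<in>space M. 2 * k * L < ?\<tau> \<omega>} \<omega>) \<partial>M)"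
  proof (rule nn_integral_mono)
    fix \<omega> assume \<omega>: "\<omega> \<in> space M"
    define t where "t = ?\<tau> \<omega>"
    \<comment> \<open>\<open>K\<close> is t / (2 L) rounded up: every index k < K satisfies 2 k L <
      t, and the \<open>K\<close> blocks of length 2 L cover t.\<close>
    define K where "K = (if t = 0 then 0 else (t - 1) div (2 * L) + 1)"
    have lt: "2 * k * L < t" if "k < K" for k
    proof -
      from that have "t \<noteq> 0" "k \<le> (t - 1) div (2 * L)" by (auto simp: K_def split: if_splits)
      then have "k * (2 * L) \<le> (t - 1) div (2 * L) * (2 * L)" by (intro mult_right_mono) auto
      also have "\<dots> \<le> t - 1" by simp
      finally show ?thesis using \<open>t \<noteq> 0\<close> by simp
    qed
    have "t \<le> K * (2 * L)"
    proof (cases "t = 0")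
      case False
      have "t - 1 < ((t - 1) div (2 * L) + 1) * (2 * L)"
        using pL dividend_less_div_times[of "2 * L" "t - 1"] by simp
      then show ?thesis using False by (simp add: K_def)
    qed simp
    then have "ennreal (real t) \<le> ennreal (real (K * (2 * L)))" by (intro ennreal_leI) (simp only: of_nat_le_iff)
    also have "\<dots> = (\<Sum>k<K. ennreal (2 * L) * indicator {\<omega>\<in>space M. 2 * k * L < ?\<tau> \<omega>} \<omega>)"
    proof -
      have "(\<Sum>k<K. ennreal (2 * L) * indicator {\<omega>\<in>space M. 2 * k * L < ?\<tau> \<omega>} \<omega>) = (\<Sum>k<K. ennreal (2 * L))"
        using lt \<omega> by (intro sum.cong) (auto simp: t_def)
      then show ?thesis by (simp add: ennreal_mult ennreal_of_nat_eq_real_of_nat)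
    qed
    also have "\<dots> \<le> (\<Sum>k. ennreal (2 * L) * indicator {\<omega>\<in>space M. 2 * k * L < ?\<tau> \<omega>} \<omega>)"
      by (intro sum_le_suminf) auto
    finally show "ennreal (real (?\<tau> \<omega>)) \<le> (\<Sum>k. ennreal (2 * L) * indicator {\<omega>\<in>space M. 2 * k * L < ?\<tau> \<omega>} \<omega>)"
      by (simp add: t_def)
  qed
  also have "\<dots> = (\<Sum>k. ennreal (2 * L) * emeasure M {\<omega>\<in>space M. 2 * k * L < ?\<tau> \<omega>})"
    by (subst nn_integral_suminf) (auto simp: nn_integral_cmult_indicator)
  also have "\<dots> \<le> (\<Sum>k. ennreal (2 * L * (2 * (1 - p) ^ k)))"
  proof (intro suminf_le)
    fix k
    show "ennreal (2 * L) * emeasure M {\<omega>\<in>space M. 2 * k * L < ?\<tau> \<omega>} \<le> ennreal (2 * L * (2 * (1 - p) ^ k))"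
      unfolding emeasure_eq_measure using tl[of k] pL
      by (subst ennreal_mult'[symmetric]) (auto intro!: ennreal_leI mult_left_mono)
  qed auto
  also have "\<dots> < \<infinity>"
  proof -
    have "summable (\<lambda>k. 2 * L * (2 * (1 - p) ^ k))"
      using pL by (intro summable_mult summable_geometric) auto
    then show ?thesis using pL by (subst suminf_ennreal2) (auto simp: less_top)
  qed
  finally have "integrable M (\<lambda>\<omega>. real (?\<tau> \<omega>))" by (intro integrableI_nonneg) auto
  then show ?thesis by (rule Bochner_Integration.integrable_bound) auto
qed

text \<open>A mean gap of at least 1 makes x / E(\<Delta>\<tau>) at most x, so that T <= x /
  E(\<Delta>\<tau>) implies both conditions in the limit hypothesis.\<close>

lemma expectation_hit_time: "1 \<le> expectation (\<lambda>\<omega>. real (hit_time J 1 \<omega> - hit_time J 0 \<omega>))"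
proof -
  have "AE \<omega> in M. 1 \<le> real (hit_time J 1 \<omega> - hit_time J 0 \<omega>)"
    using AE_infinitely_many_hits
  proof eventually_elim
    case (elim \<omega>)
    then have "hit_time J 0 \<omega> < hit_time J (Suc 0) \<omega>"
      unfolding hit_time_def by (intro enumerate_step)
    then show ?case by simp
  qed
  then have "(\<integral>\<omega>. 1 \<partial>M) \<le> expectation (\<lambda>\<omega>. real (hit_time J 1 \<omega> - hit_time J 0 \<omega>))"
    using integrable_hit_time by (intro integral_mono_AE) auto
  then show ?thesis by (simp add: prob_space)
qed

end

section \<open>Sampling at the heavy-tailed time\<close>

text \<open>The limit over \<open>v\<close> yields one \<open>v\<close> > 1 whose lower ratio limit
  exceeds 1 - e. With e = 1 / 2 this gives dominated variation, with small e the insensitivity of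
  the tail to a slight rescaling.\<close>

lemma class_C_scaling:
  assumes C: "class_C \<mu>" and e: "0 < e"
  obtains v where "1 < v" "\<forall>\<^sub>F x in at_top. (1 - e) * tail \<mu> x \<le> tail \<mu> (v * x)"
proof -
  let ?L = "\<lambda>v. Liminf at_top (\<lambda>x. ereal (tail \<mu> (v * x) / tail \<mu> x))"
  have pos: "0 < tail \<mu> x" for x using C by (simp add: class_C_def)
  have "(?L \<longlongrightarrow> 1) (at_right 1)" using C by (simp add: class_C_def)
  moreover have "ereal (1 - e) < 1" using e by simp
  ultimately have "\<forall>\<^sub>F v in at_right 1. ereal (1 - e) < ?L v" by (rule order_tendstoD)
  moreover have "\<forall>\<^sub>F v in at_right (1::real). 1 < v" by (rule eventually_at_right_less)
  ultimately have "\<forall>\<^sub>F v in at_right (1::real). 1 < v \<and> ereal (1 - e) < ?L v" by eventually_elim simp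
  then obtain v :: real where v: "1 < v" "ereal (1 - e) < ?L v"
    using eventually_happens'[OF trivial_limit_at_right_real] by blast
  have "\<forall>\<^sub>F x in at_top. ereal (1 - e) < ereal (tail \<mu> (v * x) / tail \<mu> x)"
    using less_LiminfD[OF v(2)] .
  then have "\<forall>\<^sub>F x in at_top. (1 - e) * tail \<mu> x \<le> tail \<mu> (v * x)"
    by eventually_elim (simp add: pos_less_divide_eq[OF pos] less_imp_le)
  with v(1) show ?thesis by (rule that)
qed

text \<open>The product is at most the integral of |x| over |x| > t, which vanishes by dominated
  convergence.\<close>

lemma integrable_imp_tail_small:
  fixes N :: "real measure"
  assumes N: "finite_measure N" "sets N = sets borel" and int: "integrable N (\<lambda>x. x)"
  shows "((\<lambda>t. t * measure N {x. t < \<bar>x\<bar>}) \<longlongrightarrow> 0) at_top"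
proof -
  interpret finite_measure N by fact
  have space: "space N = UNIV" using sets_eq_imp_space_eq[OF N(2)] by simp
  define f where "f t x = \<bar>x\<bar> * indicator {x. t < \<bar>x\<bar>} x" for t x :: real
  have int_f: "integrable N (f t)" for t
  proof (rule Bochner_Integration.integrable_bound[OF integrable_abs[OF int]])
    have "{x. t < \<bar>x\<bar>} \<in> sets N" unfolding N(2) by measurable
    then show "f t \<in> borel_measurable N" unfolding f_def[abs_def]
      by (intro borel_measurable_times borel_measurable_abs borel_measurable_integrable[OF int] borel_measurable_indicator)
    show "AE x in N. norm (f t x) \<le> norm \<bar>x\<bar>" by (intro AE_I2) (simp add: f_def indicator_def)
  qed
  have "((\<lambda>t. integral\<^sup>L N (f t)) \<longlongrightarrow> integral\<^sup>L N (\<lambda>x. 0)) at_top"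
  proof (rule integral_dominated_convergence_at_top)
    show "f t \<in> borel_measurable N" for t by (rule borel_measurable_integrable[OF int_f])
    show "integrable N (\<lambda>x. \<bar>x\<bar>)" using int by (rule integrable_abs)
    show "AE x in N. ((\<lambda>t. f t x) \<longlongrightarrow> 0) at_top"
    proof (intro AE_I2 tendsto_eventually)
      fix x
      show "\<forall>\<^sub>F t in at_top. f t x = 0" using eventually_ge_at_top[of "\<bar>x\<bar>"]
        by eventually_elim (simp add: f_def)
    qed
    show "\<forall>\<^sub>F t in at_top. AE x in N. norm (f t x) \<le> \<bar>x\<bar>"
      by (intro always_eventually allI AE_I2) (simp add: f_def indicator_def)
  qed simp
  then have lim: "((\<lambda>t. integral\<^sup>L N (f t)) \<longlongrightarrow> 0) at_top" by simp
  show ?thesis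
  proof (rule tendsto_sandwich[OF _ _ tendsto_const lim])
    show "\<forall>\<^sub>F t in at_top. 0 \<le> t * measure N {x. t < \<bar>x\<bar>}"
      using eventually_ge_at_top[of 0] by eventually_elim simp
    show "\<forall>\<^sub>F t in at_top. t * measure N {x. t < \<bar>x\<bar>} \<le> integral\<^sup>L N (f t)"
      using eventually_ge_at_top[of 0]
    proof eventually_elim
      case (elim t)
      have "t * measure N {x. t < \<bar>x\<bar>} = (\<integral>x. t * indicator {x. t < \<bar>x\<bar>} x \<partial>N)" using space by simp
      also have "\<dots> \<le> integral\<^sup>L N (f t)"
      proof (rule integral_mono)
        have "{x. t < \<bar>x\<bar>} \<in> sets N" unfolding N(2) by measurable
        then show "integrable N (\<lambda>x. t * indicator {x. t < \<bar>x\<bar>} x)"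
          by (intro integrable_mult_right integrable_real_indicator) (auto simp: less_top[symmetric])
        show "t * indicator {x. t < \<bar>x\<bar>} x \<le> f t x" for x by (simp add: f_def indicator_def)
      qed (rule int_f)
      finally show ?case .
    qed
  qed
qed

locale sampled_map = irreducible_map_process +
  fixes \<pi> :: "nat \<Rightarrow> real" and T :: "'a \<Rightarrow> real" and \<mu> :: "real measure"
  assumes stat: "stationary_vector d (Hinf H) \<pi>"
    and mean_int: "i < d \<Longrightarrow> j < d \<Longrightarrow> integrable (interval_measure (H i j)) (\<lambda>y. y)"
    and h_pos: "drift d H \<pi> > 0"
    and T_meas [measurable]: "T \<in> borel_measurable M"
    and T_indep: "indep_set (rv_events M T) (process_events M X J)"
    and T_C: "class_C (distr M borel T)"
    and \<beta>_tail: "i < d \<Longrightarrow> (\<lambda>x. measure (interval_measure (\<beta> i)) {y. \<bar>y\<bar> > x}) \<in> O(tail \<mu>)"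
    and H_tail: "i < d \<Longrightarrow> j < d \<Longrightarrow> (\<lambda>x. measure (interval_measure (H i j)) {y. \<bar>y\<bar> > x}) \<in> O(tail \<mu>)"
    and truncated_mean: "((\<lambda>x. expectation (\<lambda>\<omega>. T \<omega> * indicator
              {\<omega>. T \<omega> \<le> x \<and> real (Ncount J (T \<omega>) \<omega>) \<le>
                   x / expectation (\<lambda>\<omega>. real (hit_time J 1 \<omega> - hit_time J 0 \<omega>))} \<omega>)
            * tail \<mu> x / tail (distr M borel T) x) \<longlongrightarrow> 0) at_top"
begin

section \<open>The tail of T and the comparison function\<close>

definition F :: "real \<Rightarrow> real" where "F x = prob {\<omega>\<in>space M. x < T \<omega>}"

text \<open>Truncating as min(T, x), rather than restricting to T <= x, gives both x F(x) <= mT(x)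
  and mT(2 x) <= 2 mT(x), from which \<open>G\<close> inherits its bound and its dominated
  variation.\<close>

definition mT :: "real \<Rightarrow> real" where "mT x = expectation (\<lambda>\<omega>. min (T \<omega>) x)"

definition G :: "real \<Rightarrow> real" where "G x = F x / mT x"

lemma tail_T: "tail (distr M borel T) x = F x"
proof -
  have "T -` {x<..} \<inter> space M = {\<omega>\<in>space M. x < T \<omega>}" by auto
  then show ?thesis by (simp add: tail_def F_def measure_distr)
qed

lemma F_pos: "0 < F x"
  using T_C by (simp add: class_C_def flip: tail_T)

lemma F_antimono: "x \<le> y \<Longrightarrow> F y \<le> F x"
  unfolding F_def by (intro finite_measure_mono) auto

lemma AE_T_nonneg: "AE \<omega> in M. 0 \<le> T \<omega>"
proof -
  have "prob {\<omega>\<in>space M. T \<omega> < 0} = measure (distr M borel T) {..<0}"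
    by (subst measure_distr) (auto intro!: arg_cong[where f = prob])
  also have "\<dots> = 0" using T_C by (simp add: class_C_def)
  finally have "emeasure M {\<omega>\<in>space M. T \<omega> < 0} = 0" by (simp add: emeasure_eq_measure)
  then show ?thesis by (subst AE_iff_measurable[where N = "{\<omega>\<in>space M. T \<omega> < 0}"]) (auto simp: not_le)
qed

lemma F_scaling:
  assumes "0 < e"
  obtains v where "1 < v" "\<forall>\<^sub>F x in at_top. (1 - e) * F x \<le> F (v * x)"
  using class_C_scaling[OF T_C assms] unfolding tail_T by blast

lemma F_dominated:
  assumes "0 < a"
  obtains C where "C > 0" "\<forall>\<^sub>F x in at_top. F (a * x) \<le> C * F x"
proof -
  obtain v where v: "1 < v" "\<forall>\<^sub>F x in at_top. (1 - 1 / 2) * F x \<le> F (v * x)"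
    by (rule F_scaling[of "1 / 2"]) auto
  show ?thesis
    by (rule doubling_imp_scaling[of F "1 - 1 / 2" v a]) (use F_antimono v assms that in auto)
qed

lemma integrable_min_T: "0 \<le> x \<Longrightarrow> integrable M (\<lambda>\<omega>. min (T \<omega>) x)"
  using AE_T_nonneg by (intro integrable_const_bound[of _ x]) auto

lemma mT_ge: "0 \<le> x \<Longrightarrow> x * F x \<le> mT x"
proof -
  assume x: "0 \<le> x"
  have "x * F x = (\<integral>\<omega>. x * indicator {\<omega>\<in>space M. x < T \<omega>} \<omega> \<partial>M)" by (simp add: F_def)
  also have "\<dots> \<le> mT x" unfolding mT_def
  proof (rule integral_mono_AE)
    show "AE \<omega> in M. x * indicator {\<omega>\<in>space M. x < T \<omega>} \<omega> \<le> min (T \<omega>) x"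
      using AE_T_nonneg by eventually_elim (use x in \<open>auto simp: indicator_def\<close>)
  qed (use x integrable_min_T in \<open>auto simp: less_top[symmetric]\<close>)
  finally show ?thesis .
qed

lemma mT_pos: "0 < x \<Longrightarrow> 0 < mT x"
  using mT_ge[of x] F_pos[of x] by (smt (verit) mult_pos_pos)

lemma mT_mono: "0 \<le> x \<Longrightarrow> x \<le> y \<Longrightarrow> mT x \<le> mT y"
  unfolding mT_def by (intro integral_mono integrable_min_T) auto

lemma mT_double: "0 \<le> x \<Longrightarrow> mT (2 * x) \<le> 2 * mT x"
proof -
  assume x: "0 \<le> x"
  have "mT (2 * x) \<le> (\<integral>\<omega>. 2 * min (T \<omega>) x \<partial>M)" unfolding mT_def
  proof (rule integral_mono_AE)
    show "AE \<omega> in M. min (T \<omega>) (2 * x) \<le> 2 * min (T \<omega>) x"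
      using AE_T_nonneg by eventually_elim (use x in \<open>auto simp: min_def\<close>)
  qed (use x integrable_min_T in auto)
  then show ?thesis by (simp add: mT_def)
qed

text \<open>Under doubling the tail of \<open>T\<close> drops by at most a factor \<open>C\<close>
  and the truncated mean grows by at most a factor 2, hence the constant 1 / (2 C).\<close>

lemma dominated_fun_G: "\<exists>c. dominated_fun G c"
proof -
  obtain C where C: "C > 0" "\<forall>\<^sub>F x in at_top. F (1 / 2 * x) \<le> C * F x"
    by (rule F_dominated[of "1 / 2"]) auto
  have "filterlim (\<lambda>x::real. 2 * x) at_top at_top"
    by (intro filterlim_tendsto_pos_mult_at_top[OF tendsto_const]) (auto simp: filterlim_ident)
  from eventually_compose_filterlim[OF C(2) this]
  have CF: "\<forall>\<^sub>F x in at_top. F x \<le> C * F (2 * x)" by simp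
  have "dominated_fun G (1 / (2 * C))"
  proof
    show "0 < G t" if "0 < t" for t using that F_pos mT_pos by (simp add: G_def)
    show "G t \<le> G s" if "0 < s" "s \<le> t" for s t
      unfolding G_def using that F_antimono mT_mono[of s t] mT_pos F_pos by (intro frac_le) (auto simp: less_imp_le)
    show "t * G t \<le> 1" if "0 < t" for t using mT_ge[of t] mT_pos[OF that] that by (simp add: G_def)
    show "0 < 1 / (2 * C)" using C by simp
    show "\<forall>\<^sub>F t in at_top. 1 / (2 * C) * G t \<le> G (2 * t)"
      using CF eventually_gt_at_top[of 0]
    proof eventually_elim
      case (elim t)
      have "1 / (2 * C) * G t = (F t / C) / (2 * mT t)" by (simp add: G_def)
      also have "\<dots> \<le> F (2 * t) / mT (2 * t)"
        using elim C mT_double[of t] mT_pos[of "2 * t"] F_pos[of "2 * t"]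
        by (intro frac_le) (auto simp: pos_divide_le_eq mult.commute)
      finally show ?case by (simp add: G_def)
    qed
  qed
  then show ?thesis by blast
qed

section \<open>Tails of the increments and of the initial value against T\<close>

lemma bigo_tail_imp:
  assumes "Q \<in> O(tail \<mu>)"
  obtains K where "K > 0" "\<forall>\<^sub>F x in at_top. Q x \<le> K * tail \<mu> x"
proof -
  obtain K where K: "K > 0" "\<forall>\<^sub>F x in at_top. norm (Q x) \<le> K * norm (tail \<mu> x)"
    using assms by (rule landau_o.bigE)
  have "\<forall>\<^sub>F x in at_top. Q x \<le> K * tail \<mu> x"
    using K(2) by eventually_elim (simp add: tail_def)
  with K(1) show ?thesis by (rule that)
qed

text \<open>The form in which the limit hypothesis is used: E(T; T <= x), free of the counting
  process.\<close>

definition lT :: "real \<Rightarrow> real" where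
  "lT x = expectation (\<lambda>\<omega>. T \<omega> * indicator {\<omega>\<in>space M. T \<omega> \<le> x} \<omega>)"

lemma integrable_lT: "integrable M (\<lambda>\<omega>. T \<omega> * indicator {\<omega>\<in>space M. T \<omega> \<le> x} \<omega>)"
  using AE_T_nonneg by (intro integrable_const_bound[of _ "\<bar>x\<bar>"]) (auto simp: indicator_def elim: eventually_mono)

text \<open>Since \<open>N(T) \<le> T\<close>, the truncation in the hypothesis is void on \<open>T \<le> x / E(\<Delta>\<tau>)\<close>.\<close>

lemma truncated_mean_tail:
  obtains a where "0 < a" "((\<lambda>x. lT (a * x) * tail \<mu> x / F x) \<longlongrightarrow> 0) at_top"
proof -
  define m where "m = expectation (\<lambda>\<omega>. real (hit_time J 1 \<omega> - hit_time J 0 \<omega>))"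
  have m: "1 \<le> m" unfolding m_def by (rule expectation_hit_time)
  define U where "U x = expectation (\<lambda>\<omega>. T \<omega> * indicator {\<omega>. T \<omega> \<le> x \<and> real (Ncount J (T \<omega>) \<omega>) \<le> x / m} \<omega>)" for x
  have U: "((\<lambda>x. U x * tail \<mu> x / F x) \<longlongrightarrow> 0) at_top"
    using truncated_mean unfolding U_def m_def tail_T .
  have [measurable]: "(\<lambda>\<omega>. Ncount J (T \<omega>) \<omega>) \<in> measurable M (count_space UNIV)"
    by (rule measurable_Ncount) measurable
  have le: "lT (1 / m * x) \<le> U x" if x: "0 < x" for x
    unfolding lT_def U_def
  proof (rule integral_mono_AE)
    have "integrable M (\<lambda>\<omega>. T \<omega> * indicator {\<omega>\<in>space M. T \<omega> \<le> x \<and> real (Ncount J (T \<omega>) \<omega>) \<le> x / m} \<omega>)"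
      using AE_T_nonneg
      by (intro integrable_const_bound[of _ "\<bar>x\<bar>"]) (auto simp: indicator_def elim: eventually_mono)
    then show "integrable M (\<lambda>\<omega>. T \<omega> * indicator {\<omega>. T \<omega> \<le> x \<and> real (Ncount J (T \<omega>) \<omega>) \<le> x / m} \<omega>)"
      by (rule Bochner_Integration.integrable_cong[THEN iffD1, rotated 2]) (auto simp: indicator_def)
    show "AE \<omega> in M. T \<omega> * indicator {\<omega>\<in>space M. T \<omega> \<le> 1 / m * x} \<omega> \<le>
       T \<omega> * indicator {\<omega>. T \<omega> \<le> x \<and> real (Ncount J (T \<omega>) \<omega>) \<le> x / m} \<omega>"
      using AE_T_nonneg AE_infinitely_many_hits
    proof eventually_elim
      case (elim \<omega>)
      have "T \<omega> \<le> x \<and> real (Ncount J (T \<omega>) \<omega>) \<le> x / m" if "T \<omega> \<le> 1 / m * x"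
      proof -
        have "1 / m * x \<le> 1 * x" using m x by (intro mult_right_mono) auto
        then show ?thesis using that Ncount_le[of J \<omega> "T \<omega>"] elim by simp
      qed
      then show ?case using elim by (auto simp: indicator_def)
    qed
  qed (rule integrable_lT)
  have lT0: "0 \<le> lT x" for x
    unfolding lT_def using AE_T_nonneg by (intro integral_nonneg_AE) (auto elim: eventually_mono)
  have "((\<lambda>x. lT (1 / m * x) * tail \<mu> x / F x) \<longlongrightarrow> 0) at_top"
  proof (rule tendsto_sandwich[OF _ _ tendsto_const U])
    show "\<forall>\<^sub>F x in at_top. 0 \<le> lT (1 / m * x) * tail \<mu> x / F x"
      using lT0 F_pos by (intro always_eventually allI divide_nonneg_pos mult_nonneg_nonneg) (auto simp: tail_def)
    show "\<forall>\<^sub>F x in at_top. lT (1 / m * x) * tail \<mu> x / F x \<le> U x * tail \<mu> x / F x"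
      using eventually_gt_at_top[of 0]
      by eventually_elim (use F_pos le in \<open>auto intro!: divide_right_mono mult_right_mono simp: tail_def less_imp_le\<close>)
  qed
  then show ?thesis using that[of "1 / m"] m by simp
qed

text \<open>The cut is at T = a x: below it min(T, x) <= T, above it min(T, x) <= x. The scale
  \<open>a\<close> is free so as to match the one at which the limit hypothesis controls
  \<open>lT\<close>.\<close>

lemma mT_le:
  assumes "0 \<le> x" "0 < a"
  shows "mT x \<le> lT (a * x) + x * F (a * x)"
proof -
  have i: "integrable M (\<lambda>\<omega>. x * indicator {\<omega>\<in>space M. a * x < T \<omega>} \<omega>)"
    by (intro integrable_mult_right integrable_real_indicator) (auto simp: less_top[symmetric])
  have "mT x \<le> (\<integral>\<omega>. T \<omega> * indicator {\<omega>\<in>space M. T \<omega> \<le> a * x} \<omega> + x * indicator {\<omega>\<in>space M. a * x < T \<omega>} \<omega> \<partial>M)"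
    unfolding mT_def using assms
    by (intro integral_mono integrable_min_T Bochner_Integration.integrable_add[OF integrable_lT i]) (auto simp: indicator_def)
  also have "\<dots> = lT (a * x) + x * F (a * x)"
    unfolding Bochner_Integration.integral_add[OF integrable_lT i] by (simp add: lT_def F_def)
  finally show ?thesis .
qed

text \<open>The quotient Q / G = Q mT / F splits along \<open>mT_le\<close>. The term with
  \<open>lT\<close> vanishes by the limit hypothesis, as Q = O(tail \<mu>); the other is at most C x
  Q(x), which vanishes because the increments are integrable.\<close>

lemma H_tail_small:
  assumes ij: "i < d" "j < d"
  shows "((\<lambda>t. measure (interval_measure (H i j)) {x. t < \<bar>x\<bar>} / G t) \<longlongrightarrow> 0) at_top"
proof -
  define Q where "Q t = measure (interval_measure (H i j)) {x. t < \<bar>x\<bar>}" for t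
  have Q0: "0 \<le> Q t" for t by (simp add: Q_def)
  obtain K where K: "K > 0" "\<forall>\<^sub>F x in at_top. Q x \<le> K * tail \<mu> x"
    using bigo_tail_imp[OF H_tail[OF ij]] unfolding Q_def by blast
  obtain a where a: "0 < a" "((\<lambda>x. lT (a * x) * tail \<mu> x / F x) \<longlongrightarrow> 0) at_top"
    by (rule truncated_mean_tail)
  obtain C where C: "C > 0" "\<forall>\<^sub>F x in at_top. F (a * x) \<le> C * F x"
    by (rule F_dominated[OF a(1)])
  have tQ: "((\<lambda>t. t * Q t) \<longlongrightarrow> 0) at_top" unfolding Q_def
    using H_interval_measure(1)[OF ij] mean_int[OF ij] by (intro integrable_imp_tail_small) auto
  have lT0: "0 \<le> lT x" for x
    unfolding lT_def using AE_T_nonneg by (intro integral_nonneg_AE) (auto elim: eventually_mono)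
  have lim: "((\<lambda>x. K * (lT (a * x) * tail \<mu> x / F x) + C * (x * Q x)) \<longlongrightarrow> 0) at_top"
    using tendsto_add[OF tendsto_mult[OF tendsto_const a(2)] tendsto_mult[OF tendsto_const tQ]] by simp
  have "((\<lambda>t. Q t / G t) \<longlongrightarrow> 0) at_top"
  proof (rule tendsto_sandwich[OF _ _ tendsto_const lim])
    show "\<forall>\<^sub>F t in at_top. 0 \<le> Q t / G t"
      using eventually_gt_at_top[of 0]
      by eventually_elim (use Q0 F_pos mT_pos in \<open>auto intro!: divide_nonneg_nonneg simp: G_def less_imp_le\<close>)
    show "\<forall>\<^sub>F x in at_top. Q x / G x \<le> K * (lT (a * x) * tail \<mu> x / F x) + C * (x * Q x)"
      using K(2) C(2) eventually_gt_at_top[of 0]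
    proof eventually_elim
      case (elim x)
      have "Q x * mT x \<le> Q x * lT (a * x) + Q x * (x * F (a * x))"
        using mult_left_mono[OF mT_le[of x a] Q0[of x]] elim a by (simp add: distrib_left)
      also have "\<dots> \<le> (K * tail \<mu> x) * lT (a * x) + Q x * (x * (C * F x))"
        using elim Q0[of x] lT0 by (intro add_mono mult_right_mono mult_left_mono) auto
      finally have "Q x * mT x / F x \<le> ((K * tail \<mu> x) * lT (a * x) + Q x * (x * (C * F x))) / F x"
        using F_pos[of x] by (intro divide_right_mono) auto
      also have "\<dots> = K * (lT (a * x) * tail \<mu> x / F x) + C * (x * Q x)"
        using F_pos[of x] by (simp add: field_simps)
      finally show ?case by (simp add: G_def)
    qed
  qed
  then show ?thesis by (simp add: Q_def)
qed

lemma tail_\<mu>_small: "((\<lambda>x. tail \<mu> x / F x) \<longlongrightarrow> 0) at_top"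
proof -
  obtain a where a: "0 < a" "((\<lambda>x. lT (a * x) * tail \<mu> x / F x) \<longlongrightarrow> 0) at_top"
    by (rule truncated_mean_tail)
  have "((\<lambda>x. F x) \<longlongrightarrow> 0) at_top"
  proof -
    interpret D: prob_space "distr M borel T" by (rule prob_space_distr) measurable
    interpret D: real_distribution "distr M borel T" by standard auto
    have "F x = 1 - cdf (distr M borel T) x" for x
    proof -
      have "{x<..} = space (distr M borel T) - {..x}" by auto
      then show ?thesis unfolding tail_T[symmetric] tail_def cdf_def
        using D.prob_compl[of "{..x}"] by simp
    qed
    then show ?thesis using tendsto_diff[OF tendsto_const D.cdf_lim_at_top_prob, of 1] by simp
  qed
  then have "\<forall>\<^sub>F x in at_top. F x < F 1" using F_pos by (intro order_tendstoD) auto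
  then obtain R where R: "F R < F 1" by (auto simp: eventually_at_top_linorder)
  have lower: "F 1 - F R \<le> lT x" if "R \<le> x" for x
  proof -
    have i: "integrable M (\<lambda>\<omega>. indicator {\<omega>\<in>space M. 1 < T \<omega>} \<omega> - indicator {\<omega>\<in>space M. R < T \<omega>} \<omega> :: real)"
      by (intro Bochner_Integration.integrable_diff integrable_real_indicator) (auto simp: less_top[symmetric])
    have "F 1 - F R = (\<integral>\<omega>. indicator {\<omega>\<in>space M. 1 < T \<omega>} \<omega> - indicator {\<omega>\<in>space M. R < T \<omega>} \<omega> \<partial>M)"
      unfolding F_def by (subst Bochner_Integration.integral_diff) (auto simp: less_top[symmetric])
    also have "\<dots> \<le> lT x" unfolding lT_def
    proof (rule integral_mono_AE[OF i integrable_lT])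
      show "AE \<omega> in M. indicator {\<omega>\<in>space M. 1 < T \<omega>} \<omega> - indicator {\<omega>\<in>space M. R < T \<omega>} \<omega> \<le>
        T \<omega> * indicator {\<omega>\<in>space M. T \<omega> \<le> x} \<omega>"
        using AE_T_nonneg by eventually_elim (use that in \<open>auto simp: indicator_def\<close>)
    qed
    finally show ?thesis .
  qed
  define l0 where "l0 = F 1 - F R"
  have l0: "0 < l0" using R by (simp add: l0_def)
  have lim: "((\<lambda>x. 1 / l0 * (lT (a * x) * tail \<mu> x / F x)) \<longlongrightarrow> 0) at_top"
    using tendsto_mult[OF tendsto_const a(2), of "1 / l0"] by simp
  show ?thesis
  proof (rule tendsto_sandwich[OF _ _ tendsto_const lim])
    show "\<forall>\<^sub>F x in at_top. 0 \<le> tail \<mu> x / F x"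
      using F_pos by (intro always_eventually allI divide_nonneg_pos) (auto simp: tail_def)
    show "\<forall>\<^sub>F x in at_top. tail \<mu> x / F x \<le> 1 / l0 * (lT (a * x) * tail \<mu> x / F x)"
      using eventually_ge_at_top[of "R / a"]
    proof eventually_elim
      case (elim x)
      have "R \<le> a * x" using elim a by (simp add: pos_divide_le_eq mult.commute)
      then have "1 \<le> lT (a * x) / l0" using lower[of "a * x"] l0 by (simp add: l0_def)
      then have "1 * (tail \<mu> x / F x) \<le> lT (a * x) / l0 * (tail \<mu> x / F x)"
        using F_pos[of x] by (intro mult_right_mono divide_nonneg_pos) (auto simp: tail_def)
      then show ?case by simp
    qed
  qed
qed

text \<open>\<open>is_MAP\<close> only prescribes the values of \<open>\<beta> i\<close>. The law of
  \<open>X 0\<close> on the event J_0 = i has them as its cdf, which shows that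
  \<open>\<beta> i\<close> is a distribution function and identifies its interval measure.\<close>

lemma \<beta>_measure:
  assumes i: "i < d"
  shows "prob {\<omega>\<in>space M. x < \<bar>X 0 \<omega>\<bar> \<and> J 0 \<omega> = i} = measure (interval_measure (\<beta> i)) {y. x < \<bar>y\<bar>}"
proof -
  let ?\<nu> = "distr (density M (indicator {\<omega>\<in>space M. J 0 \<omega> = i})) borel (X 0)"
  have em: "emeasure ?\<nu> B = emeasure M {\<omega>\<in>space M. X 0 \<omega> \<in> B \<and> J 0 \<omega> = i}" if B [measurable]: "B \<in> sets borel" for B
  proof -
    have "emeasure ?\<nu> B = (\<integral>\<^sup>+\<omega>. indicator {\<omega>\<in>space M. J 0 \<omega> = i} \<omega> * indicator (X 0 -` B \<inter> space M) \<omega> \<partial>M)"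
      by (subst emeasure_distr) (auto simp: emeasure_density)
    also have "\<dots> = (\<integral>\<^sup>+\<omega>. indicator {\<omega>\<in>space M. X 0 \<omega> \<in> B \<and> J 0 \<omega> = i} \<omega> \<partial>M)"
      by (intro nn_integral_cong) (auto split: split_indicator)
    also have "\<dots> = emeasure M {\<omega>\<in>space M. X 0 \<omega> \<in> B \<and> J 0 \<omega> = i}"
      by (rule nn_integral_indicator) measurable
    finally show ?thesis .
  qed
  interpret N: finite_measure ?\<nu>
  proof (rule finite_measureI)
    have "emeasure ?\<nu> UNIV \<noteq> \<infinity>" by (subst em) (auto simp: emeasure_eq_measure)
    then show "emeasure ?\<nu> (space ?\<nu>) \<noteq> \<infinity>" by simp
  qed
  interpret N: finite_borel_measure ?\<nu> by standard simp
  have cdf: "cdf ?\<nu> = \<beta> i"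
  proof
    fix y
    have "emeasure ?\<nu> {..y} = emeasure M {\<omega>\<in>space M. X 0 \<omega> \<le> y \<and> J 0 \<omega> = i}" by (subst em) auto
    then have "measure ?\<nu> {..y} = prob {\<omega>\<in>space M. X 0 \<omega> \<le> y \<and> J 0 \<omega> = i}" by (simp add: measure_def)
    then show "cdf ?\<nu> y = \<beta> i y" using MAP i by (simp add: is_MAP_def cdf_def)
  qed
  have "distr_fun (\<beta> i)"
    unfolding distr_fun_def cdf[symmetric]
    using N.cdf_nondecreasing N.cdf_is_right_cont N.cdf_lim_at_bot N.cdf_lim_at_top by (auto simp: mono_def)
  then have "emeasure (interval_measure (\<beta> i)) {..y} = ennreal (\<beta> i y)" for y
    by (rule distr_fun_interval_measure)
  also have "ennreal (\<beta> i y) = emeasure ?\<nu> {..y}" for y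
    unfolding cdf[symmetric] cdf_def by (rule N.emeasure_eq_measure[symmetric])
  finally have "?\<nu> = interval_measure (\<beta> i)"
    by (intro finite_measure_eqI_Iic[OF _ _ N.finite_measure_axioms]) auto
  then have "emeasure (interval_measure (\<beta> i)) {y. x < \<bar>y\<bar>} = emeasure M {\<omega>\<in>space M. X 0 \<omega> \<in> {y. x < \<bar>y\<bar>} \<and> J 0 \<omega> = i}"
    using em[of "{y. x < \<bar>y\<bar>}"] by simp
  then show ?thesis by (simp add: measure_def)
qed

text \<open>Summing over the finitely many initial states keeps the bound o(F), and dominated
  variation of \<open>F\<close> absorbs the factor \<open>\<eta>\<close>.\<close>

lemma X0_tail_small:
  assumes \<eta>: "0 < \<eta>"
  shows "((\<lambda>x. prob {\<omega>\<in>space M. \<eta> * x < \<bar>X 0 \<omega>\<bar>} / F x) \<longlongrightarrow> 0) at_top"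
proof -
  let ?q = "\<lambda>x. prob {\<omega>\<in>space M. x < \<bar>X 0 \<omega>\<bar>}"
  have split: "?q x = (\<Sum>i<d. measure (interval_measure (\<beta> i)) {y. x < \<bar>y\<bar>})" for x
    by (subst split_state[where n = 0], measurable)
      (auto simp flip: \<beta>_measure intro!: sum.cong arg_cong[where f = prob])
  have one: "((\<lambda>x. measure (interval_measure (\<beta> i)) {y. x < \<bar>y\<bar>} / F x) \<longlongrightarrow> 0) at_top" if i: "i < d" for i
  proof -
    obtain K where K: "K > 0" "\<forall>\<^sub>F x in at_top. measure (interval_measure (\<beta> i)) {y. x < \<bar>y\<bar>} \<le> K * tail \<mu> x"
      using bigo_tail_imp[OF \<beta>_tail[OF i]] by blast
    have lim: "((\<lambda>x. K * (tail \<mu> x / F x)) \<longlongrightarrow> 0) at_top"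
      using tendsto_mult[OF tendsto_const tail_\<mu>_small, of K] by simp
    show ?thesis
    proof (rule tendsto_sandwich[OF _ _ tendsto_const lim])
      show "\<forall>\<^sub>F x in at_top. 0 \<le> measure (interval_measure (\<beta> i)) {y. x < \<bar>y\<bar>} / F x"
        using F_pos by (intro always_eventually allI divide_nonneg_pos) auto
      show "\<forall>\<^sub>F x in at_top. measure (interval_measure (\<beta> i)) {y. x < \<bar>y\<bar>} / F x \<le> K * (tail \<mu> x / F x)"
        using K(2) by eventually_elim (use F_pos in \<open>auto intro!: divide_right_mono simp: less_imp_le\<close>)
    qed
  qed
  have q: "((\<lambda>x. ?q x / F x) \<longlongrightarrow> 0) at_top"
    unfolding split sum_divide_distrib using one by (intro tendsto_null_sum) auto
  obtain C where C: "C > 0" "\<forall>\<^sub>F x in at_top. F (\<eta> * x) \<le> C * F x" by (rule F_dominated[OF \<eta>])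
  have "filterlim (\<lambda>x::real. \<eta> * x) at_top at_top"
    using \<eta> by (intro filterlim_tendsto_pos_mult_at_top[OF tendsto_const]) (auto simp: filterlim_ident)
  from filterlim_compose[OF q this]
  have lim: "((\<lambda>x. C * (?q (\<eta> * x) / F (\<eta> * x))) \<longlongrightarrow> 0) at_top"
    by (rule tendsto_mult_right_zero)
  show ?thesis
  proof (rule tendsto_sandwich[OF _ _ tendsto_const lim])
    show "\<forall>\<^sub>F x in at_top. 0 \<le> ?q (\<eta> * x) / F x"
      using F_pos by (intro always_eventually allI divide_nonneg_pos) auto
    show "\<forall>\<^sub>F x in at_top. ?q (\<eta> * x) / F x \<le> C * (?q (\<eta> * x) / F (\<eta> * x))"
      using C(2)
    proof eventually_elim
      case (elim x)
      have "?q (\<eta> * x) / F x = C * (?q (\<eta> * x) / (C * F x))" using C by simp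
      also have "\<dots> \<le> C * (?q (\<eta> * x) / F (\<eta> * x))"
        using elim C F_pos[of x] F_pos[of "\<eta> * x"] by (intro mult_left_mono divide_left_mono) auto
      finally show ?case .
    qed
  qed
qed

end

lemma asymp_equiv_sandwichI:
  fixes f F :: "real \<Rightarrow> real"
  assumes pos: "\<And>x. 0 < F x"
    and lower: "\<And>e. 0 < e \<Longrightarrow> e < 1 \<Longrightarrow> \<forall>\<^sub>F x in at_top. (1 - e) * F x \<le> f x"
    and upper: "\<And>e. 0 < e \<Longrightarrow> e < 1 \<Longrightarrow> \<forall>\<^sub>F x in at_top. f x \<le> (1 + e) * F x"
  shows "f \<sim>[at_top] F"
proof (rule asymp_equivI', rule tendstoI)
  fix e :: real assume "0 < e"
  define e' where "e' = min (e / 2) (1 / 2)"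
  have e': "0 < e'" "e' < 1" "e' < e" using \<open>0 < e\<close> by (auto simp: e'_def min_def)
  show "\<forall>\<^sub>F x in at_top. dist (f x / F x) 1 < e"
    using lower[OF e'(1,2)] upper[OF e'(1,2)]
  proof eventually_elim
    case (elim x)
    have "1 - e' \<le> f x / F x" "f x / F x \<le> 1 + e'"
      using elim pos[of x] by (simp_all only: pos_le_divide_eq pos_divide_le_eq)
    then show ?case using e' by (simp add: dist_real_def abs_less_iff)
  qed
qed

lemma Smax_greater_iff: "c < Smax X n \<omega> \<longleftrightarrow> (\<exists>k\<le>n. c < Ssum X k \<omega>)"
proof -
  have "{Ssum X k \<omega> | k. k \<le> n} = (\<lambda>k. Ssum X k \<omega>) ` {..n}" by auto
  then show ?thesis unfolding Smax_def by (auto simp: Max_gr_iff)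
qed

text \<open>The increments of \<open>g\<close> along the chain telescope. The identity holds for any
  \<open>g\<close> and \<open>h\<close>; the Poisson equation matters only for centring the
  sum.\<close>

lemma Ssum_decomposition:
  "Ssum X k \<omega> = X 0 \<omega> + real k * h
    + (\<Sum>l<k. X (Suc l) \<omega> + (g (J (Suc l) \<omega>) - g (J l \<omega>) - h)) + g (J 0 \<omega>) - g (J k \<omega>)"
  by (induction k) (simp_all add: Ssum_def algebra_simps)

section \<open>Evaluation at the independent random time\<close>

context sampled_map
begin

abbreviation "h \<equiv> drift d H \<pi>"

lemma nat_floor_measurable [measurable]: "(\<lambda>t::real. nat \<lfloor>t\<rfloor>) \<in> measurable borel (count_space UNIV)"
  by (rule measurable_compose[OF measurable_real_floor]) simp

lemma process_events_sets: "E \<in> process_events M X J \<Longrightarrow> E \<in> sets M"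
  using indep_setD_ev2[OF T_indep] by auto

lemma past_process_events: "E \<in> sets (past n) \<Longrightarrow> E \<in> process_events M X J"
proof -
  assume "E \<in> sets (past n)"
  then show ?thesis unfolding sets_past past_events_def process_events_def
    by (rule rev_subsetD) (intro sigma_sets_mono' UN_mono, auto)
qed

lemma maximum_event_past:
  assumes u: "\<And>i j. u i j \<in> borel_measurable borel"
  shows "{\<omega>\<in>space M. \<exists>k\<le>n. z \<le> (\<Sum>l<k. incr u l \<omega>)} \<in> sets (past n)"
proof -
  have "{\<omega>\<in>space M. \<exists>k\<le>n. z \<le> (\<Sum>l<k. incr u l \<omega>)} = (\<Union>k\<in>{..n}. {\<omega>\<in>space (past n). z \<le> (\<Sum>l<k. incr u l \<omega>)})"
    by auto
  also have "\<dots> \<in> sets (past n)"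
    by (intro sets.finite_UN borel_measurable_le borel_measurable_sum incr_past u) auto
  finally show ?thesis .
qed

lemma sampled_event_split:
  "{\<omega>\<in>space M. T \<omega> \<in> B \<and> \<omega> \<in> E (nat \<lfloor>T \<omega>\<rfloor>)} =
    (\<Union>n. (T -` (B \<inter> (\<lambda>t. nat \<lfloor>t\<rfloor>) -` {n}) \<inter> space M) \<inter> E n)"
  by auto

lemma time_slice:
  assumes "B \<in> sets borel"
  shows "T -` (B \<inter> (\<lambda>t. nat \<lfloor>t\<rfloor>) -` {n}) \<inter> space M \<in> rv_events M T"
    and "T -` (B \<inter> (\<lambda>t. nat \<lfloor>t\<rfloor>) -` {n}) \<inter> space M \<in> sets M"
proof -
  have "(\<lambda>t::real. nat \<lfloor>t\<rfloor>) -` {n} \<inter> space borel \<in> sets borel"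
    by (rule measurable_sets[OF nat_floor_measurable]) simp
  then have B: "B \<inter> (\<lambda>t. nat \<lfloor>t\<rfloor>) -` {n} \<in> sets borel" using assms by (intro sets.Int) auto
  then show "T -` (B \<inter> (\<lambda>t. nat \<lfloor>t\<rfloor>) -` {n}) \<inter> space M \<in> rv_events M T"
    unfolding rv_events_def by blast
  show "T -` (B \<inter> (\<lambda>t. nat \<lfloor>t\<rfloor>) -` {n}) \<inter> space M \<in> sets M"
    by (rule measurable_sets[OF T_meas B])
qed

lemma sampled_event_sets:
  assumes "B \<in> sets borel" "\<And>n. E n \<in> sets M"
  shows "{\<omega>\<in>space M. T \<omega> \<in> B \<and> \<omega> \<in> E (nat \<lfloor>T \<omega>\<rfloor>)} \<in> sets M"
  unfolding sampled_event_split using time_slice(2)[OF assms(1)] assms(2) by (intro sets.countable_UN) auto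

text \<open>Slicing by the value of floor(T) makes the sampling time deterministic, and independence
  factorizes each slice. Slices that miss \<open>B\<close> are empty, so \<open>q\<close> has to
  bound only the others.\<close>

lemma sampled_event_bound:
  assumes E: "\<And>n. E n \<in> process_events M X J" and B: "B \<in> sets borel"
    and q: "\<And>t. t \<in> B \<Longrightarrow> prob (E (nat \<lfloor>t\<rfloor>)) \<le> q (nat \<lfloor>t\<rfloor>)"
  shows "emeasure M {\<omega>\<in>space M. T \<omega> \<in> B \<and> \<omega> \<in> E (nat \<lfloor>T \<omega>\<rfloor>)} \<le>
    (\<integral>\<^sup>+\<omega>. indicator B (T \<omega>) * ennreal (q (nat \<lfloor>T \<omega>\<rfloor>)) \<partial>M)"
proof -
  let ?A = "\<lambda>n. T -` (B \<inter> (\<lambda>t. nat \<lfloor>t\<rfloor>) -` {n}) \<inter> space M"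
  note A = time_slice[OF B]
  have [measurable]: "?A n \<in> sets M" for n by (rule A)
  have EM: "E n \<in> sets M" for n using E by (rule process_events_sets)
  have "emeasure M (\<Union>n. ?A n \<inter> E n) \<le> (\<Sum>n. emeasure M (?A n \<inter> E n))"
    using A(2) EM by (intro emeasure_subadditive_countably) auto
  also have "\<dots> \<le> (\<Sum>n. \<integral>\<^sup>+\<omega>. ennreal (q n) * indicator (?A n) \<omega> \<partial>M)"
  proof (rule suminf_le)
    fix n
    show "emeasure M (?A n \<inter> E n) \<le> (\<integral>\<^sup>+\<omega>. ennreal (q n) * indicator (?A n) \<omega> \<partial>M)"
    proof (cases "?A n = {}")
      case False
      then obtain t where t: "t \<in> B" "nat \<lfloor>t\<rfloor> = n" by auto
      have "emeasure M (?A n \<inter> E n) = ennreal (prob (E n) * prob (?A n))"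
        unfolding emeasure_eq_measure indep_setD[OF T_indep A(1) E] by (simp add: mult.commute)
      also have "\<dots> \<le> ennreal (q n * prob (?A n))"
        using q[OF t(1)] t(2) by (intro ennreal_leI mult_right_mono) auto
      also have "\<dots> = ennreal (q n) * emeasure M (?A n)"
        unfolding emeasure_eq_measure by (rule ennreal_mult'') simp
      also have "\<dots> = (\<integral>\<^sup>+\<omega>. ennreal (q n) * indicator (?A n) \<omega> \<partial>M)"
        using A(2) by (simp add: nn_integral_cmult_indicator)
      finally show ?thesis .
    qed simp
  qed auto
  also have "\<dots> = (\<integral>\<^sup>+\<omega>. (\<Sum>n. ennreal (q n) * indicator (?A n) \<omega>) \<partial>M)"
    by (rule nn_integral_suminf[symmetric]) measurable
  also have "\<dots> = (\<integral>\<^sup>+\<omega>. indicator B (T \<omega>) * ennreal (q (nat \<lfloor>T \<omega>\<rfloor>)) \<partial>M)"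
  proof (rule nn_integral_cong)
    fix \<omega> assume \<omega>: "\<omega> \<in> space M"
    have "(\<Sum>n. ennreal (q n) * indicator (?A n) \<omega>) = (\<Sum>n\<in>{nat \<lfloor>T \<omega>\<rfloor>}. ennreal (q n) * indicator (?A n) \<omega>)"
      by (rule suminf_finite) auto
    also have "\<dots> = indicator B (T \<omega>) * ennreal (q (nat \<lfloor>T \<omega>\<rfloor>))"
      using \<omega> by (simp add: indicator_def)
    finally show "(\<Sum>n. ennreal (q n) * indicator (?A n) \<omega>) = indicator B (T \<omega>) * ennreal (q (nat \<lfloor>T \<omega>\<rfloor>))" .
  qed
  finally show ?thesis unfolding sampled_event_split .
qed

lemma Ssum_measurable [measurable]: "Ssum X n \<in> borel_measurable M"
  unfolding Ssum_def[abs_def] by measurable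

lemma sampled_measurable:
  "(\<lambda>\<omega>. Ssum X (nat \<lfloor>T \<omega>\<rfloor>) \<omega>) \<in> borel_measurable M"
  "{\<omega>\<in>space M. c < Smax X (nat \<lfloor>T \<omega>\<rfloor>) \<omega>} \<in> sets M"
proof -
  have N: "(\<lambda>\<omega>. nat \<lfloor>T \<omega>\<rfloor>) \<in> measurable M (count_space UNIV)" by measurable
  show "(\<lambda>\<omega>. Ssum X (nat \<lfloor>T \<omega>\<rfloor>) \<omega>) \<in> borel_measurable M"
    by (rule measurable_compose_countable[OF _ N, where f = "\<lambda>n. Ssum X n"]) measurable
  have "{\<omega>\<in>space M. T \<omega> \<in> UNIV \<and> \<omega> \<in> {\<omega>\<in>space M. c < Smax X (nat \<lfloor>T \<omega>\<rfloor>) \<omega>}} \<in> sets M"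
    using sampled_event_sets[of UNIV "\<lambda>n. {\<omega>\<in>space M. \<exists>k\<le>n. c < Ssum X k \<omega>}"]
    unfolding Smax_greater_iff by simp
  then show "{\<omega>\<in>space M. c < Smax X (nat \<lfloor>T \<omega>\<rfloor>) \<omega>} \<in> sets M" by simp
qed

text \<open>The martingale part \<open>D\<close> of \<open>S\<close>, obtained from the solution \<open>g\<close> of the Poisson equation.\<close>

lemma martingale_decomposition:
  obtains D :: "nat \<Rightarrow> 'a \<Rightarrow> real" and b where
    "\<And>k \<omega>. \<omega> \<in> space M \<Longrightarrow> \<bar>Ssum X k \<omega> - (X 0 \<omega> + real k * h + D k \<omega>)\<bar> \<le> b"
    "\<And>s n z. {\<omega>\<in>space M. \<exists>k\<le>n. z \<le> s * D k \<omega>} \<in> sets (past n)"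
    "\<And>\<omega>. D 0 \<omega> = 0"
    "\<And>s \<eta> \<epsilon>. \<bar>s\<bar> = 1 \<Longrightarrow> 0 < \<eta> \<Longrightarrow> 0 < \<epsilon> \<Longrightarrow> \<forall>\<^sub>F x in at_top. \<forall>n. 1 \<le> n \<and> real n \<le> x \<longrightarrow>
      prob {\<omega>\<in>space M. \<exists>k\<le>n. \<eta> * x \<le> s * D k \<omega>} \<le> \<epsilon> * (real n * G x)"
proof -
  let ?m = "\<lambda>i. \<Sum>j<d. \<integral>y. y \<partial>interval_measure (H i j)"
  have pi1: "(\<Sum>i<d. \<pi> i) = 1" using stat by (simp add: stationary_vector_def)
  \<comment> \<open>The definition of the drift is exactly the solvability condition of the Poisson
    equation.\<close>
  have "(\<Sum>i<d. \<pi> i * (?m i - h)) = (\<Sum>i<d. \<pi> i * ?m i) - (\<Sum>i<d. \<pi> i) * h"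
    by (simp add: right_diff_distrib sum_subtractf sum_distrib_right)
  then have "(\<Sum>i<d. \<pi> i * (?m i - h)) = 0" using pi1 by (simp add: drift_def)
  then obtain g where g: "\<And>i. i < d \<Longrightarrow> ?m i - h + (\<Sum>j<d. Hinf H i j * g j) = g i"
    using poisson_equation[OF stoch irred stat, of "\<lambda>i. ?m i - h"] by blast
  obtain c where c: "dominated_fun G c" using dominated_fun_G by blast
  define D where "D k \<omega> = (\<Sum>l<k. X (Suc l) \<omega> + (g (J (Suc l) \<omega>) - g (J l \<omega>) - h))" for k \<omega>
  let ?u = "\<lambda>s i j y. s * (y + (g j - g i - h))"
  have D_incr: "(\<Sum>l<k. incr (?u s) l \<omega>) = s * D k \<omega>" for s k \<omega>
    by (simp add: incr_def D_def sum_distrib_left)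
  have g_le: "\<bar>g i\<bar> \<le> (\<Sum>i<d. \<bar>g i\<bar>)" if "i < d" for i
    using that by (intro member_le_sum) auto
  show ?thesis
  proof (rule that[of D "2 * (\<Sum>i<d. \<bar>g i\<bar>)"])
    fix k \<omega> assume \<omega>: "\<omega> \<in> space M"
    have "Ssum X k \<omega> - (X 0 \<omega> + real k * h + D k \<omega>) = g (J 0 \<omega>) - g (J k \<omega>)"
      unfolding D_def by (subst Ssum_decomposition[where g = g and h = h and J = J]) simp
    then show "\<bar>Ssum X k \<omega> - (X 0 \<omega> + real k * h + D k \<omega>)\<bar> \<le> 2 * (\<Sum>i<d. \<bar>g i\<bar>)"
      using g_le[OF J_less[OF \<omega>, of 0]] g_le[OF J_less[OF \<omega>, of k]] by linarith
  next
    fix s z :: real and n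
    show "{\<omega>\<in>space M. \<exists>k\<le>n. z \<le> s * D k \<omega>} \<in> sets (past n)"
      unfolding D_incr[symmetric] by (rule maximum_event_past) measurable
  next
    show "D 0 \<omega> = 0" for \<omega> by (simp add: D_def)
  next
    fix s \<eta> \<epsilon> :: real assume "\<bar>s\<bar> = 1" "0 < \<eta>" "0 < \<epsilon>"
    then show "\<forall>\<^sub>F x in at_top. \<forall>n. 1 \<le> n \<and> real n \<le> x \<longrightarrow>
      prob {\<omega>\<in>space M. \<exists>k\<le>n. \<eta> * x \<le> s * D k \<omega>} \<le> \<epsilon> * (real n * G x)"
      unfolding D_incr[symmetric] using deviation[OF c H_tail_small mean_int g] by blast
  qed
qed

text \<open>As long as T <= x / v, the drift alone lifts the walk to at most h x / v. A maximum
  above h x therefore needs T > x / v, a large |X_0| or a large martingale part. The first event has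
  probability close to F(x) by class C, each of the others costs a small multiple of F(x).\<close>

lemma upper_bound:
  assumes e: "0 < e" "e < 1"
  shows "\<forall>\<^sub>F x in at_top. prob {\<omega>\<in>space M. h * x < Smax X (nat \<lfloor>T \<omega>\<rfloor>) \<omega>} \<le> (1 + e) * F x"
proof -
  obtain D b where D: "\<And>k \<omega>. \<omega> \<in> space M \<Longrightarrow> \<bar>Ssum X k \<omega> - (X 0 \<omega> + real k * h + D k \<omega>)\<bar> \<le> b"
    and D_past: "\<And>s n z. {\<omega>\<in>space M. \<exists>k\<le>n. z \<le> s * D k \<omega>} \<in> sets (past n)"
    and D0: "\<And>\<omega>. D 0 \<omega> = 0"
    and dev: "\<And>s \<eta> \<epsilon>. \<bar>s\<bar> = 1 \<Longrightarrow> 0 < \<eta> \<Longrightarrow> 0 < \<epsilon> \<Longrightarrow> \<forall>\<^sub>F x in at_top. \<forall>n. 1 \<le> n \<and> real n \<le> x \<longrightarrow>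
      prob {\<omega>\<in>space M. \<exists>k\<le>n. \<eta> * x \<le> s * D k \<omega>} \<le> \<epsilon> * (real n * G x)"
    using martingale_decomposition by blast
  obtain v where v: "1 < v" "\<forall>\<^sub>F x in at_top. (1 - e / 6) * F x \<le> F (v * x)"
    using e by (rule_tac F_scaling[of "e / 6"]) auto
  have "filterlim (\<lambda>x::real. 1 / v * x) at_top at_top"
    using v by (intro filterlim_tendsto_pos_mult_at_top[OF tendsto_const]) (auto simp: filterlim_ident)
  from eventually_compose_filterlim[OF v(2) this]
  have Fv: "\<forall>\<^sub>F x in at_top. (1 - e / 6) * F (x / v) \<le> F x" using v by simp
  \<comment> \<open>\<open>\<eta> * x\<close> is a third of the gap between h x / v and h x:
    \<open>X 0\<close>, the bounded term \<open>b\<close> and the martingale part get one share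
    each.\<close>
  define \<eta> where "\<eta> = h * (1 - 1 / v) / 3"
  have \<eta>: "0 < \<eta>" using h_pos v by (simp add: \<eta>_def)
  have "\<forall>\<^sub>F x in at_top. prob {\<omega>\<in>space M. \<eta> * x < \<bar>X 0 \<omega>\<bar>} / F x < e / 3"
    using X0_tail_small[OF \<eta>] e by (intro order_tendstoD) auto
  moreover have "\<forall>\<^sub>F x in at_top. \<forall>n. 1 \<le> n \<and> real n \<le> x \<longrightarrow>
      prob {\<omega>\<in>space M. \<exists>k\<le>n. \<eta> * x \<le> 1 * D k \<omega>} \<le> e / 3 * (real n * G x)"
    using e \<eta> by (intro dev) auto
  ultimately show ?thesis using Fv eventually_gt_at_top[of 0] eventually_ge_at_top[of "b / \<eta>"]
  proof eventually_elim
    case (elim x)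
    have x: "0 < x" "b \<le> \<eta> * x" using elim \<eta> by (auto simp: pos_divide_le_eq mult.commute)
    let ?E = "\<lambda>n. {\<omega>\<in>space M. \<exists>k\<le>n. \<eta> * x \<le> 1 * D k \<omega>}"
    let ?B = "{..x / v}"
    let ?A1 = "{\<omega>\<in>space M. x / v < T \<omega>}"
    let ?A2 = "{\<omega>\<in>space M. \<eta> * x < \<bar>X 0 \<omega>\<bar>}"
    let ?A3 = "{\<omega>\<in>space M. T \<omega> \<in> ?B \<and> \<omega> \<in> ?E (nat \<lfloor>T \<omega>\<rfloor>)}"
    have E: "?E n \<in> process_events M X J" for n by (rule past_process_events[OF D_past])
    have "?A3 \<in> sets M"
      by (rule sampled_event_sets) (use E process_events_sets in auto)
    moreover have "?A1 \<in> sets M" "?A2 \<in> sets M" by measurable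
    ultimately have A_sets: "?A1 \<in> sets M" "?A2 \<in> sets M" "?A3 \<in> sets M" by blast+
    have Gx: "0 \<le> G x" using F_pos[of x] mT_pos[OF x(1)] by (simp add: G_def)
    have "emeasure M ?A3 \<le> (\<integral>\<^sup>+\<omega>. indicator ?B (T \<omega>) * ennreal (e / 3 * (real (nat \<lfloor>T \<omega>\<rfloor>) * G x)) \<partial>M)"
    proof (rule sampled_event_bound[OF E])
      fix t assume t: "t \<in> ?B"
      have "x / v \<le> x" using x v by (simp add: pos_divide_le_eq)
      then have "real (nat \<lfloor>t\<rfloor>) \<le> x" using t x of_nat_floor[of t] unfolding atMost_iff by (cases "0 \<le> t") linarith+
      \<comment> \<open>The deviation bound starts at n = 1; at n = 0 the walk \<open>D\<close> is
        0, below the positive level.\<close>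
      moreover have "prob (?E 0) = 0" using \<eta> x by (simp add: D0 mult_le_0_iff not_le)
      ultimately show "prob (?E (nat \<lfloor>t\<rfloor>)) \<le> e / 3 * (real (nat \<lfloor>t\<rfloor>) * G x)"
        using elim(2)[rule_format, of "nat \<lfloor>t\<rfloor>"] by (cases "nat \<lfloor>t\<rfloor> = 0") auto
    qed simp
    also have "\<dots> \<le> (\<integral>\<^sup>+\<omega>. ennreal (e / 3 * G x * min (T \<omega>) x) \<partial>M)"
    proof (rule nn_integral_mono_AE)
      show "AE \<omega> in M. indicator ?B (T \<omega>) * ennreal (e / 3 * (real (nat \<lfloor>T \<omega>\<rfloor>) * G x)) \<le> ennreal (e / 3 * G x * min (T \<omega>) x)"
        using AE_T_nonneg
      proof eventually_elim
        case (elim \<omega>)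
        show ?case
        proof (cases "T \<omega> \<le> x / v")
          case True
          moreover have "x / v \<le> x" using x v by (simp add: pos_divide_le_eq)
          ultimately have "real (nat \<lfloor>T \<omega>\<rfloor>) \<le> min (T \<omega>) x" using elim of_nat_floor[OF elim] by simp
          then have "e / 3 * G x * real (nat \<lfloor>T \<omega>\<rfloor>) \<le> e / 3 * G x * min (T \<omega>) x"
            using e Gx by (intro mult_left_mono) auto
          then show ?thesis using True by (auto intro!: ennreal_leI simp: mult_ac)
        qed simp
      qed
    qed
    also have "\<dots> = ennreal (e / 3 * F x)"
    proof -
      have "(\<integral>\<^sup>+\<omega>. ennreal (e / 3 * G x * min (T \<omega>) x) \<partial>M) = ennreal (\<integral>\<omega>. e / 3 * G x * min (T \<omega>) x \<partial>M)"
      proof (rule nn_integral_eq_integral)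
        show "integrable M (\<lambda>\<omega>. e / 3 * G x * min (T \<omega>) x)"
          using integrable_min_T[of x] x by (intro integrable_mult_right) auto
        show "AE \<omega> in M. 0 \<le> e / 3 * G x * min (T \<omega>) x"
          using AE_T_nonneg by eventually_elim (use e Gx x in auto)
      qed
      also have "(\<integral>\<omega>. e / 3 * G x * min (T \<omega>) x \<partial>M) = e / 3 * (G x * mT x)" by (simp add: mT_def)
      also have "G x * mT x = F x" using mT_pos[OF x(1)] by (simp add: G_def)
      finally show ?thesis .
    qed
    finally have A3: "prob ?A3 \<le> e / 3 * F x"
      using e F_pos[of x] by (simp add: emeasure_eq_measure)
    have A2: "prob ?A2 \<le> e / 3 * F x"
      using elim(1) F_pos[of x] by (simp only: pos_divide_less_eq less_imp_le)
    have A1: "prob ?A1 \<le> (1 + e / 3) * F x"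
    proof -
      \<comment> \<open>Inverts the scaling inequality at \<open>x / v\<close>; the product equals 1
        + e / 6 - e^2 / 18.\<close>
      have "(1 + e / 3) * (1 - e / 6) \<ge> 1"
        using e mult_left_mono[of e 1 e] by (simp add: algebra_simps)
      then have "1 * F (x / v) \<le> (1 + e / 3) * (1 - e / 6) * F (x / v)"
        using F_pos[of "x / v"] by (intro mult_right_mono) auto
      also have "\<dots> = (1 + e / 3) * ((1 - e / 6) * F (x / v))" by simp
      also have "\<dots> \<le> (1 + e / 3) * F x" using elim(3) e by (intro mult_left_mono) auto
      finally show ?thesis by (simp add: F_def)
    qed
    have "prob {\<omega>\<in>space M. h * x < Smax X (nat \<lfloor>T \<omega>\<rfloor>) \<omega>} \<le> prob (?A1 \<union> ?A2 \<union> ?A3)"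
    proof (rule finite_measure_mono)
      show "{\<omega>\<in>space M. h * x < Smax X (nat \<lfloor>T \<omega>\<rfloor>) \<omega>} \<subseteq> ?A1 \<union> ?A2 \<union> ?A3"
      proof (rule subsetI, rule ccontr)
        fix \<omega> assume "\<omega> \<in> {\<omega>\<in>space M. h * x < Smax X (nat \<lfloor>T \<omega>\<rfloor>) \<omega>}" and n: "\<omega> \<notin> ?A1 \<union> ?A2 \<union> ?A3"
        then obtain k where \<omega>: "\<omega> \<in> space M" and k: "k \<le> nat \<lfloor>T \<omega>\<rfloor>" "h * x < Ssum X k \<omega>"
          by (auto simp: Smax_greater_iff)
        have T: "T \<omega> \<le> x / v" and X0: "\<bar>X 0 \<omega>\<bar> \<le> \<eta> * x"
          using n \<omega> k by (auto simp: not_less not_le)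
        have "\<omega> \<notin> ?E (nat \<lfloor>T \<omega>\<rfloor>)" using n \<omega> T by blast
        then have "\<not> \<eta> * x \<le> 1 * D k \<omega>" using \<omega> k(1) by blast
        then have Dk: "D k \<omega> < \<eta> * x" by simp
        have "real k \<le> x / v"
        proof (cases "0 \<le> T \<omega>")
          case True
          have "real k \<le> real (nat \<lfloor>T \<omega>\<rfloor>)" using k by simp
          also have "\<dots> \<le> T \<omega>" using True by (rule of_nat_floor)
          finally show ?thesis using T by simp
        next
          \<comment> \<open>\<open>T\<close> is nonnegative only almost surely; at a negative value
            \<open>nat\<close> of the floor is 0, which leaves k = 0.\<close>
          case False
          then have "k = 0" using k(1) by simp
          then show ?thesis using x v by simp
        qed
        then have "real k * h \<le> x / v * h" using h_pos by (intro mult_right_mono) auto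
        moreover have "3 * (\<eta> * x) = h * x - x / v * h" using v by (simp add: \<eta>_def field_simps)
        ultimately show False using D[OF \<omega>, of k] X0 Dk k x by linarith
      qed
    qed (intro sets.Un A_sets)
    also have "\<dots> \<le> prob ?A1 + prob ?A2 + prob ?A3"
      using measure_Un_le[OF sets.Un[OF A_sets(1,2)] A_sets(3)] measure_Un_le[OF A_sets(1,2)] by linarith
    also have "\<dots> \<le> (1 + e / 3) * F x + e / 3 * F x + e / 3 * F x" by (intro add_mono A1 A2 A3)
    also have "\<dots> = (1 + e) * F x" by (simp add: algebra_simps)
    finally show ?case .
  qed
qed

text \<open>Given T > v x, the walk fails to exceed h x only on an event of the process up to time n
  = floor(T), of probability at most e / 3 once n is large. Independence turns this into a loss of e
  / 3 * P(T > v x), and P(T > v x) is close to P(T > x) by class C.\<close>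

lemma lower_bound:
  assumes e: "0 < e" "e < 1"
  shows "\<forall>\<^sub>F x in at_top. (1 - e) * F x \<le> prob {\<omega>\<in>space M. h * x < Ssum X (nat \<lfloor>T \<omega>\<rfloor>) \<omega>}"
proof -
  obtain D b where D: "\<And>k \<omega>. \<omega> \<in> space M \<Longrightarrow> \<bar>Ssum X k \<omega> - (X 0 \<omega> + real k * h + D k \<omega>)\<bar> \<le> b"
    and D_past: "\<And>s n z. {\<omega>\<in>space M. \<exists>k\<le>n. z \<le> s * D k \<omega>} \<in> sets (past n)"
    and "\<And>\<omega>. D 0 \<omega> = 0"
    and dev: "\<And>s \<eta> \<epsilon>. \<bar>s\<bar> = 1 \<Longrightarrow> 0 < \<eta> \<Longrightarrow> 0 < \<epsilon> \<Longrightarrow> \<forall>\<^sub>F x in at_top. \<forall>n. 1 \<le> n \<and> real n \<le> x \<longrightarrow>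
      prob {\<omega>\<in>space M. \<exists>k\<le>n. \<eta> * x \<le> s * D k \<omega>} \<le> \<epsilon> * (real n * G x)"
    using martingale_decomposition by blast
  obtain c where "dominated_fun G c" using dominated_fun_G by blast
  then interpret G: dominated_fun G c .
  obtain v where v: "1 < v" "\<forall>\<^sub>F x in at_top. (1 - e / 3) * F x \<le> F (v * x)"
    using e by (rule_tac F_scaling[of "e / 3"]) auto
  \<comment> \<open>The room between w x and v x absorbs the rounding down of
    \<open>T\<close>.\<close>
  define w where "w = (1 + v) / 2"
  have w: "1 < w" "w < v" using v by (auto simp: w_def)
  \<comment> \<open>Three losses of at most \<eta> k, the martingale one strict, still leave S_k
    above k h / w >= h x.\<close>
  define \<eta> where "\<eta> = h * (1 - 1 / w) / 3"
  have \<eta>: "0 < \<eta>" using h_pos w by (simp add: \<eta>_def)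
  \<comment> \<open>Level and horizon are both tied to \<open>n\<close> instead of x, so that the
    bad event depends on floor(T) alone.\<close>
  define Ev where "Ev n = {\<omega>\<in>space M. \<eta> * real n < \<bar>X 0 \<omega>\<bar>} \<union> {\<omega>\<in>space M. \<exists>k\<le>n. \<eta> * real n \<le> (-1) * D k \<omega>}" for n
  have E_past: "Ev n \<in> sets (past n)" for n
  proof -
    have "{\<omega>\<in>space (past n). \<eta> * real n < \<bar>X 0 \<omega>\<bar>} \<in> sets (past n)"
      by (intro borel_measurable_less borel_measurable_abs X_past) auto
    then show ?thesis unfolding space_past Ev_def by (rule sets.Un[OF _ D_past])
  qed
  have "\<forall>\<^sub>F x in at_top. prob {\<omega>\<in>space M. \<eta> * x < \<bar>X 0 \<omega>\<bar>} / F x < e / 6"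
    using X0_tail_small[OF \<eta>] e by (intro order_tendstoD) auto
  moreover have "\<forall>\<^sub>F x in at_top. \<forall>n. 1 \<le> n \<and> real n \<le> x \<longrightarrow>
      prob {\<omega>\<in>space M. \<exists>k\<le>n. \<eta> * x \<le> (-1) * D k \<omega>} \<le> e / 6 * (real n * G x)"
    using e \<eta> by (intro dev) auto
  ultimately have "\<forall>\<^sub>F x in at_top. 1 \<le> x \<and> b \<le> \<eta> * x \<and> prob {\<omega>\<in>space M. \<eta> * x < \<bar>X 0 \<omega>\<bar>} \<le> e / 6 \<and>
     (\<forall>n. 1 \<le> n \<and> real n \<le> x \<longrightarrow>
      prob {\<omega>\<in>space M. \<exists>k\<le>n. \<eta> * x \<le> (-1) * D k \<omega>} \<le> e / 6 * (real n * G x))"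
    using eventually_ge_at_top[of 1] eventually_ge_at_top[of "b / \<eta>"]
  proof eventually_elim
    case (elim x)
    have "prob {\<omega>\<in>space M. \<eta> * x < \<bar>X 0 \<omega>\<bar>} \<le> e / 6 * F x"
      using elim(1) F_pos[of x] by (simp only: pos_divide_less_eq less_imp_le)
    also have "\<dots> \<le> e / 6 * 1" using e by (intro mult_left_mono) (auto simp: F_def)
    finally show ?case using elim \<eta> by (auto simp: pos_divide_le_eq mult.commute)
  qed
  then obtain x0 where x0: "\<And>x. x0 \<le> x \<Longrightarrow> 1 \<le> x \<and> b \<le> \<eta> * x \<and> prob {\<omega>\<in>space M. \<eta> * x < \<bar>X 0 \<omega>\<bar>} \<le> e / 6 \<and>
     (\<forall>n. 1 \<le> n \<and> real n \<le> x \<longrightarrow>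
      prob {\<omega>\<in>space M. \<exists>k\<le>n. \<eta> * x \<le> (-1) * D k \<omega>} \<le> e / 6 * (real n * G x))"
    by (auto simp: eventually_at_top_linorder)
  have E_small: "prob (Ev n) \<le> e / 3" if n: "x0 \<le> real n" for n
  proof -
    have "prob (Ev n) \<le> prob {\<omega>\<in>space M. \<eta> * real n < \<bar>X 0 \<omega>\<bar>} + prob {\<omega>\<in>space M. \<exists>k\<le>n. \<eta> * real n \<le> (-1) * D k \<omega>}"
      unfolding Ev_def by (rule measure_Un_le[OF _ subsetD[OF sets_past_le D_past]]) measurable
    also have "\<dots> \<le> e / 6 + e / 6 * (real n * G (real n))"
    proof (rule add_mono)
      have "1 \<le> n \<and> real n \<le> real n" using x0[OF n] by simp
      then show "prob {\<omega>\<in>space M. \<exists>k\<le>n. \<eta> * real n \<le> (-1) * D k \<omega>} \<le> e / 6 * (real n * G (real n))"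
        using x0[OF n] by blast
    qed (use x0[OF n] in blast)
    also have "\<dots> \<le> e / 6 + e / 6 * 1"
      using x0[OF n] e by (intro add_left_mono mult_left_mono G.G_le) (linarith, simp)
    finally show ?thesis by simp
  qed
  show ?thesis using v(2) eventually_ge_at_top[of "1 / (v - w)"] eventually_gt_at_top[of 0] eventually_ge_at_top[of x0]
  proof eventually_elim
    case (elim x)
    have floor_ge: "w * x \<le> real (nat \<lfloor>t\<rfloor>)" if t: "v * x < t" for t
    proof -
      have "1 \<le> (v - w) * x" using elim(2) w by (simp add: pos_divide_le_eq mult.commute)
      then have "w * x \<le> v * x - 1" by (simp add: algebra_simps)
      also have "\<dots> < real (nat \<lfloor>t\<rfloor>)" using t by linarith
      finally show ?thesis by simp
    qed
    have wx: "x \<le> w * x" using w elim by simp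
    let ?A = "{\<omega>\<in>space M. T \<omega> \<in> {v * x<..} \<and> \<omega> \<in> Ev (nat \<lfloor>T \<omega>\<rfloor>)}"
    let ?S = "{\<omega>\<in>space M. h * x < Ssum X (nat \<lfloor>T \<omega>\<rfloor>) \<omega>}"
    note E = past_process_events[OF E_past]
    note [measurable] = sampled_measurable(1)
    have S_sets: "?S \<in> sets M" by measurable
    have A_sets: "?A \<in> sets M"
      by (rule sampled_event_sets) (use process_events_sets[OF E] in auto)
    have "emeasure M ?A \<le> (\<integral>\<^sup>+\<omega>. indicator {v * x<..} (T \<omega>) * ennreal (e / 3) \<partial>M)"
    proof (rule sampled_event_bound[OF E])
      fix t assume "t \<in> {v * x<..}"
      then have "x0 \<le> real (nat \<lfloor>t\<rfloor>)" using floor_ge[of t] wx elim(4) by simp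
      then show "prob (Ev (nat \<lfloor>t\<rfloor>)) \<le> e / 3" by (rule E_small)
    qed simp
    also have "\<dots> = (\<integral>\<^sup>+\<omega>. ennreal (e / 3) * indicator {\<omega>\<in>space M. v * x < T \<omega>} \<omega> \<partial>M)"
      by (intro nn_integral_cong) (auto simp: indicator_def)
    also have "\<dots> = ennreal (e / 3) * emeasure M {\<omega>\<in>space M. v * x < T \<omega>}"
      by (rule nn_integral_cmult_indicator) measurable
    also have "\<dots> = ennreal (e / 3 * F (v * x))"
      unfolding emeasure_eq_measure F_def by (rule ennreal_mult[symmetric]) (use e in auto)
    finally have A: "prob ?A \<le> e / 3 * F (v * x)"
      using e F_pos[of "v * x"] by (simp add: emeasure_eq_measure)
    have "F (v * x) \<le> prob (?S \<union> ?A)" unfolding F_def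
    proof (rule finite_measure_mono)
      show "{\<omega>\<in>space M. v * x < T \<omega>} \<subseteq> ?S \<union> ?A"
      proof (rule subsetI, rule ccontr)
        fix \<omega> assume \<omega>: "\<omega> \<in> {\<omega>\<in>space M. v * x < T \<omega>}" and n: "\<omega> \<notin> ?S \<union> ?A"
        define k where "k = nat \<lfloor>T \<omega>\<rfloor>"
        have k: "w * x \<le> real k" using floor_ge[of "T \<omega>"] \<omega> by (simp add: k_def)
        have "b \<le> \<eta> * real k" using x0[of "real k"] k wx elim(4) by simp
        moreover have "\<omega> \<notin> Ev k" "Ssum X k \<omega> \<le> h * x" using n \<omega> by (auto simp: k_def)
        then have "\<bar>X 0 \<omega>\<bar> \<le> \<eta> * real k" "- D k \<omega> < \<eta> * real k" "Ssum X k \<omega> \<le> h * x"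
          using \<omega> by (auto simp: Ev_def not_less not_le)
        moreover have "\<omega> \<in> space M" using \<omega> by simp
        moreover have "h * x \<le> h * (real k / w)"
          using k w h_pos by (intro mult_left_mono) (auto simp: pos_le_divide_eq mult.commute)
        moreover have "3 * (\<eta> * real k) = real k * h - h * (real k / w)"
          using w by (simp add: \<eta>_def field_simps)
        ultimately show False using D[of \<omega> k] by linarith
      qed
    qed (intro sets.Un S_sets A_sets)
    also have "\<dots> \<le> prob ?S + prob ?A" by (intro measure_Un_le S_sets A_sets)
    finally have "(1 - e / 3) * F (v * x) \<le> prob ?S" using A by (simp add: left_diff_distrib)
    moreover have "(1 - e / 3) * ((1 - e / 3) * F x) \<le> (1 - e / 3) * F (v * x)"
      using elim(1) e by (intro mult_left_mono) auto
    moreover have "(1 - e) * F x \<le> (1 - e / 3) * ((1 - e / 3) * F x)"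
    proof -
      have "1 - e \<le> (1 - e / 3) * (1 - e / 3)" using e by (simp add: algebra_simps)
      then show ?thesis using F_pos[of x] mult_right_mono[of "1 - e" "(1 - e / 3) * (1 - e / 3)" "F x"] by simp
    qed
    ultimately show ?case by (meson order_trans)
  qed
qed

text \<open>The walk lies below its maximum, so the upper bound for the maximum and the lower bound
  for the walk settle both.\<close>

lemma sampled_tail_asymptotics:
  "(\<lambda>x. prob {\<omega>\<in>space M. Ssum X (nat \<lfloor>T \<omega>\<rfloor>) \<omega> > h * x}) \<sim>[at_top] F"
  "(\<lambda>x. prob {\<omega>\<in>space M. Smax X (nat \<lfloor>T \<omega>\<rfloor>) \<omega> > h * x}) \<sim>[at_top] F"
proof -
  have le: "prob {\<omega>\<in>space M. h * x < Ssum X (nat \<lfloor>T \<omega>\<rfloor>) \<omega>} \<le> prob {\<omega>\<in>space M. h * x < Smax X (nat \<lfloor>T \<omega>\<rfloor>) \<omega>}" for x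
    by (rule finite_measure_mono[OF _ sampled_measurable(2)]) (auto simp: Smax_greater_iff)
  show "(\<lambda>x. prob {\<omega>\<in>space M. Ssum X (nat \<lfloor>T \<omega>\<rfloor>) \<omega> > h * x}) \<sim>[at_top] F"
  proof (rule asymp_equiv_sandwichI[OF F_pos lower_bound])
    fix e :: real assume "0 < e" "e < 1"
    from upper_bound[OF this]
    show "\<forall>\<^sub>F x in at_top. prob {\<omega>\<in>space M. h * x < Ssum X (nat \<lfloor>T \<omega>\<rfloor>) \<omega>} \<le> (1 + e) * F x"
      by eventually_elim (rule order_trans[OF le])
  qed
  show "(\<lambda>x. prob {\<omega>\<in>space M. Smax X (nat \<lfloor>T \<omega>\<rfloor>) \<omega> > h * x}) \<sim>[at_top] F"
  proof (rule asymp_equiv_sandwichI[OF F_pos _ upper_bound])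
    fix e :: real assume "0 < e" "e < 1"
    from lower_bound[OF this]
    show "\<forall>\<^sub>F x in at_top. (1 - e) * F x \<le> prob {\<omega>\<in>space M. h * x < Smax X (nat \<lfloor>T \<omega>\<rfloor>) \<omega>}"
      by eventually_elim (rule order_trans[OF _ le])
  qed
qed

end

theorem theorem3p6:
  fixes M :: "'a measure" and d :: nat
    and X :: "nat \<Rightarrow> 'a \<Rightarrow> real" and J :: "nat \<Rightarrow> 'a \<Rightarrow> nat"
    and \<beta> :: "nat \<Rightarrow> real \<Rightarrow> real" and H :: "nat \<Rightarrow> nat \<Rightarrow> real \<Rightarrow> real"
    and \<pi> :: "nat \<Rightarrow> real" and T :: "'a \<Rightarrow> real"
  assumes MAP: "is_MAP M d X J \<beta> H"
    and stoch: "stochastic_matrix d (Hinf H)"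
    and irred: "irreducible_matrix d (Hinf H)"
    and stat: "stationary_vector d (Hinf H) \<pi>"
    and mean_int: "\<forall>i<d. \<forall>j<d. integrable (interval_measure (H i j)) (\<lambda>y. y)"
    and h_pos: "drift d H \<pi> > 0"
    and T_meas: "T \<in> borel_measurable M"
    and T_indep: "prob_space.indep_set M (rv_events M T) (process_events M X J)"
    and T_C: "class_C (distr M borel T)"
    and Y: "\<exists>\<mu>. subexponential \<mu> \<and>
        (\<forall>i<d. (\<lambda>x. measure (interval_measure (\<beta> i)) {y. \<bar>y\<bar> > x}) \<in> O(tail \<mu>)) \<and>
        (\<forall>i<d. \<forall>j<d. (\<lambda>x. measure (interval_measure (H i j)) {y. \<bar>y\<bar> > x}) \<in> O(tail \<mu>)) \<and>
        ((\<lambda>x. prob_space.expectation M (\<lambda>\<omega>. T \<omega> * indicator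
              {\<omega>. T \<omega> \<le> x \<and> real (Ncount J (T \<omega>) \<omega>) \<le>
                   x / prob_space.expectation M (\<lambda>\<omega>. real (hit_time J 1 \<omega> - hit_time J 0 \<omega>))} \<omega>)
            * tail \<mu> x / tail (distr M borel T) x) \<longlongrightarrow> 0) at_top"
  shows "((\<lambda>x. measure M {\<omega>\<in>space M. Ssum X (nat \<lfloor>T \<omega>\<rfloor>) \<omega> > drift d H \<pi> * x})
           \<sim>[at_top] (\<lambda>x. measure M {\<omega>\<in>space M. T \<omega> > x})) \<and>
         ((\<lambda>x. measure M {\<omega>\<in>space M. Smax X (nat \<lfloor>T \<omega>\<rfloor>) \<omega> > drift d H \<pi> * x})
           \<sim>[at_top] (\<lambda>x. measure M {\<omega>\<in>space M. T \<omega> > x}))"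
proof -
  obtain \<mu> where \<mu>: "\<And>i. i < d \<Longrightarrow> (\<lambda>x. measure (interval_measure (\<beta> i)) {y. \<bar>y\<bar> > x}) \<in> O(tail \<mu>)"
      "\<And>i j. i < d \<Longrightarrow> j < d \<Longrightarrow> (\<lambda>x. measure (interval_measure (H i j)) {y. \<bar>y\<bar> > x}) \<in> O(tail \<mu>)"
      "((\<lambda>x. prob_space.expectation M (\<lambda>\<omega>. T \<omega> * indicator
              {\<omega>. T \<omega> \<le> x \<and> real (Ncount J (T \<omega>) \<omega>) \<le>
                   x / prob_space.expectation M (\<lambda>\<omega>. real (hit_time J 1 \<omega> - hit_time J 0 \<omega>))} \<omega>)
            * tail \<mu> x / tail (distr M borel T) x) \<longlongrightarrow> 0) at_top"
    using Y by blast
  interpret prob_space M using MAP by (simp add: is_MAP_def)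
  interpret sampled_map M d X J \<beta> H \<pi> T \<mu>
  proof
    show "is_MAP M d X J \<beta> H" "stochastic_matrix d (Hinf H)" "irreducible_matrix d (Hinf H)"
      "stationary_vector d (Hinf H) \<pi>" "0 < drift d H \<pi>" "T \<in> borel_measurable M"
      "indep_set (rv_events M T) (process_events M X J)" "class_C (distr M borel T)"
      by fact+
    show "integrable (interval_measure (H i j)) (\<lambda>y. y)" if "i < d" "j < d" for i j
      using mean_int that by blast
  qed (fact \<mu>)+
  show ?thesis using sampled_tail_asymptotics unfolding F_def[abs_def] by blast
qed

end
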